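(* Let $\varphi$ be an Orlicz function whose conjugate $\psi$ is also an Orlicz function, and let $H^\varphi=H^\varphi[0,1]$ be the Orlicz heart. The following statements are equivalent: (1) $H^\varphi$ has the order Banach-Saks property ($oBSP$). (2) $H^\varphi$ has the weak order Banach-Saks property ($w$-$oBSP$). (3) $H^\varphi$ has the Banach-Saks property ($BSP$). (4) $\varphi$ and $\psi$ both have the $\Delta_2$-condition.
   Context: $L^0$ is the vector lattice of real measurable functions on $[0,1]$ (Lebesgue measure), modulo a.e. equality; inequalities are a.e. An Orlicz function is a convex, increasing (i.e. nondecreasing), non-constant function $\varphi:[0,\infty)\to[0,\infty)$ with $\varphi(0)=0$. Its conjugate is $\psi(s)=\sup\{st-\varphi(t):t\ge0\}$, $s\ge0$; $\psi$ is an Orlicz function exactly when it is finite-valued. The Orlicz space $L^\varphi$ is the space of $f\in L^0$ with $\|f\|_\varphi:=\inf\{\lambda>0:\int_0^1\varphi(|f|/\lambda)\,dt\le1\}<\infty$. The Orlicz heart is $H^\varphi=\{f\in L^\varphi:\int_0^1\varphi(|f|/\lambda)\,dt<\infty\ \text{for all }\lambda>0\}$ with norm $\|\cdot\|_\varphi$. An Orlicz function $\varphi$ has the $\Delta_2$-condition if there exist $C>0$ and $t_0>0$ with $\varphi(2t)\le C\varphi(t)$ for all $t>t_0$. A sequence $\{f_n\}$ in $X=H^\varphi$ order converges to $f\in X$ if there is a sequence $\{g_n\}$ in $X$ with $g_n\downarrow0$ and $|f_n-f|\le g_n$ for all $n$; equivalently, $f_n\to f$ a.e. and there is $0\le h\in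 X$ with $|f_n|\le h$ for all $n$. The Cesàro sequence of $\{f_n\}$ is $\{\frac1m\sum_{n=1}^m f_n\}_m$. $X$ has $oBSP$ (resp. $w$-$oBSP$) if every norm bounded (resp. weakly null) sequence in $X$ has a subsequence whose Cesàro sequence order converges in $X$. $X$ has $BSP$ if every norm bounded sequence in $X$ has a subsequence whose Cesàro sequence converges in norm in $X$. *)

theory Defs
  imports "HOL-Analysis.Analysis"
begin

text \<open>
  Elements of the function spaces are represented by measurable functions on the unit interval;
  all order relations between them are almost everywhere relations, so no quotient is formed.
  An Orlicz function is a real function of which only the values on \<open>[0, \<infinity>)\<close> matter.
\<close>

abbreviation unit_interval :: "real measure" where
  "unit_interval \<equiv> lebesgue_on {0..1}"

definition orlicz_function :: "(real \<Rightarrow> real) \<Rightarrow> bool" where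
  "orlicz_function \<phi> \<longleftrightarrow>
     (\<forall>t\<ge>0. 0 \<le> \<phi> t) \<and> convex_on {0..} \<phi> \<and> mono_on {0..} \<phi> \<and> \<phi> 0 = 0 \<and>
     \<not> (\<phi> constant_on {0..})"

definition orlicz_conjugate :: "(real \<Rightarrow> real) \<Rightarrow> real \<Rightarrow> ereal" where
  "orlicz_conjugate \<phi> s = (SUP t\<in>{0..}. ereal (s * t - \<phi> t))"

definition delta2 :: "(real \<Rightarrow> real) \<Rightarrow> bool" where
  "delta2 \<phi> \<longleftrightarrow> (\<exists>C>0. \<exists>t0>0. \<forall>t>t0. \<phi> (2 * t) \<le> C * \<phi> t)"

definition modular :: "(real \<Rightarrow> real) \<Rightarrow> (real \<Rightarrow> real) \<Rightarrow> ennreal" where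
  "modular \<phi> f = (\<integral>\<^sup>+ t. ennreal (\<phi> \<bar>f t\<bar>) \<partial>unit_interval)"

text \<open>The Luxemburg norm, with value \<open>\<infinity>\<close> outside the Orlicz space (infimum of the empty set).\<close>

definition luxemburg_norm :: "(real \<Rightarrow> real) \<Rightarrow> (real \<Rightarrow> real) \<Rightarrow> ennreal" where
  "luxemburg_norm \<phi> f = (INF c \<in> {c. 0 < c \<and> modular \<phi> (\<lambda>t. f t / c) \<le> 1}. ennreal c)"

definition orlicz_space :: "(real \<Rightarrow> real) \<Rightarrow> (real \<Rightarrow> real) set" where
  "orlicz_space \<phi> = {f \<in> borel_measurable unit_interval. luxemburg_norm \<phi> f < \<infinity>}"

definition orlicz_heart :: "(real \<Rightarrow> real) \<Rightarrow> (real \<Rightarrow> real) set" where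
  "orlicz_heart \<phi> = {f \<in> orlicz_space \<phi>. \<forall>c>0. modular \<phi> (\<lambda>t. f t / c) < \<infinity>}"

definition ae_le :: "(real \<Rightarrow> real) \<Rightarrow> (real \<Rightarrow> real) \<Rightarrow> bool" where
  "ae_le f g \<longleftrightarrow> (AE t in unit_interval. f t \<le> g t)"

text \<open>\<open>g\<^sub>n \<down> 0\<close> in the vector lattice: decreasing with greatest lower bound \<open>0\<close> there.\<close>

definition decreases_to_zero :: "(real \<Rightarrow> real) \<Rightarrow> (nat \<Rightarrow> real \<Rightarrow> real) \<Rightarrow> bool" where
  "decreases_to_zero \<phi> g \<longleftrightarrow>
     (\<forall>n. ae_le (g (Suc n)) (g n)) \<and>
     (\<forall>n. ae_le (\<lambda>_. 0) (g n)) \<and>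
     (\<forall>h\<in>orlicz_heart \<phi>. (\<forall>n. ae_le h (g n)) \<longrightarrow> ae_le h (\<lambda>_. 0))"

definition order_converges ::
  "(real \<Rightarrow> real) \<Rightarrow> (nat \<Rightarrow> real \<Rightarrow> real) \<Rightarrow> (real \<Rightarrow> real) \<Rightarrow> bool" where
  "order_converges \<phi> f l \<longleftrightarrow>
     (\<exists>g. (\<forall>n. g n \<in> orlicz_heart \<phi>) \<and> decreases_to_zero \<phi> g \<and>
          (\<forall>n. ae_le (\<lambda>t. \<bar>f n t - l t\<bar>) (g n)))"

definition norm_converges ::
  "(real \<Rightarrow> real) \<Rightarrow> (nat \<Rightarrow> real \<Rightarrow> real) \<Rightarrow> (real \<Rightarrow> real) \<Rightarrow> bool" where
  "norm_converges \<phi> f l \<longleftrightarrow> (\<lambda>n. luxemburg_norm \<phi> (\<lambda>t. f n t - l t)) \<longlonglongrightarrow> 0"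

definition norm_bounded :: "(real \<Rightarrow> real) \<Rightarrow> (nat \<Rightarrow> real \<Rightarrow> real) \<Rightarrow> bool" where
  "norm_bounded \<phi> f \<longleftrightarrow> (\<exists>C::real. \<forall>n. luxemburg_norm \<phi> (f n) \<le> ennreal C)"

text \<open>
  Continuous linear functionals on the Orlicz heart; values outside it are irrelevant.
  The norm bound makes them invariant under almost everywhere equality.
\<close>

definition heart_dual :: "(real \<Rightarrow> real) \<Rightarrow> ((real \<Rightarrow> real) \<Rightarrow> real) set" where
  "heart_dual \<phi> =
     {L. (\<forall>f\<in>orlicz_heart \<phi>. \<forall>g\<in>orlicz_heart \<phi>. L (\<lambda>t. f t + g t) = L f + L g) \<and>
         (\<forall>f\<in>orlicz_heart \<phi>. \<forall>a. L (\<lambda>t. a * f t) = a * L f) \<and>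
         (\<exists>C::real. \<forall>f\<in>orlicz_heart \<phi>. ennreal \<bar>L f\<bar> \<le> ennreal C * luxemburg_norm \<phi> f)}"

definition weakly_null :: "(real \<Rightarrow> real) \<Rightarrow> (nat \<Rightarrow> real \<Rightarrow> real) \<Rightarrow> bool" where
  "weakly_null \<phi> f \<longleftrightarrow> (\<forall>L\<in>heart_dual \<phi>. (\<lambda>n. L (f n)) \<longlonglongrightarrow> 0)"

text \<open>Sequences are indexed from \<open>0\<close>, so the term at \<open>m\<close> averages the first \<open>m + 1\<close> functions.\<close>

definition cesaro :: "(nat \<Rightarrow> real \<Rightarrow> real) \<Rightarrow> nat \<Rightarrow> real \<Rightarrow> real" where
  "cesaro f m = (\<lambda>t. (\<Sum>n<Suc m. f n t) / real (Suc m))"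

definition oBSP :: "(real \<Rightarrow> real) \<Rightarrow> bool" where
  "oBSP \<phi> \<longleftrightarrow>
     (\<forall>f. (\<forall>n. f n \<in> orlicz_heart \<phi>) \<and> norm_bounded \<phi> f \<longrightarrow>
       (\<exists>r::nat \<Rightarrow> nat. strict_mono r \<and>
         (\<exists>l\<in>orlicz_heart \<phi>. order_converges \<phi> (cesaro (f \<circ> r)) l)))"

definition w_oBSP :: "(real \<Rightarrow> real) \<Rightarrow> bool" where
  "w_oBSP \<phi> \<longleftrightarrow>
     (\<forall>f. (\<forall>n. f n \<in> orlicz_heart \<phi>) \<and> weakly_null \<phi> f \<longrightarrow>
       (\<exists>r::nat \<Rightarrow> nat. strict_mono r \<and>
         (\<exists>l\<in>orlicz_heart \<phi>. order_converges \<phi> (cesaro (f \<circ> r)) l)))"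

definition BSP :: "(real \<Rightarrow> real) \<Rightarrow> bool" where
  "BSP \<phi> \<longleftrightarrow>
     (\<forall>f. (\<forall>n. f n \<in> orlicz_heart \<phi>) \<and> norm_bounded \<phi> f \<longrightarrow>
       (\<exists>r::nat \<Rightarrow> nat. strict_mono r \<and>
         (\<exists>l\<in>orlicz_heart \<phi>. norm_converges \<phi> (cesaro (f \<circ> r)) l)))"

end

theory Submission
  imports Defs "HOL-Library.Diagonal_Subsequence"
begin

text \<open>
  By Young's inequality the \<open>\<Delta>\<^sub>2\<close>-condition of the conjugate \<open>\<psi>\<close> is a lower growth condition on \<open>\<phi>\<close>
  itself: for some \<open>l > 1\<close> one has \<open>\<phi> (l t) \<ge> 2 l \<phi> t\<close> for all large \<open>t\<close>
  (\<open>nabla2_if_delta2_conjugate\<close>, \<open>delta2_conjugate_if_nabla2\<close>). So the fourth statement says that \<open>\<phi>\<close>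
  grows at infinity at most polynomially and at least like a power with an exponent \<open>p > 1\<close>.

  Suppose that both growth conditions hold. Then \<open>\<phi>\<close> is equivalent, up to additive and
  multiplicative constants, to a smooth gauge \<open>\<Phi>\<close> with derivative \<open>G\<close> for which
  \<open>\<Phi> \<bar>a + c u\<bar> \<le> \<Phi> \<bar>a\<bar> + c G(a) u + C c\<^sup>p (\<Phi> \<bar>a\<bar> + \<Phi> \<bar>u\<bar>)\<close> when \<open>0 \<le> c \<le> 1\<close> (\<open>Phi_expand\<close>).
  Adding \<open>c u\<close> to a function \<open>v\<close> with \<open>\<integral> G(v) u \<approx> 0\<close> therefore raises the energy \<open>\<integral> \<Phi> \<bar>v\<bar>\<close> only by
  a quantity of order \<open>c\<^sup>p\<close>. A weakly null sequence contains such a \<open>u\<close> arbitrarily far out, for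
  every \<open>v\<close>; picking terms one after the other gives a subsequence whose partial sums \<open>S\<^sub>n\<close> satisfy
  \<open>\<integral> \<Phi> (\<bar>S\<^sub>n\<bar> / n\<^sup>\<theta>) \<le> B\<close> for a fixed \<open>\<theta> < 1\<close> with \<open>\<theta> p > 1\<close> (\<open>selection\<close>). The energies of the
  Cesaro means then decay like a negative power of \<open>n\<close>, so they are summable along a
  grid \<open>n = j\<^sup>a\<close>; between two grid points a Cesaro mean changes by at most a fraction of order
  \<open>1/j\<close> of an average, whose energy is of order \<open>j\<^sup>-\<^sup>p\<close>, again summable. The sum of all these
  terms dominates every Cesaro mean, and its finiteness forces almost everywhere convergence
  (\<open>cesaro_dominated\<close>). This is order convergence, and dominated convergence turns it into norm
  convergence. A norm bounded sequence is reduced to a weakly null one by subtracting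
  a weak limit (\<open>weak_compactness\<close>), and a weakly null sequence is bounded by a gliding hump argument
  (\<open>weakly_null_bounded\<close>).

  Conversely, suppose that a growth condition fails. On disjoint intervals \<open>I\<^sub>k\<close> choose heights \<open>a\<^sub>k\<close> and let
  \<open>f\<^sub>n\<close> be \<open>a\<^sub>k\<close> times a random sign (or zero) on \<open>I\<^sub>k\<close> for \<open>k \<le> n\<close>, independently for different \<open>n\<close>. If the
  modulars of the levels are summable, this sequence is bounded and weakly null
  (\<open>block_sequence_weakly_null\<close>). If \<open>\<phi>\<close> violates \<open>\<Delta>\<^sub>2\<close>, heights with
  \<open>\<phi> (2 a\<^sub>k) \<ge> 16\<^sup>k\<^sup>+\<^sup>1 \<phi> (a\<^sub>k)\<close> outweigh the probability \<open>4\<^sup>-\<^sup>k\<^sup>-\<^sup>1\<close> that \<open>2 k + 2\<close> signs agree, and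
  when they agree some Cesaro mean is at least \<open>a\<^sub>k / 2\<close>. If the lower growth condition fails, \<open>\<phi>\<close> is almost linear on
  long stretches, and the divergence of the harmonic series prevents \<open>sup\<^sub>m \<bar>f\<^sub>m\<bar> / m\<close> from lying in the heart. In
  both cases no subsequence has order bounded Cesaro means. For norm convergence the
  counterexamples are partial sums that behave like the summing basis of \<open>c\<^sub>0\<close>
  (\<open>not_BSP_if_not_delta2\<close>) and normalized functions that behave like the unit vectors of \<open>l\<^sup>1\<close>
  (\<open>not_BSP_if_not_nabla2\<close>).
\<close>

section \<open>Orlicz functions and Orlicz hearts\<close>

lemma ennreal_between: "0 < (a::ennreal) \<Longrightarrow> \<exists>c>0. ennreal c < a"
proof (cases a)
  case (real r)
  then show "0 < a \<Longrightarrow> \<exists>c>0. ennreal c < a" by (intro exI[of _ "r/2"]) (simp add: ennreal_lessI)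
qed (auto intro!: exI[of _ 1])

lemma emeasure_unit: "emeasure unit_interval (space unit_interval) = 1"
  by (simp add: emeasure_restrict_space space_restrict_space)

lemma measure_unit: "measure unit_interval (space unit_interval) = 1"
  using emeasure_unit by (simp only: measure_def) simp

lemma finite_measure_unit: "finite_measure unit_interval"
  by (rule finite_measureI) (simp only: emeasure_unit, simp)

lemma bounded_integrable:
  assumes "f \<in> borel_measurable unit_interval" "\<And>t. \<bar>f t\<bar> \<le> B"
  shows "integrable unit_interval (f :: real \<Rightarrow> real)"
  using finite_measure.integrable_const_bound[OF finite_measure_unit, of f B] assms by simp

lemma borel_in_unit: "A \<in> sets borel \<Longrightarrow> A \<subseteq> {0..1::real} \<Longrightarrow> A \<in> sets unit_interval"
  by (auto simp: sets_restrict_space_iff)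

locale orlicz =
  fixes \<phi> :: "real \<Rightarrow> real"
  assumes orlicz: "orlicz_function \<phi>"
begin

lemma nonneg: "0 \<le> t \<Longrightarrow> 0 \<le> \<phi> t"
  using orlicz by (simp add: orlicz_function_def)

lemma zero [simp]: "\<phi> 0 = 0"
  using orlicz by (simp add: orlicz_function_def)

lemma conv: "convex_on {0..} \<phi>"
  using orlicz by (simp add: orlicz_function_def)

lemma mono: "0 \<le> s \<Longrightarrow> s \<le> t \<Longrightarrow> \<phi> s \<le> \<phi> t"
  using orlicz by (auto simp: orlicz_function_def mono_on_def)

lemma scale: 
  assumes "0 \<le> c" "c \<le> 1" "0 \<le> t" shows "\<phi> (c * t) \<le> c * \<phi> t"
  using convex_onD[OF conv, of c 0 t] assms by simp

lemma slope: 
  assumes "0 < s" "s \<le> t" shows "\<phi> s / s \<le> \<phi> t / t"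
  using scale[of "s/t" t] assms by (simp add: field_simps)

lemma add_le_half: 
  assumes "0 \<le> x" "0 \<le> y" shows "\<phi> (x + y) \<le> (\<phi> (2 * x) + \<phi> (2 * y)) / 2"
  using convex_onD[OF conv, of "1/2" "2*x" "2*y"] assms by (simp add: field_simps)

text \<open>
  Convexity and \<open>\<phi> 0 = 0\<close> bound each summand by its share \<open>x / (x + y)\<close> of \<open>\<phi> (x + y)\<close>.
\<close>

lemma superadd: 
  assumes "0 \<le> x" "0 \<le> y" shows "\<phi> x + \<phi> y \<le> \<phi> (x + y)"
proof (cases "x + y = 0")
  case True then show ?thesis using assms by (simp add: add_nonneg_eq_0_iff)
next
  case False
  then have p: "x + y > 0" using assms by simp
  have "\<phi> x \<le> x / (x+y) * \<phi> (x+y)" using scale[of "x/(x+y)" "x+y"] assms p by simp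
  moreover have "\<phi> y \<le> y / (x+y) * \<phi> (x+y)" using scale[of "y/(x+y)" "x+y"] assms p by simp
  moreover have "x / (x+y) * \<phi> (x+y) + y / (x+y) * \<phi> (x+y) = \<phi> (x+y)"
    using p by (simp add: add_divide_distrib[symmetric] distrib_right[symmetric])
  ultimately show ?thesis by linarith
qed

lemma superadd_sum:
  assumes "finite A" "\<And>i. i \<in> A \<Longrightarrow> 0 \<le> x i" shows "(\<Sum>i\<in>A. \<phi> (x i)) \<le> \<phi> (\<Sum>i\<in>A. x i)"
  using assms
proof (induction A rule: finite_induct)
  case (insert a A)
  have "\<phi> (x a) + \<phi> (\<Sum>i\<in>A. x i) \<le> \<phi> (x a + (\<Sum>i\<in>A. x i))"
    using insert by (intro superadd sum_nonneg) auto
  with insert show ?case by auto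
qed simp

lemma positive_somewhere: "\<exists>u>0. \<phi> u > 0"
proof -
  have "\<not> (\<phi> constant_on {0..})" using orlicz by (simp add: orlicz_function_def)
  then obtain u where u: "u \<ge> 0" "\<phi> u \<noteq> 0" unfolding constant_on_def by auto
  then have "u \<noteq> 0" by auto
  with u nonneg[of u] have "u > 0 \<and> \<phi> u > 0" by auto
  then show ?thesis by blast
qed

lemma large: "\<exists>T>0. \<forall>t\<ge>T. B \<le> \<phi> t"
proof -
  obtain u where u: "u > 0" "\<phi> u > 0" using positive_somewhere by blast
  define T where "T = u * max 1 (B / \<phi> u)"
  have "T > 0" using u by (simp add: T_def)
  moreover have "B \<le> \<phi> t" if "t \<ge> T" for t
  proof -
    have "u \<le> T" using u by (simp add: T_def)
    then have "u \<le> t" using that by simp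
    then have "\<phi> u / u \<le> \<phi> t / t" using slope u by blast
    then have "t * \<phi> u / u \<le> \<phi> t" using u \<open>u \<le> t\<close> by (simp add: field_simps)
    moreover have "B \<le> T * \<phi> u / u" using u by (simp add: T_def field_simps max_def)
    moreover have "T * \<phi> u / u \<le> t * \<phi> u / u" using that u by (simp add: divide_right_mono mult_right_mono)
    ultimately show ?thesis by linarith
  qed
  ultimately show ?thesis by blast
qed

lemma measurable_compose [measurable]:
  assumes "f \<in> borel_measurable M" shows "(\<lambda>t. \<phi> \<bar>f t\<bar>) \<in> borel_measurable M"
proof -
  have "mono (\<lambda>x. \<phi> (max 0 x))" by (rule monoI) (auto intro!: mono)
  then have "(\<lambda>x. \<phi> (max 0 x)) \<in> borel_measurable borel" by (rule borel_measurable_mono)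
  from measurable_compose[OF _ this, of "\<lambda>t. \<bar>f t\<bar>" M] assms show ?thesis by simp
qed

abbreviation modul ("\<rho>") where "\<rho> \<equiv> modular \<phi>"

lemma modular_mono:
  assumes "AE t in unit_interval. \<bar>f t\<bar> \<le> \<bar>h t\<bar>" shows "\<rho> f \<le> \<rho> h"
  unfolding modular_def
  by (intro nn_integral_mono_AE) (use assms in \<open>eventually_elim, auto intro!: ennreal_leI mono\<close>)

lemma modular_scale:
  assumes [measurable]: "f \<in> borel_measurable unit_interval" and "c \<ge> 1"
  shows "\<rho> (\<lambda>t. f t / c) \<le> ennreal (1/c) * \<rho> f"
proof -
  have "\<rho> (\<lambda>t. f t / c) \<le> (\<integral>\<^sup>+ t. ennreal (1/c) * ennreal (\<phi> \<bar>f t\<bar>) \<partial>unit_interval)"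
    unfolding modular_def
  proof (intro nn_integral_mono)
    fix t
    have "\<phi> (\<bar>f t\<bar> / c) \<le> 1/c * \<phi> \<bar>f t\<bar>" using scale[of "1/c" "\<bar>f t\<bar>"] \<open>c \<ge> 1\<close> by simp
    then show "ennreal (\<phi> \<bar>f t / c\<bar>) \<le> ennreal (1/c) * ennreal (\<phi> \<bar>f t\<bar>)"
      using \<open>c \<ge> 1\<close> by (simp add: ennreal_mult'[symmetric] ennreal_leI nonneg)
  qed
  also have "\<dots> = ennreal (1/c) * \<rho> f" unfolding modular_def by (rule nn_integral_cmult) measurable
  finally show ?thesis .
qed

lemma modular_add:
  assumes [measurable]: "f \<in> borel_measurable unit_interval" "h \<in> borel_measurable unit_interval"
  shows "\<rho> (\<lambda>t. f t + h t) \<le> \<rho> (\<lambda>t. 2 * f t) + \<rho> (\<lambda>t. 2 * h t)"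
proof -
  have "\<rho> (\<lambda>t. f t + h t) \<le> (\<integral>\<^sup>+ t. ennreal (\<phi> \<bar>2 * f t\<bar>) + ennreal (\<phi> \<bar>2 * h t\<bar>) \<partial>unit_interval)"
    unfolding modular_def
  proof (intro nn_integral_mono)
    fix t
    have "\<phi> \<bar>f t + h t\<bar> \<le> \<phi> (\<bar>f t\<bar> + \<bar>h t\<bar>)" by (intro mono) auto
    also have "\<dots> \<le> (\<phi> (2 * \<bar>f t\<bar>) + \<phi> (2 * \<bar>h t\<bar>)) / 2" by (rule add_le_half) auto
    also have "\<dots> \<le> \<phi> (\<bar>2 * f t\<bar>) + \<phi> (\<bar>2 * h t\<bar>)"
      using nonneg[of "2 * \<bar>f t\<bar>"] nonneg[of "2 * \<bar>h t\<bar>"] by (simp add: abs_mult)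
    finally show "ennreal (\<phi> \<bar>f t + h t\<bar>) \<le> ennreal (\<phi> \<bar>2 * f t\<bar>) + ennreal (\<phi> \<bar>2 * h t\<bar>)"
      by (simp add: ennreal_plus[symmetric] nonneg ennreal_leI del: ennreal_plus)
  qed
  also have "\<dots> = \<rho> (\<lambda>t. 2 * f t) + \<rho> (\<lambda>t. 2 * h t)"
    unfolding modular_def by (rule nn_integral_add) measurable
  finally show ?thesis .
qed

lemma norm_leI: "0 < c \<Longrightarrow> \<rho> (\<lambda>t. f t / c) \<le> 1 \<Longrightarrow> luxemburg_norm \<phi> f \<le> ennreal c"
  unfolding luxemburg_norm_def by (rule INF_lower) simp

lemma modular_le_1:
  assumes "luxemburg_norm \<phi> f < ennreal c" shows "\<rho> (\<lambda>t. f t / c) \<le> 1"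
proof -
  obtain d where d: "0 < d" "\<rho> (\<lambda>t. f t / d) \<le> 1" "ennreal d < ennreal c"
    using assms unfolding luxemburg_norm_def INF_less_iff by auto
  then have "d < c" by (metis ennreal_less_iff less_imp_le)
  then have "\<rho> (\<lambda>t. f t / c) \<le> \<rho> (\<lambda>t. f t / d)"
    by (intro modular_mono AE_I2) (use d in \<open>auto intro!: divide_left_mono\<close>)
  with d show ?thesis by simp
qed

abbreviation "H \<equiv> orlicz_heart \<phi>"

lemma heartD:
  assumes "f \<in> H"
  shows "f \<in> borel_measurable unit_interval" "c > 0 \<Longrightarrow> \<rho> (\<lambda>t. f t / c) < \<infinity>"
  using assms by (auto simp: orlicz_heart_def orlicz_space_def)

lemma heartD_mult:
  assumes "f \<in> H" shows "\<rho> (\<lambda>t. c * f t) < \<infinity>"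
proof -
  have "\<rho> (\<lambda>t. c * f t) \<le> \<rho> (\<lambda>t. f t / (1 / (\<bar>c\<bar> + 1)))"
    by (intro modular_mono AE_I2) (simp add: abs_mult mult.commute[of "\<bar>c\<bar>"] mult_left_mono)
  also have "\<dots> < \<infinity>" by (rule heartD(2)[OF assms]) simp
  finally show ?thesis .
qed

lemma heartI:
  assumes f [measurable]: "f \<in> borel_measurable unit_interval"
    and fin: "\<And>c. c > 0 \<Longrightarrow> \<rho> (\<lambda>t. c * f t) < \<infinity>"
  shows "f \<in> H"
proof -
  have fin': "\<rho> (\<lambda>t. f t / c) < \<infinity>" if "c > 0" for c
    using fin[of "1/c"] that by simp
  define C where "C = enn2real (\<rho> f) + 1"
  have "C \<ge> 1" by (simp add: C_def)
  have "\<rho> f < \<infinity>" using fin[of 1] by simp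
  then have le: "\<rho> f \<le> ennreal C" unfolding C_def
    by (metis ennreal_enn2real ennreal_leI infinity_ennreal_def le_add_same_cancel1 zero_le_one)
  have "\<rho> (\<lambda>t. f t / C) \<le> ennreal (1/C) * \<rho> f" using \<open>C \<ge> 1\<close> by (intro modular_scale) auto
  also have "\<dots> \<le> ennreal (1/C) * ennreal C" using le by (rule mult_left_mono) simp
  also have "\<dots> = 1" using \<open>C \<ge> 1\<close> by (simp add: ennreal_mult'[symmetric])
  finally have "luxemburg_norm \<phi> f \<le> ennreal C" using \<open>C \<ge> 1\<close> by (intro norm_leI) auto
  then have "luxemburg_norm \<phi> f < \<infinity>" by (rule le_less_trans) simp
  with fin' f show ?thesis by (simp add: orlicz_heart_def orlicz_space_def)
qed

lemma heart_dominated: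
  assumes h: "h \<in> H" and f: "f \<in> borel_measurable unit_interval"
    and le: "AE t in unit_interval. \<bar>f t\<bar> \<le> \<bar>h t\<bar>"
  shows "f \<in> H"
proof (rule heartI[OF f])
  fix c :: real assume "c > 0"
  have "\<rho> (\<lambda>t. c * f t) \<le> \<rho> (\<lambda>t. c * h t)"
    by (rule modular_mono) (use le \<open>c > 0\<close> in \<open>auto simp: abs_mult mult_left_mono elim!: eventually_mono\<close>)
  also have "\<dots> < \<infinity>" by (rule heartD_mult[OF h])
  finally show "\<rho> (\<lambda>t. c * f t) < \<infinity>" .
qed

lemma heart_add:
  assumes f: "f \<in> H" and h: "h \<in> H" shows "(\<lambda>t. f t + h t) \<in> H"
proof (rule heartI)
  note [measurable] = heartD(1)[OF f] heartD(1)[OF h]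
  show "(\<lambda>t. f t + h t) \<in> borel_measurable unit_interval" by measurable
  fix c :: real assume "c > 0"
  have "\<rho> (\<lambda>t. c * f t + c * h t) \<le> \<rho> (\<lambda>t. 2 * (c * f t)) + \<rho> (\<lambda>t. 2 * (c * h t))"
    by (rule modular_add) measurable
  also have "\<dots> < \<infinity>" using heartD_mult[OF f, of "2*c"] heartD_mult[OF h, of "2*c"]
    by (simp add: mult.assoc)
  finally show "\<rho> (\<lambda>t. c * (f t + h t)) < \<infinity>" by (simp add: distrib_left)
qed

lemma heart_cmult:
  assumes f: "f \<in> H" shows "(\<lambda>t. a * f t) \<in> H"
proof (rule heartI)
  note [measurable] = heartD(1)[OF f]
  show "(\<lambda>t. a * f t) \<in> borel_measurable unit_interval" by measurable
  fix c :: real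
  show "\<rho> (\<lambda>t. c * (a * f t)) < \<infinity>" using heartD_mult[OF f, of "c*a"] by (simp add: mult.assoc)
qed

lemma heart_diff: "f \<in> H \<Longrightarrow> h \<in> H \<Longrightarrow> (\<lambda>t. f t - h t) \<in> H"
  using heart_add[of f "\<lambda>t. - 1 * h t"] heart_cmult[of h "-1"] by simp

lemma heart_abs: "f \<in> H \<Longrightarrow> (\<lambda>t. \<bar>f t\<bar>) \<in> H"
  by (rule heart_dominated[of f]) (auto dest: heartD(1))

lemma heart_bounded:
  assumes f: "f \<in> borel_measurable unit_interval" and le: "AE t in unit_interval. \<bar>f t\<bar> \<le> B"
  shows "f \<in> H"
proof (rule heart_dominated[OF _ f])
  show "(\<lambda>t. B) \<in> H"
  proof (rule heartI)
    fix c :: real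
    have "\<rho> (\<lambda>t. c * B) = ennreal (\<phi> \<bar>c * B\<bar>) * emeasure unit_interval (space unit_interval)"
      unfolding modular_def by (rule nn_integral_const)
    then show "\<rho> (\<lambda>t. c * B) < \<infinity>" unfolding emeasure_unit by simp
  qed simp
  show "AE t in unit_interval. \<bar>f t\<bar> \<le> \<bar>B\<bar>" using le by eventually_elim auto
qed

lemma heart_sum: "(\<And>i. i \<in> A \<Longrightarrow> f i \<in> H) \<Longrightarrow> (\<lambda>t. \<Sum>i\<in>A. f i t) \<in> H"
proof (induction A rule: infinite_finite_induct)
  case (insert x F) then show ?case using heart_add[of "f x" "\<lambda>t. \<Sum>i\<in>F. f i t"] by simp
qed (auto intro!: heart_bounded[of _ 0])

lemma cesaro_heart: "(\<And>n. f n \<in> H) \<Longrightarrow> cesaro f m \<in> H"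
  unfolding cesaro_def
  using heart_cmult[OF heart_sum[of "{..<Suc m}" f], of "1 / real (Suc m)"] by simp

text \<open>
  A convex function that is positive somewhere lies above a line of positive slope, so the modular
  controls the integral; this is how statements about norm limits become almost everywhere statements.
\<close>

lemma L1_bound:
  "\<exists>K>0. \<forall>f c. f \<in> borel_measurable unit_interval \<longrightarrow> c > 0 \<longrightarrow> \<rho> (\<lambda>t. f t / c) \<le> 1 \<longrightarrow>
     (\<integral>\<^sup>+ t. ennreal \<bar>f t\<bar> \<partial>unit_interval) \<le> ennreal (K * c)"
proof -
  obtain u where u: "u > 0" "\<phi> u > 0" using positive_somewhere by blast
  define K where "K = u + u / \<phi> u"
  have le: "x \<le> u + u / \<phi> u * \<phi> x" if "x \<ge> 0" for x
  proof (cases "x \<le> u")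
    case True then show ?thesis using u nonneg[OF that] by (simp add: add_increasing2)
  next
    case False
    then have "\<phi> u / u \<le> \<phi> x / x" using u by (intro slope) auto
    then have "x \<le> u / \<phi> u * \<phi> x" using u False by (simp add: field_simps)
    then show ?thesis using u by simp
  qed
  have "(\<integral>\<^sup>+ t. ennreal \<bar>f t\<bar> \<partial>unit_interval) \<le> ennreal (K * c)"
    if [measurable]: "f \<in> borel_measurable unit_interval" and c: "c > 0" and r: "\<rho> (\<lambda>t. f t / c) \<le> 1" for f c
  proof -
    have "(\<integral>\<^sup>+ t. ennreal \<bar>f t\<bar> \<partial>unit_interval) 
      \<le> (\<integral>\<^sup>+ t. ennreal (c * u) + ennreal (c * u / \<phi> u) * ennreal (\<phi> \<bar>f t / c\<bar>) \<partial>unit_interval)"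
    proof (intro nn_integral_mono)
      fix t
      have "\<bar>f t\<bar> = c * \<bar>f t / c\<bar>" using c by simp
      also have "\<dots> \<le> c * (u + u / \<phi> u * \<phi> \<bar>f t / c\<bar>)"
        by (intro mult_left_mono le) (use c in auto)
      also have "\<dots> = c * u + c * u / \<phi> u * \<phi> \<bar>f t / c\<bar>" by (simp add: algebra_simps)
      finally have "ennreal \<bar>f t\<bar> \<le> ennreal (c * u + c * u / \<phi> u * \<phi> \<bar>f t / c\<bar>)" by (rule ennreal_leI)
      also have "\<dots> = ennreal (c * u) + ennreal (c * u / \<phi> u) * ennreal (\<phi> \<bar>f t / c\<bar>)"
        using c u by (subst ennreal_plus) (auto simp: ennreal_mult'[symmetric] nonneg simp del: ennreal_plus)
      finally show "ennreal \<bar>f t\<bar> \<le> \<dots>" .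
    qed
    also have "\<dots> = ennreal (c * u) + ennreal (c * u / \<phi> u) * \<rho> (\<lambda>t. f t / c)"
      unfolding modular_def
      by (subst nn_integral_add, measurable, subst nn_integral_cmult, measurable)
        (simp only: nn_integral_const emeasure_unit mult_1_right)
    also have "\<dots> \<le> ennreal (c * u) + ennreal (c * u / \<phi> u) * 1"
      by (intro add_left_mono mult_left_mono r) auto
    also have "\<dots> = ennreal (K * c)" using c u
      by (simp add: K_def ennreal_plus[symmetric] algebra_simps del: ennreal_plus)
    finally show ?thesis .
  qed
  moreover have "K > 0" using u by (simp add: K_def add_pos_pos)
  ultimately show ?thesis by blast
qed

text \<open>
  Norm convergence is used only through modulars: this rule and the next one avoid the triangle
  inequality for the Luxemburg norm.
\<close>

lemma norm_convergesI:
  assumes "\<And>c. c > 0 \<Longrightarrow> \<forall>\<^sub>F n in sequentially. \<rho> (\<lambda>t. (f n t - l t) / c) \<le> 1"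
  shows "norm_converges \<phi> f l"
  unfolding norm_converges_def
proof (rule order_tendstoI)
  fix a :: ennreal assume "0 < a"
  obtain c where c: "0 < c" "ennreal c < a" using ennreal_between[OF \<open>0 < a\<close>] by blast
  show "\<forall>\<^sub>F n in sequentially. luxemburg_norm \<phi> (\<lambda>t. f n t - l t) < a"
    using assms[OF c(1)] by eventually_elim (use norm_leI[OF c(1)] c in \<open>meson le_less_trans\<close>)
qed simp

lemma norm_convergesD:
  assumes "norm_converges \<phi> f l" "c > 0"
  shows "\<forall>\<^sub>F n in sequentially. \<rho> (\<lambda>t. (f n t - l t) / c) \<le> 1"
proof -
  have "\<forall>\<^sub>F n in sequentially. luxemburg_norm \<phi> (\<lambda>t. f n t - l t) < ennreal c"
    using assms unfolding norm_converges_def by (intro order_tendstoD(2)) auto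
  then show ?thesis by eventually_elim (rule modular_le_1)
qed

lemma norm_boundedI:
  assumes "\<And>n. \<rho> (f n) \<le> 1" shows "norm_bounded \<phi> f"
  unfolding norm_bounded_def by (rule exI[of _ 1], intro allI norm_leI) (use assms in auto)

lemma norm_boundedD:
  assumes "norm_bounded \<phi> f" obtains c where "c > 0" "\<And>n. \<rho> (\<lambda>t. f n t / c) \<le> 1"
proof -
  obtain C where C: "\<And>n. luxemburg_norm \<phi> (f n) \<le> ennreal C" using assms by (auto simp: norm_bounded_def)
  have "\<rho> (\<lambda>t. f n t / (\<bar>C\<bar> + 1)) \<le> 1" for n
    proof (rule modular_le_1)
    have "ennreal C < ennreal (\<bar>C\<bar> + 1)" by (rule ennreal_lessI) auto
    with C[of n] show "luxemburg_norm \<phi> (f n) < ennreal (\<bar>C\<bar> + 1)" by (rule le_less_trans)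
  qed
  then show ?thesis by (intro that[of "\<bar>C\<bar> + 1"]) auto
qed

text \<open>
  The only consequence of order convergence that the counterexamples have to contradict.
\<close>

lemma order_converges_dominated:
  assumes l: "l \<in> H" and oc: "order_converges \<phi> f l" 
  obtains h where "h \<in> H" "AE t in unit_interval. \<forall>n. \<bar>f n t\<bar> \<le> h t"
proof -
  obtain g where g: "\<And>n. g n \<in> H" "decreases_to_zero \<phi> g" 
     "\<And>n. AE t in unit_interval. \<bar>f n t - l t\<bar> \<le> g n t"
    using oc unfolding order_converges_def ae_le_def by blast
  have dec: "AE t in unit_interval. g (Suc n) t \<le> g n t" for n
    using g(2) by (auto simp: decreases_to_zero_def ae_le_def)
  have "AE t in unit_interval. \<forall>n. g (Suc n) t \<le> g n t" using dec by (simp add: AE_all_countable)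
  moreover have "AE t in unit_interval. \<forall>n. \<bar>f n t - l t\<bar> \<le> g n t" using g(3) by (simp add: AE_all_countable)
  ultimately have "AE t in unit_interval. \<forall>n. \<bar>f n t\<bar> \<le> \<bar>l t\<bar> + g 0 t"
  proof eventually_elim
    fix t assume a: "\<forall>n. g (Suc n) t \<le> g n t" "\<forall>n. \<bar>f n t - l t\<bar> \<le> g n t"
    have "g n t \<le> g 0 t" for n by (rule lift_Suc_antimono_le[of "\<lambda>n. g n t"]) (use a in auto)
    then show "\<forall>n. \<bar>f n t\<bar> \<le> \<bar>l t\<bar> + g 0 t" using a(2) 
      by (metis (no_types, opaque_lifting) abs_triangle_ineq2 add.commute diff_le_eq dual_order.trans)
  qed
  moreover have "(\<lambda>t. \<bar>l t\<bar> + g 0 t) \<in> H" by (intro heart_add heart_abs l g)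
  ultimately show ?thesis using that by blast
qed

end

section \<open>Growth conditions and conjugates\<close>

text \<open>
  The lower growth condition dual to \<open>\<Delta>\<^sub>2\<close>: iterating it shows that \<open>\<phi>\<close> grows at least like
  \<open>t\<^sup>p\<close> with \<open>p = 1 + log\<^sub>l 2\<close>.
\<close>

definition nabla2 :: "(real \<Rightarrow> real) \<Rightarrow> bool" where
  "nabla2 \<phi> \<longleftrightarrow> (\<exists>l>1. \<exists>t1>0. \<forall>t\<ge>t1. 2 * l * \<phi> t \<le> \<phi> (l * t))"

locale orlicz_pair = orlicz \<phi> for \<phi> +
  fixes \<psi> :: "real \<Rightarrow> real"
  assumes conjugate: "s \<ge> 0 \<Longrightarrow> ereal (\<psi> s) = orlicz_conjugate \<phi> s" and orlicz': "orlicz_function \<psi>"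
begin

sublocale conj: orlicz \<psi> by unfold_locales (rule orlicz')

lemma young: "0 \<le> s \<Longrightarrow> 0 \<le> t \<Longrightarrow> s * t - \<phi> t \<le> \<psi> s"
  using conjugate[of s] SUP_upper[of t "{0..}" "\<lambda>t. ereal (s * t - \<phi> t)"]
  by (simp add: orlicz_conjugate_def flip: ereal_less_eq(3))

lemma conjugate_least:
  assumes "0 \<le> s" "\<And>t. 0 \<le> t \<Longrightarrow> s * t - \<phi> t \<le> x" shows "\<psi> s \<le> x"
proof -
  have "orlicz_conjugate \<phi> s \<le> ereal x"
    unfolding orlicz_conjugate_def by (rule SUP_least) (use assms in auto)
  then show ?thesis using conjugate[OF assms(1)] by (metis ereal_less_eq(3))
qed

lemma subgradient:
  assumes t: "0 < t" obtains s where "\<And>u. 0 \<le> u \<Longrightarrow> \<phi> t + s * (u - t) \<le> \<phi> u"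
proof -
  have "t \<in> interior {0..}" using t by simp
  from convex_le_Inf_differential[OF conv this] show ?thesis by (intro that) auto
qed

text \<open>
  If \<open>s\<close> is a slope of \<open>\<phi>\<close> at \<open>t\<close>, Young's inequality is an equality at \<open>(s, t)\<close>; applying it at
  \<open>(2 s, l t)\<close> with \<open>2 l\<close> at least the \<open>\<Delta>\<^sub>2\<close>-constant of \<open>\<psi>\<close> gives \<open>\<phi> (l t) \<ge> 2 l \<phi> t\<close>. The conjugate is finite,
  so \<open>\<phi>\<close> is superlinear and \<open>s\<close> is large when \<open>t\<close> is.
\<close>

lemma nabla2_if_delta2_conjugate:
  assumes "delta2 \<psi>" shows "nabla2 \<phi>"
proof -
  obtain C s0 where C: "C > 0" "s0 > 0" "\<And>s. s > s0 \<Longrightarrow> \<psi> (2 * s) \<le> C * \<psi> s"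
    using assms unfolding delta2_def by blast
  define l where "l = max C 4 / 2"
  have l: "l > 1" "2 * l \<ge> C" by (auto simp: l_def)
  define t1 where "t1 = \<psi> (s0 + 1) + 1"
  have t1: "t1 > 0" using conj.nonneg[of "s0 + 1"] C(2) by (simp add: t1_def)
  have "2 * l * \<phi> t \<le> \<phi> (l * t)" if t: "t \<ge> t1" for t
  proof -
    have t0: "t > 0" using t t1 by simp
    obtain s where s: "\<And>u. 0 \<le> u \<Longrightarrow> \<phi> t + s * (u - t) \<le> \<phi> u" using subgradient[OF t0] by blast
    have "s0 * t < \<phi> t" using young[of "s0 + 1" t] C(2) t t0 by (simp add: t1_def algebra_simps)
    also have "\<phi> t \<le> s * t" using s[of 0] by simp
    finally have ss: "s > s0" using t0 by simp
    have "\<psi> s \<le> s * t - \<phi> t"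
    proof (rule conjugate_least)
      fix u :: real assume "0 \<le> u"
      from s[OF this] show "s * u - \<phi> u \<le> s * t - \<phi> t" by (simp add: algebra_simps)
    qed (use ss C(2) in simp)
    then have "2 * l * \<phi> t \<le> 2 * l * (s * t - \<psi> s)" using l by (intro mult_left_mono) auto
    also have "\<dots> = 2 * s * (l * t) - 2 * l * \<psi> s" by (simp add: algebra_simps)
    also have "\<dots> \<le> 2 * s * (l * t) - C * \<psi> s"
      using conj.nonneg[of s] ss C(2) l(2) by (intro diff_left_mono mult_right_mono) auto
    also have "\<dots> \<le> 2 * s * (l * t) - \<psi> (2 * s)" using C(3)[OF ss] by simp
    also have "\<dots> \<le> \<phi> (l * t)" using young[of "2 * s" "l * t"] ss C(2) l t0 by simp
    finally show ?thesis .
  qed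
  then show ?thesis unfolding nabla2_def using l t1 by blast
qed

text \<open>
  In the supremum that defines \<open>\<psi> (2 s)\<close> the points \<open>t = l u\<close> with \<open>u \<ge> t1\<close> contribute at most
  \<open>2 l (s u - \<phi> u) \<le> 2 l \<psi> s\<close>, and the bounded range of smaller \<open>t\<close> contributes at most a multiple of \<open>s\<close>, which
  \<open>\<psi> s\<close> dominates.
\<close>

lemma delta2_conjugate_if_nabla2:
  assumes "nabla2 \<phi>" shows "delta2 \<psi>"
proof -
  obtain l t1 where l: "l > 1" "t1 > 0" "\<And>t. t \<ge> t1 \<Longrightarrow> 2 * l * \<phi> t \<le> \<phi> (l * t)"
    using assms unfolding nabla2_def by blast
  \<comment> \<open>For \<open>s > s0\<close> the point \<open>t1\<close> alone gives \<open>\<psi> s \<ge> s t1 / 2\<close>.\<close>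
  define s0 where "s0 = 2 * \<phi> t1 / t1 + 1"
  have s0: "s0 > 0" using nonneg[of t1] l(2) by (simp add: s0_def add_nonneg_pos)
  have "\<psi> (2 * s) \<le> 4 * l * \<psi> s" if s: "s > s0" for s
  proof (rule conjugate_least)
    have s': "s > 0" using s s0 by simp
    then show "0 \<le> 2 * s" by simp
    fix t :: real assume t: "0 \<le> t"
    show "2 * s * t - \<phi> t \<le> 4 * l * \<psi> s"
    proof (cases "t \<ge> l * t1")
      case True
      define u where "u = t / l"
      have u: "u \<ge> t1" "t = l * u" using True l by (auto simp: u_def field_simps)
      have "2 * s * t - \<phi> t \<le> 2 * l * (s * u - \<phi> u)" using l(3)[OF u(1)] by (simp add: u(2) algebra_simps)
      also have "\<dots> \<le> 2 * l * \<psi> s" using young[of s u] s' u l by (intro mult_left_mono) auto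
      also have "\<dots> \<le> 4 * l * \<psi> s" using conj.nonneg[of s] s' l by (intro mult_right_mono) auto
      finally show ?thesis .
    next
      case False
      have "2 * \<phi> t1 \<le> s * t1" using s l(2) by (simp add: s0_def field_simps)
      then have "s * t1 / 2 \<le> \<psi> s" using young[of s t1] s' l by simp
      have "2 * s * t \<le> 2 * s * (l * t1)" using False s' by (intro mult_left_mono) auto
      then have "2 * s * t - \<phi> t \<le> 2 * s * (l * t1)" using nonneg[OF t] by linarith
      also have "\<dots> = 4 * l * (s * t1 / 2)" by simp
      also have "\<dots> \<le> 4 * l * \<psi> s" using \<open>s * t1 / 2 \<le> \<psi> s\<close> l by (intro mult_left_mono) auto
      finally show ?thesis .
    qed
  qed
  moreover have "4 * l > 0" using l by simp
  ultimately show ?thesis unfolding delta2_def using s0 by blast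
qed

end


section \<open>Digits as independent random variables\<close>

definition digit :: "nat \<Rightarrow> nat \<Rightarrow> real \<Rightarrow> int" where
  "digit b n x = \<lfloor>real b ^ Suc n * x\<rfloor> mod int b"

definition cylinder :: "nat \<Rightarrow> nat set \<Rightarrow> (nat \<Rightarrow> int set) \<Rightarrow> real set" where
  "cylinder b F S = {x \<in> {0..<1}. \<forall>n\<in>F. digit b n x \<in> S n}"

lemma digit_measurable [measurable]: "digit b n \<in> borel \<rightarrow>\<^sub>M count_space UNIV"
  unfolding digit_def by measurable

lemma cylinder_sets [measurable]: "finite F \<Longrightarrow> cylinder b F S \<in> sets borel"
  unfolding cylinder_def by measurable

lemma digit_range: "b > 0 \<Longrightarrow> digit b n x \<in> {0..<int b}"
  by (simp add: digit_def)

lemma digit_shift_Suc: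
  assumes "b > 0" shows "digit b (Suc n) ((of_int j + y) / real b) = digit b n y"
proof -
  have "real b ^ Suc (Suc n) * ((of_int j + y) / real b) = of_int (int b ^ Suc n * j) + real b ^ Suc n * y"
    using assms by (simp add: field_simps)
  then have "\<lfloor>real b ^ Suc (Suc n) * ((of_int j + y) / real b)\<rfloor> = int b ^ Suc n * j + \<lfloor>real b ^ Suc n * y\<rfloor>"
    by (metis add.commute floor_add_int)
  then show ?thesis by (simp add: digit_def mult.assoc)
qed

lemma digit_shift_0:
  assumes "b > 0" "j \<in> {0..<int b}" "y \<in> {0..<1}"
  shows "digit b 0 ((of_int j + y) / real b) = j"
proof -
  have "\<lfloor>of_int j + y\<rfloor> = j" using assms by (simp add: floor_eq_iff)
  then show ?thesis using assms by (simp add: digit_def)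
qed

lemma emeasure_affine_preimage:
  fixes A :: "real set"
  assumes [measurable]: "A \<in> sets borel" and "\<beta> > 0"
  shows "emeasure lborel {t. (t - c) / \<beta> \<in> A} = ennreal \<beta> * emeasure lborel A"
proof -
  have "emeasure lborel {t. (t - c) / \<beta> \<in> A} = (\<integral>\<^sup>+t. indicator A ((t - c) / \<beta>) \<partial>lborel)"
  proof -
    have "(\<lambda>t. (t - c) / \<beta>) -` A \<inter> space borel \<in> sets borel" by (rule measurable_sets[of _ _ borel]) auto
    then have m: "{t. (t - c) / \<beta> \<in> A} \<in> sets lborel" by (simp add: vimage_def)
    have "indicator A ((t - c) / \<beta>) = (indicator {t. (t - c) / \<beta> \<in> A} t :: ennreal)" for t
      by (simp add: indicator_def)
    then show ?thesis unfolding nn_integral_indicator[OF m, symmetric] by simp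
  qed
  also have "\<dots> = ennreal \<bar>\<beta>\<bar> * (\<integral>\<^sup>+t. indicator A ((c + \<beta> * t - c) / \<beta>) \<partial>lborel)"
    by (rule nn_integral_real_affine) (use assms in auto)
  also have "\<dots> = ennreal \<beta> * emeasure lborel A" using \<open>\<beta> > 0\<close> by simp
  finally show ?thesis .
qed

lemma affine_rewrite: "b > 0 \<Longrightarrow> (x - of_int j / real b) / (1 / real b) = x * real b - of_int j"
  by (simp add: left_diff_distrib)

text \<open>
  Splitting off the first digit \<open>j\<close> leaves a cylinder of the remaining digits, shrunk by the base and
  moved to \<open>j / b\<close>.
\<close>

lemma cylinder_Suc:
  assumes "b > 0"
  shows "cylinder b {..<Suc N} S =
    (\<Union>j\<in>S 0 \<inter> {0..<int b}. {x. (x - of_int j / real b) / (1 / real b) \<in> cylinder b {..<N} (S \<circ> Suc)})"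
    (is "?L = ?R")
proof (intro equalityI subsetI)
  fix x assume x: "x \<in> ?L"
  define j where "j = \<lfloor>real b * x\<rfloor>"
  define y where "y = real b * x - of_int j"
  have xe: "x = (of_int j + y) / real b" using assms by (simp add: y_def)
  have x01: "0 \<le> x" "x < 1" using x by (auto simp: cylinder_def)
  have y: "y \<in> {0..<1}" by (auto simp: y_def j_def) linarith
  have j: "j \<in> {0..<int b}" using x01 assms by (auto simp: j_def floor_less_iff)
  have "digit b 0 x \<in> S 0" using x by (auto simp: cylinder_def)
  then have "j \<in> S 0" using digit_shift_0[OF assms j y] xe by simp
  moreover have "digit b n y \<in> S (Suc n)" if "n < N" for n
  proof -
    have "digit b (Suc n) x \<in> S (Suc n)" using x that by (auto simp: cylinder_def)
    then show ?thesis unfolding xe digit_shift_Suc[OF assms] .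
  qed
  then have "y \<in> cylinder b {..<N} (S \<circ> Suc)"
    using y unfolding cylinder_def by auto
  moreover have "(x - of_int j / real b) / (1 / real b) = y" using assms by (simp add: y_def field_simps)
  ultimately show "x \<in> ?R" using j by auto
next
  fix x assume "x \<in> ?R"
  then obtain j where j: "j \<in> S 0" "j \<in> {0..<int b}" and "(x - of_int j / real b) / (1 / real b) \<in> cylinder b {..<N} (S \<circ> Suc)" by auto
  then obtain y where y: "y \<in> cylinder b {..<N} (S \<circ> Suc)" and "y = (x - of_int j / real b) / (1 / real b)" by blast
  have "y = x * real b - of_int j" using \<open>y = _\<close> unfolding affine_rewrite[OF assms] .
  then have xe: "x = (of_int j + y) / real b" using assms by simp
  have y01: "y \<in> {0..<1}" using y by (simp add: cylinder_def)
  have "j + 1 \<le> int b" using j by simp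
  then have "of_int j + 1 \<le> real b" by (metis of_int_1 of_int_add of_int_le_iff of_int_of_nat_eq)
  then have "x < 1" "0 \<le> x" using j y01 assms by (auto simp: xe field_simps)
  moreover have "digit b n x \<in> S n" if "n < Suc N" for n
  proof (cases n)
    case 0 then show ?thesis using digit_shift_0[OF assms j(2) y01] j xe by simp
  next
    case (Suc m) then show ?thesis using that y unfolding xe Suc digit_shift_Suc[OF assms] by (auto simp: cylinder_def)
  qed
  ultimately show "x \<in> ?L" by (simp add: cylinder_def)
qed

lemma emeasure_cylinder_initial:
  assumes "b > 0"
  shows "emeasure lborel (cylinder b {..<N} S) = ennreal (\<Prod>n<N. card (S n \<inter> {0..<int b}) / real b)"
proof (induction N arbitrary: S)
  case 0
  have "cylinder b {..<0} S = {0..<1}" by (auto simp: cylinder_def)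
  then show ?case by simp
next
  case (Suc N)
  let ?C = "cylinder b {..<N} (S \<circ> Suc)" and ?J = "S 0 \<inter> {0..<int b}"
  let ?f = "\<lambda>j::int. {x. (x - of_int j / real b) / (1 / real b) \<in> ?C}"
  let ?P = "\<Prod>n<N. card ((S \<circ> Suc) n \<inter> {0..<int b}) / real b"
  have fm: "?f j \<in> sets borel" for j by measurable
  have f: "emeasure lborel (?f j) = ennreal (1 / real b * ?P)" for j
    using assms by (subst emeasure_affine_preimage, simp, simp, subst Suc, subst ennreal_mult) (auto intro!: prod_nonneg)
  have disj: "disjoint_family_on ?f ?J"
    unfolding disjoint_family_on_def
  proof (intro ballI impI equals0I)
    fix i j x assume *: "i \<in> ?J" "j \<in> ?J" "i \<noteq> j" "x \<in> ?f i \<inter> ?f j"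
    then have "(x - of_int i / real b) / (1 / real b) \<in> {0..<1}" "(x - of_int j / real b) / (1 / real b) \<in> {0..<1}"
      by (auto simp: cylinder_def)
    then have "\<lfloor>x * real b\<rfloor> = i" "\<lfloor>x * real b\<rfloor> = j"
      unfolding affine_rewrite[OF assms] by (auto simp: floor_eq_iff)
    with * show False by simp
  qed
  have "emeasure lborel (cylinder b {..<Suc N} S) = (\<Sum>j\<in>?J. emeasure lborel (?f j))"
    unfolding cylinder_Suc[OF assms]
    by (rule sum_emeasure[symmetric]) (use disj fm in auto)
  also have "\<dots> = ennreal (card ?J * (1 / real b * ?P))"
    unfolding f by (simp add: ennreal_mult'' prod_nonneg ennreal_of_nat_eq_real_of_nat flip: ennreal_mult)
  also have "card ?J * (1 / real b * ?P) = (\<Prod>n<Suc N. card (S n \<inter> {0..<int b}) / real b)"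
    unfolding prod.lessThan_Suc_shift by simp
  finally show ?case .
qed

text \<open>
  Independence of the digits: the coordinates are unrestricted outside \<open>F\<close> and contribute the factor 1.
\<close>

lemma emeasure_cylinder:
  assumes "b > 0" "finite F"
  shows "emeasure lborel (cylinder b F S) = ennreal (\<Prod>n\<in>F. card (S n \<inter> {0..<int b}) / real b)"
proof -
  obtain N where N: "F \<subseteq> {..<N}" using assms(2) finite_nat_bounded by blast
  define S' where "S' n = (if n \<in> F then S n else UNIV)" for n
  have "cylinder b F S = cylinder b {..<N} S'" using N by (auto simp: cylinder_def S'_def)
  moreover have "(\<Prod>n<N. card (S' n \<inter> {0..<int b}) / real b) = (\<Prod>n\<in>F. card (S n \<inter> {0..<int b}) / real b)"
    by (rule prod.mono_neutral_cong_right) (use N assms in \<open>auto simp: S'_def\<close>)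
  ultimately show ?thesis using emeasure_cylinder_initial[OF assms(1)] by simp
qed

text \<open>
  The \<open>k\<close>-th block lives on an interval of length \<open>\<beta> k\<close> starting at \<open>2\<^sup>-\<^sup>k\<^sup>-\<^sup>1\<close>; the bound on \<open>\<beta> k\<close>
  keeps these intervals disjoint. On each of them the digits in base \<open>b k\<close> of the relative position play
  the part of independent random variables.
\<close>

locale blocks =
  fixes b :: "nat \<Rightarrow> nat" and \<beta> :: "nat \<Rightarrow> real"
  assumes base: "b k \<ge> 2" and len: "0 < \<beta> k" "\<beta> k \<le> (1/2) ^ Suc k"
begin

definition cell :: "nat \<Rightarrow> nat set \<Rightarrow> (nat \<Rightarrow> int set) \<Rightarrow> real set" where
  "cell k F S = {t. (t - (1/2) ^ Suc k) / \<beta> k \<in> cylinder (b k) F S}"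

lemma cell_iff: "t \<in> cell k F S \<longleftrightarrow> (1/2) ^ Suc k \<le> t \<and> t < (1/2) ^ Suc k + \<beta> k \<and>
   (\<forall>n\<in>F. digit (b k) n ((t - (1/2) ^ Suc k) / \<beta> k) \<in> S n)"
  using len(1)[of k] by (auto simp: cell_def cylinder_def field_simps)

lemma cell_subset: "cell k F S \<subseteq> {(1/2) ^ Suc k..<(1/2) ^ k}"
proof
  fix t assume "t \<in> cell k F S"
  then have "(1/2) ^ Suc k \<le> t" "t < (1/2) ^ Suc k + \<beta> k" by (auto simp: cell_iff)
  moreover have "(1/2) ^ Suc k + \<beta> k \<le> (1/2) ^ k" using len(2)[of k] by simp
  ultimately show "t \<in> {(1/2) ^ Suc k..<(1/2) ^ k}" by auto
qed

lemma cell_disjoint: 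
  assumes "t \<in> cell k F S" "t \<in> cell j F' S'" shows "j = k"
proof (rule ccontr)
  assume "j \<noteq> k"
  have *: False if "t \<in> cell k F S" "t \<in> cell j F' S'" "j < k" for j k F S F' S'
  proof -
    have "(1/2::real) ^ k \<le> (1/2) ^ Suc j" using that(3) by (intro power_decreasing) auto
    moreover have "t < (1/2) ^ k" using cell_subset[of k F S] that by auto
    moreover have "(1/2) ^ Suc j \<le> t" using subsetD[OF cell_subset that(2)] by simp
    ultimately show False by linarith
  qed
  show False using *[OF assms] *[OF assms(2,1)] \<open>j \<noteq> k\<close> by linarith
qed

lemma cell_unit: "cell k F S \<subseteq> {0..1}"
proof -
  have "(1/2::real) ^ k \<le> 1" "(0::real) \<le> (1/2) ^ Suc k" by (auto intro: power_le_one)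
  then show ?thesis using cell_subset[of k F S] by auto
qed

lemma cell_borel [measurable]: "finite F \<Longrightarrow> cell k F S \<in> sets borel"
  unfolding cell_def by measurable

lemma cell_sets [measurable]: "finite F \<Longrightarrow> cell k F S \<in> sets unit_interval"
  by (intro borel_in_unit cell_unit cell_borel)

lemma emeasure_cell:
  assumes "finite F"
  shows "emeasure unit_interval (cell k F S) = ennreal (\<beta> k * (\<Prod>n\<in>F. card (S n \<inter> {0..<int (b k)}) / real (b k)))"
proof -
  have "emeasure unit_interval (cell k F S) = emeasure lebesgue (cell k F S)"
    using cell_unit by (intro emeasure_restrict_space) auto
  also have "\<dots> = emeasure lborel (cell k F S)" using cell_borel[OF assms, of k S] by (simp add: emeasure_completion)
  also have "\<dots> = ennreal (\<beta> k) * ennreal (\<Prod>n\<in>F. card (S n \<inter> {0..<int (b k)}) / real (b k))"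
    unfolding cell_def using assms base[of k] len[of k]
    by (subst emeasure_affine_preimage) (auto simp: emeasure_cylinder)
  finally show ?thesis using len(1)[of k] by (simp add: ennreal_mult' less_imp_le)
qed

end

section \<open>Block sequences\<close>

context orlicz
begin

lemma dual_bound:
  assumes "L \<in> heart_dual \<phi>"
  obtains C where "C \<ge> 0" "\<And>f c. f \<in> H \<Longrightarrow> c > 0 \<Longrightarrow> \<rho> (\<lambda>t. f t / c) \<le> 1 \<Longrightarrow> \<bar>L f\<bar> \<le> C * c"
proof -
  obtain C where C: "\<And>f. f \<in> H \<Longrightarrow> ennreal \<bar>L f\<bar> \<le> ennreal C * luxemburg_norm \<phi> f"
    using assms unfolding heart_dual_def by blast
  have "\<bar>L f\<bar> \<le> \<bar>C\<bar> * c" if f: "f \<in> H" "c > 0" "\<rho> (\<lambda>t. f t / c) \<le> 1" for f c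
  proof -
    have "ennreal \<bar>L f\<bar> \<le> ennreal \<bar>C\<bar> * ennreal c"
      by (rule order_trans[OF C[OF f(1)]]) (intro mult_mono norm_leI f ennreal_leI, auto)
    then show ?thesis using f by (simp add: ennreal_mult[symmetric])
  qed
  then show ?thesis using that[of "\<bar>C\<bar>"] by auto
qed

lemma dual_add: "L \<in> heart_dual \<phi> \<Longrightarrow> f \<in> H \<Longrightarrow> h \<in> H \<Longrightarrow> L (\<lambda>t. f t + h t) = L f + L h"
  by (auto simp: heart_dual_def)

lemma dual_cmult: "L \<in> heart_dual \<phi> \<Longrightarrow> f \<in> H \<Longrightarrow> L (\<lambda>t. a * f t) = a * L f"
  by (auto simp: heart_dual_def)

lemma heart_0: "(\<lambda>t. 0) \<in> H" by (rule heart_bounded[of _ 0]) auto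

lemma dual_0: "L \<in> heart_dual \<phi> \<Longrightarrow> L (\<lambda>t. 0) = 0"
  using dual_cmult[of L "\<lambda>t. 0" 0] heart_0 by simp

lemma dual_sum:
  assumes L: "L \<in> heart_dual \<phi>" and f: "\<And>i. i \<in> A \<Longrightarrow> f i \<in> H"
  shows "L (\<lambda>t. \<Sum>i\<in>A. s i * f i t) = (\<Sum>i\<in>A. s i * L (f i))"
  using f
proof (induction A rule: infinite_finite_induct)
  case (insert x F)
  have "L (\<lambda>t. s x * f x t + (\<Sum>i\<in>F. s i * f i t)) = L (\<lambda>t. s x * f x t) + L (\<lambda>t. \<Sum>i\<in>F. s i * f i t)"
    using insert by (intro dual_add[OF L] heart_cmult heart_sum) auto
  then show ?case using insert dual_cmult[OF L, of "f x" "s x"] by simp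
qed (simp_all add: dual_0[OF L])

text \<open>
  If \<open>L\<close> stayed away from 0 on infinitely many \<open>u n\<close>, so it would on their averages with suitable
  signs. But an average of \<open>N\<close> bounded orthogonal functions has \<open>L\<^sup>2\<close>-norm at most \<open>N\<^sup>-\<^sup>1\<^sup>/\<^sup>2\<close>, and for uniformly
  bounded functions this makes the modular of any fixed multiple small.
\<close>

lemma orthogonal_weakly_null:
  fixes u :: "nat \<Rightarrow> real \<Rightarrow> real"
  assumes u [measurable]: "\<And>n. u n \<in> borel_measurable unit_interval"
    and bd: "\<And>n t. \<bar>u n t\<bar> \<le> 1"
    and orth: "\<And>n m. n \<noteq> m \<Longrightarrow> (LINT t|unit_interval. u n t * u m t) = 0"
    and L: "L \<in> heart_dual \<phi>"
  shows "(\<lambda>n. L (u n)) \<longlonglongrightarrow> 0"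
proof (rule ccontr)
  assume "\<not> ?thesis"
  then obtain e where e: "e > 0" "\<And>N. \<exists>n\<ge>N. \<bar>L (u n)\<bar> \<ge> e"
    unfolding LIMSEQ_iff by (auto simp: not_less)
  define I where "I = {n. \<bar>L (u n)\<bar> \<ge> e}"
  have "infinite I" unfolding infinite_nat_iff_unbounded_le I_def using e(2) by auto
  obtain C where C: "C \<ge> 0" "\<And>f c. f \<in> H \<Longrightarrow> c > 0 \<Longrightarrow> \<rho> (\<lambda>t. f t / c) \<le> 1 \<Longrightarrow> \<bar>L f\<bar> \<le> C * c"
    using dual_bound[OF L] by blast
  define c where "c = e / (2 * (C + 1))"
  have "C / (2 * (C + 1)) < 1" using C(1) by (simp add: field_simps)
  from mult_strict_left_mono[OF this e(1)] have c: "c > 0" "C * c < e" using e C(1) by (auto simp: c_def mult.commute)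
  define B where "B = \<phi> (1 / c)"
  have B: "B \<ge> 0" unfolding B_def using c by (intro nonneg) auto
  \<comment> \<open>By \<open>2 \<bar>x\<bar> \<le> r x\<^sup>2 + 1 / r\<close> an average of \<open>N \<ge> r\<^sup>2\<close> functions has \<open>L\<^sup>1\<close>-norm at most \<open>1 / r\<close>.\<close>
  define r where "r = B + 1"
  have r: "r > 0" using B by (simp add: r_def)
  define N where "N = nat \<lceil>r ^ 2\<rceil>"
  have N: "real N \<ge> r ^ 2" unfolding N_def by linarith
  have N0: "real N > 0" using N r by (smt (verit) zero_less_power)
  obtain F where F: "finite F" "card F = N" "F \<subseteq> I"
    using infinite_arbitrarily_large[OF \<open>infinite I\<close>] by blast
  define s where "s n = sgn (L (u n)) / N" for n
  define A where "A t = (\<Sum>n\<in>F. s n * u n t)" for t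
  have [measurable]: "A \<in> borel_measurable unit_interval" unfolding A_def by measurable
  have uH: "u n \<in> H" for n by (rule heart_bounded[of _ 1]) (use bd in auto)
  have sle: "\<bar>s n\<bar> \<le> 1 / N" for n by (auto simp: s_def abs_mult sgn_if)
  have sle1: "\<bar>s n\<bar> \<le> 1" for n
  proof -
    have "1 / real N \<le> 1" using N0 by simp
    with sle[of n] show ?thesis by linarith
  qed
  have Abd: "\<bar>A t\<bar> \<le> 1" for t
  proof -
    have "\<bar>A t\<bar> \<le> (\<Sum>n\<in>F. \<bar>s n * u n t\<bar>)" unfolding A_def by (rule sum_abs)
    also have "\<dots> \<le> (\<Sum>n\<in>F. 1 / N * 1)" unfolding abs_mult by (intro sum_mono mult_mono sle bd) auto
    also have "\<dots> = 1" using F N0 by simp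
    finally show ?thesis .
  qed
  have AH: "A \<in> H" by (rule heart_bounded[of _ 1]) (use Abd in auto)
  have LA: "L A \<ge> e"
  proof -
    have "L A = (\<Sum>n\<in>F. s n * L (u n))" unfolding A_def by (rule dual_sum[OF L uH])
    also have "\<dots> = (\<Sum>n\<in>F. \<bar>L (u n)\<bar> / N)" by (simp add: s_def abs_sgn mult.commute)
    also have "\<dots> \<ge> (\<Sum>n\<in>F. e / N)" using F by (intro sum_mono divide_right_mono) (auto simp: I_def)
    also have "(\<Sum>n\<in>F. e / N) = e" using F N0 by simp
    finally show ?thesis .
  qed
  have int: "integrable unit_interval (\<lambda>t. s n * u n t * (s m * u m t))" for n m
    by (rule bounded_integrable[of _ 1])
      (use bd[of n] bd[of m] sle1 in \<open>auto simp: abs_mult intro!: mult_le_one\<close>)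
  have "(LINT t|unit_interval. (A t)\<^sup>2) = (LINT t|unit_interval. (\<Sum>n\<in>F. \<Sum>m\<in>F. s n * u n t * (s m * u m t)))"
    unfolding A_def power2_eq_square sum_product ..
  also have "\<dots> = (\<Sum>n\<in>F. \<Sum>m\<in>F. LINT t|unit_interval. s n * u n t * (s m * u m t))"
    using int by simp
  also have "\<dots> = (\<Sum>n\<in>F. \<Sum>m\<in>F. if m = n then LINT t|unit_interval. s n * u n t * (s n * u n t) else 0)"
  proof (intro sum.cong refl)
    fix n m
    have "(LINT t|unit_interval. s n * u n t * (s m * u m t)) = s n * s m * (LINT t|unit_interval. u n t * u m t)"
      by (simp flip: integral_mult_right_zero add: ac_simps)
    then show "(LINT t|unit_interval. s n * u n t * (s m * u m t)) =
      (if m = n then LINT t|unit_interval. s n * u n t * (s n * u n t) else 0)" using orth[of n m] by auto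
  qed
  also have "\<dots> = (\<Sum>n\<in>F. LINT t|unit_interval. s n * u n t * (s n * u n t))" using F by simp
  also have "\<dots> \<le> (\<Sum>n\<in>F. LINT t|unit_interval. (1/N)\<^sup>2)"
  proof (intro sum_mono integral_mono int)
    fix n t
    have "(s n * u n t)\<^sup>2 \<le> (1/N)\<^sup>2" using mult_mono[OF sle[of n] bd[of n t]] N0
      by (intro abs_le_square_iff[THEN iffD1]) (auto simp: abs_mult)
    then show "s n * u n t * (s n * u n t) \<le> (1/N)\<^sup>2" by (simp add: power2_eq_square)
  qed (intro bounded_integrable[of _ "(1/N)^2"], auto)
  also have "\<dots> = 1 / N" using F N0 emeasure_unit by (simp add: measure_def power2_eq_square)
  finally have A2: "(LINT t|unit_interval. (A t)\<^sup>2) \<le> 1 / N" .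
  have "\<rho> (\<lambda>t. A t / c) \<le> (\<integral>\<^sup>+t. ennreal (B * (r * (A t)\<^sup>2 + 1/r) / 2) \<partial>unit_interval)"
    unfolding modular_def
  proof (intro nn_integral_mono ennreal_leI)
    fix t
    have "\<phi> \<bar>A t / c\<bar> \<le> \<bar>A t\<bar> * B"
      using scale[of "\<bar>A t\<bar>" "1/c"] Abd c by (simp add: B_def)
    also have "\<bar>A t\<bar> \<le> (r * (A t)\<^sup>2 + 1/r) / 2"
    proof -
      have "0 \<le> (r * \<bar>A t\<bar> - 1)\<^sup>2 / r" using r by simp
      then show ?thesis using r by (simp add: power2_eq_square field_simps)
    qed
    finally show "\<phi> \<bar>A t / c\<bar> \<le> B * (r * (A t)\<^sup>2 + 1/r) / 2" using B by (simp add: mult_right_mono mult.commute)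
  qed
  also have "\<dots> = ennreal (LINT t|unit_interval. B * (r * (A t)\<^sup>2 + 1/r) / 2)"
    using Abd B r by (intro nn_integral_eq_integral bounded_integrable[of _ "B * (r * 1 + 1/r) / 2"])
       (auto simp: abs_mult abs_square_le_1 intro!: mult_left_mono add_mono mult_nonneg_nonneg add_nonneg_nonneg)
  also have "(LINT t|unit_interval. B * (r * (A t)\<^sup>2 + 1/r) / 2) = B * (r * (LINT t|unit_interval. (A t)\<^sup>2) + 1/r) / 2"
  proof -
    have "integrable unit_interval (\<lambda>t. (A t)\<^sup>2)"
      using Abd by (intro bounded_integrable[of _ 1]) (auto simp: abs_square_le_1)
    moreover have "integrable unit_interval (\<lambda>t. 1/r)" by (rule bounded_integrable) auto
    ultimately show ?thesis using emeasure_unit by (simp add: measure_def)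
  qed
  also have "\<dots> \<le> B * (r * (1/N) + 1/r) / 2" using A2 B r by (intro divide_right_mono mult_left_mono add_right_mono) auto
  also have "\<dots> \<le> B * (1/r + 1/r) / 2"
  proof -
    have "r * (1/N) \<le> r * (1/r^2)" using N N0 r by (intro mult_left_mono divide_left_mono mult_pos_pos zero_less_power) auto
    also have "\<dots> = 1/r" using r by (simp add: power2_eq_square)
    finally show ?thesis using B by (intro divide_right_mono mult_left_mono add_right_mono) auto
  qed
  also have "\<dots> \<le> 1" using B r by (simp add: r_def field_simps)
  finally have "\<rho> (\<lambda>t. A t / c) \<le> 1" by (simp add: ennreal_leI)
  from C(2)[OF AH c(1) this] LA c(2) show False by linarith
qed

lemma modular_disjoint:
  assumes [measurable]: "f \<in> borel_measurable unit_interval" "h \<in> borel_measurable unit_interval"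
    and "\<And>t. f t = 0 \<or> h t = 0"
  shows "\<rho> (\<lambda>t. f t + h t) = \<rho> f + \<rho> h"
proof -
  have "\<rho> (\<lambda>t. f t + h t) = (\<integral>\<^sup>+ t. ennreal (\<phi> \<bar>f t\<bar>) + ennreal (\<phi> \<bar>h t\<bar>) \<partial>unit_interval)"
    unfolding modular_def
  proof (intro nn_integral_cong)
    fix t show "ennreal (\<phi> \<bar>f t + h t\<bar>) = ennreal (\<phi> \<bar>f t\<bar>) + ennreal (\<phi> \<bar>h t\<bar>)"
      using assms(3)[of t] by auto
  qed
  then show ?thesis unfolding modular_def by (simp add: nn_integral_add)
qed

end

locale orlicz_blocks = orlicz \<phi> + blocks b \<beta> for \<phi> b \<beta> +
  fixes a :: "nat \<Rightarrow> real"
  assumes a_nonneg: "0 \<le> a k" and weight: "\<phi> (a k) * \<beta> k * (2 / b k) \<le> (1/2) ^ Suc k"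
begin

text \<open>
  The sign is \<open>1\<close> on digit 0, \<open>-1\<close> on digit 1 and zero on all other digits: base 2 gives Rademacher
  functions, and a large base gives signs that are supported on rare independent events.
\<close>

definition digit_sign :: "nat \<Rightarrow> nat \<Rightarrow> real \<Rightarrow> real" where
  "digit_sign k n t = indicator (cell k {n} (\<lambda>_. {0})) t - indicator (cell k {n} (\<lambda>_. {1})) t"

lemma digit_sign_measurable [measurable]: "digit_sign k n \<in> borel_measurable unit_interval"
  unfolding digit_sign_def by measurable

lemma digit_sign_bound: "\<bar>digit_sign k n t\<bar> \<le> 1"
  by (auto simp: digit_sign_def indicator_def)

lemma digit_sign_support: "digit_sign k n t \<noteq> 0 \<longleftrightarrow> t \<in> cell k {n} (\<lambda>_. {0, 1})"
  by (auto simp: digit_sign_def indicator_def cell_iff)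

lemma digit_sign_abs: "\<bar>digit_sign k n t\<bar> = indicator (cell k {n} (\<lambda>_. {0, 1})) t"
  by (auto simp: digit_sign_def indicator_def cell_iff)

lemma card_singleton: "i \<in> {0, 1} \<Longrightarrow> card ({i} \<inter> {0..<int (b k)}) = 1"
  using base[of k] by auto

lemma card_pair: "card ({0, 1} \<inter> {0..<int (b k)}) = 2"
proof -
  have "{0, 1} \<inter> {0..<int (b k)} = {0, 1}" using base[of k] by auto
  then show ?thesis by simp
qed

lemma digit_sign_orthogonal:
  assumes "n \<noteq> m" shows "(LINT t|unit_interval. digit_sign k n t * digit_sign k m t) = 0"
proof -
  define D where "D i j = cell k {n, m} (\<lambda>l. if l = n then {i} else {j})" for i j :: int
  have D: "measure unit_interval (D i j) = \<beta> k * (1 / b k * (1 / b k))" if "i \<in> {0,1}" "j \<in> {0,1}" for i j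
    using assms len[of k] card_singleton[OF that(1), of k] card_singleton[OF that(2), of k] 
    unfolding D_def by (simp add: measure_def emeasure_cell)
  have [measurable]: "D i j \<in> sets unit_interval" for i j unfolding D_def by (rule cell_sets) simp
  have i: "integrable unit_interval (indicat_real (D i j))" for i j by (rule bounded_integrable[of _ 1]) (auto simp: indicator_def)
  have "(LINT t|unit_interval. digit_sign k n t * digit_sign k m t) = 
    (LINT t|unit_interval. indicator (D 0 0) t - indicator (D 0 1) t - indicator (D 1 0) t + indicator (D 1 1) t)"
    using assms by (intro Bochner_Integration.integral_cong refl) (auto simp: digit_sign_def D_def indicator_def cell_iff)
  also have "\<dots> = measure unit_interval (D 0 0) - measure unit_interval (D 0 1) - measure unit_interval (D 1 0) + measure unit_interval (D 1 1)"
  proof -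
    have "integral\<^sup>L unit_interval (indicat_real (D i j)) = measure unit_interval (D i j)" for i j
      using cell_unit by (simp add: D_def Int_absorb2)
    then show ?thesis using i by simp
  qed
  finally show ?thesis by (simp add: D)
qed

lemma modular_digit_sign: 
  assumes "\<bar>s\<bar> \<le> 1" shows "\<rho> (\<lambda>t. s * (a k * digit_sign k n t)) \<le> ennreal ((1/2) ^ Suc k)"
proof -
  have "\<rho> (\<lambda>t. s * (a k * digit_sign k n t)) \<le> \<rho> (\<lambda>t. a k * digit_sign k n t)"
    by (intro modular_mono AE_I2) (use assms in \<open>simp add: abs_mult mult_left_le_one_le\<close>)
  also have "\<dots> = (\<integral>\<^sup>+t. ennreal (\<phi> (a k)) * indicator (cell k {n} (\<lambda>_. {0, 1})) t \<partial>unit_interval)"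
    unfolding modular_def by (intro nn_integral_cong) (auto simp: abs_mult digit_sign_abs a_nonneg indicator_def)
  also have "\<dots> = ennreal (\<phi> (a k)) * ennreal (\<beta> k * (2 / b k))"
    by (subst nn_integral_cmult_indicator) (simp_all add: emeasure_cell card_pair)
  also have "\<dots> \<le> ennreal ((1/2) ^ Suc k)" using weight[of k] nonneg[OF a_nonneg[of k]]
    by (simp add: ennreal_mult'[symmetric] ennreal_leI mult.assoc)
  finally show ?thesis .
qed

definition block_part :: "nat \<Rightarrow> nat \<Rightarrow> nat \<Rightarrow> real \<Rightarrow> real" where
  "block_part K N n t = (\<Sum>k=K..<N. a k * digit_sign k n t)"

lemma block_part_measurable [measurable]: "block_part K N n \<in> borel_measurable unit_interval"
  unfolding block_part_def by measurable

lemma block_part_heart: "block_part K N n \<in> H"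
  unfolding block_part_def
  by (intro heart_sum heart_cmult heart_bounded[of _ 1]) (auto simp: digit_sign_bound)

lemma block_part_zero:
  assumes "t \<in> cell k F S" "k \<notin> {K..<N}" shows "block_part K N n t = 0"
  unfolding block_part_def
proof (intro sum.neutral ballI)
  fix j assume "j \<in> {K..<N}"
  then have "\<not> t \<in> cell j {n} (\<lambda>_. {0, 1})" using assms cell_disjoint by blast
  then show "a j * digit_sign j n t = 0" using digit_sign_support by auto
qed

lemma block_part_nonzero:
  assumes "block_part K N n t \<noteq> 0" shows "\<exists>k\<in>{K..<N}. t \<in> cell k {} (\<lambda>_. UNIV)"
proof -
  obtain k where "k \<in> {K..<N}" "a k * digit_sign k n t \<noteq> 0" using assms unfolding block_part_def by (meson sum.neutral)
  then have "t \<in> cell k {n} (\<lambda>_. {0,1})" using digit_sign_support by auto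
  then have "t \<in> cell k {} (\<lambda>_. UNIV)" by (auto simp: cell_iff)
  with \<open>k \<in> _\<close> show ?thesis by blast
qed

text \<open>
  Modulars add up over disjoint supports. The added blocks may use an index \<open>n\<close> that differs from those
  used in \<open>g\<close>; the proof that functionals are small on tails depends on this freedom.
\<close>

lemma add_block_part_modular:
  assumes [measurable]: "g \<in> borel_measurable unit_interval" and supp: "\<And>t. g t \<noteq> 0 \<Longrightarrow> \<exists>k<K. t \<in> cell k {} (\<lambda>_. UNIV)"
    and s: "\<bar>s\<bar> \<le> 1"
  shows "\<rho> (\<lambda>t. g t + s * block_part K (K + d) n t) \<le> \<rho> g + (\<Sum>k=K..<K+d. ennreal ((1/2) ^ Suc k))"
proof (induction d)
  case 0 then show ?case by (simp add: block_part_def)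
next
  case (Suc d)
  let ?g = "\<lambda>t. g t + s * block_part K (K + d) n t"
  have "\<rho> (\<lambda>t. g t + s * block_part K (K + Suc d) n t) = \<rho> (\<lambda>t. ?g t + s * (a (K+d) * digit_sign (K+d) n t))"
    by (simp add: block_part_def algebra_simps)
  also have "\<dots> = \<rho> ?g + \<rho> (\<lambda>t. s * (a (K+d) * digit_sign (K+d) n t))"
  proof (rule modular_disjoint)
    fix t
    show "?g t = 0 \<or> s * (a (K+d) * digit_sign (K+d) n t) = 0"
    proof (cases "digit_sign (K+d) n t = 0")
      case False
      then have t: "t \<in> cell (K+d) {n} (\<lambda>_. {0,1})" using digit_sign_support by blast
      then have "block_part K (K+d) n t = 0" by (rule block_part_zero) auto
      moreover have "g t = 0" using supp[of t] cell_disjoint[OF _ t] by fastforce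
      ultimately show ?thesis by simp
    qed simp
  qed measurable
  also have "\<dots> \<le> (\<rho> g + (\<Sum>k=K..<K+d. ennreal ((1/2) ^ Suc k))) + ennreal ((1/2) ^ Suc (K+d))"
    using Suc modular_digit_sign[OF s] by (intro add_mono) auto
  finally show ?case by (simp add: add.assoc)
qed

lemma half_sums: "(\<Sum>k=K..<K+d. ennreal ((1/2) ^ Suc k)) + ennreal ((1/2)^(K+d)) = ennreal ((1/2)^K)"
proof (induction d)
  case (Suc d)
  have "ennreal ((1/2) ^ Suc (K+d)) + ennreal ((1/2)^(K+Suc d)) = ennreal ((1/2)^(K+d))"
    by (subst ennreal_plus[symmetric]) auto
  then show ?case using Suc by (simp add: add.assoc del: ennreal_plus)
qed simp

lemma block_part_modular: "\<rho> (block_part K N n) \<le> 1"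
proof (cases "K \<le> N")
  case True
  then obtain d where d: "N = K + d" using le_Suc_ex by blast
  have "\<rho> (\<lambda>t. 0 + 1 * block_part K N n t) \<le> \<rho> (\<lambda>t. 0) + (\<Sum>k=K..<K+d. ennreal ((1/2) ^ Suc k))"
    unfolding d by (rule add_block_part_modular) auto
  also have "\<rho> (\<lambda>t. 0) = 0" by (simp add: modular_def)
  also have "0 + (\<Sum>k=K..<K+d. ennreal ((1/2) ^ Suc k)) \<le> ennreal ((1/2)^K)"
    unfolding half_sums[of K d, symmetric] by simp
  also have "\<dots> \<le> 1" by (simp add: power_le_one)
  finally show ?thesis by simp
qed (simp add: block_part_def modular_def)

text \<open>
  Otherwise successive blocks, with signs that make \<open>L\<close> positive and with an index \<open>n\<close> depending on the
  block, could be added up: \<open>L\<close> would grow without bound on functions whose modular stays below 1.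
\<close>

lemma tail_small:
  assumes L: "L \<in> heart_dual \<phi>" and e: "e > 0"
  shows "\<exists>K. \<forall>N n. \<bar>L (block_part K N n)\<bar> < e"
proof (rule ccontr)
  assume "\<not> ?thesis"
  then have big: "\<exists>N n. \<bar>L (block_part K N n)\<bar> \<ge> e" for K by (meson not_less)
  have ex: "\<exists>g K. g \<in> H \<and> (\<forall>t. g t \<noteq> 0 \<longrightarrow> (\<exists>k<K. t \<in> cell k {} (\<lambda>_. UNIV))) \<and>
      \<rho> g + ennreal ((1/2) ^ K) \<le> 1 \<and> L g \<ge> real j * e" for j
  proof (induction j)
    case 0
    show ?case by (intro exI[of _ "\<lambda>t. 0"] exI[of _ 0]) (simp add: heart_0 dual_0[OF L] modular_def)
  next
    case (Suc j)
    then obtain g K where g: "g \<in> H" "\<And>t. g t \<noteq> 0 \<Longrightarrow> \<exists>k<K. t \<in> cell k {} (\<lambda>_. UNIV)"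
      "\<rho> g + ennreal ((1/2) ^ K) \<le> 1" "L g \<ge> real j * e" by blast
    obtain N n where N: "\<bar>L (block_part K N n)\<bar> \<ge> e" using big by blast
    have "K \<le> N"
    proof (rule ccontr)
      assume "\<not> K \<le> N"
      then have "block_part K N n = (\<lambda>t. 0)" by (auto simp: block_part_def)
      then show False using N e dual_0[OF L] by simp
    qed
    then obtain d where d: "N = K + d" using le_Suc_ex by blast
    define s where "s = sgn (L (block_part K N n))"
    let ?g = "\<lambda>t. g t + s * block_part K N n t"
    have s: "\<bar>s\<bar> \<le> 1" by (simp add: s_def sgn_if)
    have "?g \<in> H" by (intro heart_add heart_cmult g block_part_heart)
    moreover have "\<exists>k<N. t \<in> cell k {} (\<lambda>_. UNIV)" if "?g t \<noteq> 0" for t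
    proof -
      have "g t \<noteq> 0 \<or> block_part K N n t \<noteq> 0" using that by auto
      then show ?thesis using g(2)[of t] block_part_nonzero[of K N n t] \<open>K \<le> N\<close> by force
    qed
    moreover have "\<rho> ?g + ennreal ((1/2) ^ N) \<le> 1"
    proof -
      have "\<rho> ?g + ennreal ((1/2) ^ N) \<le> (\<rho> g + (\<Sum>k=K..<K+d. ennreal ((1/2) ^ Suc k))) + ennreal ((1/2)^(K+d))"
        unfolding d by (intro add_right_mono add_block_part_modular heartD(1) g s)
      also have "\<dots> = \<rho> g + ennreal ((1/2)^K)" unfolding add.assoc half_sums ..
      finally show ?thesis using g(3) by simp
    qed
    moreover have "L ?g \<ge> real (Suc j) * e"
    proof -
      have "L ?g = L g + s * L (block_part K N n)"
        using dual_add[OF L g(1) heart_cmult[OF block_part_heart], of s K N n] dual_cmult[OF L block_part_heart] by simp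
      also have "s * L (block_part K N n) = \<bar>L (block_part K N n)\<bar>" by (simp add: s_def abs_sgn mult.commute)
      finally show ?thesis using g(4) N by (simp add: distrib_right)
    qed
    ultimately show ?case by blast
  qed
  obtain C where C: "C \<ge> 0" "\<And>f c. f \<in> H \<Longrightarrow> c > 0 \<Longrightarrow> \<rho> (\<lambda>t. f t / c) \<le> 1 \<Longrightarrow> \<bar>L f\<bar> \<le> C * c"
    using dual_bound[OF L] by blast
  obtain j :: nat where j: "real j * e > C" using ex_less_of_nat_mult[OF e] by blast
  obtain g K where g: "g \<in> H" "\<rho> g + ennreal ((1/2) ^ K) \<le> 1" "L g \<ge> real j * e" using ex by blast
  have "\<rho> g \<le> \<rho> g + ennreal ((1/2) ^ K)" by simp
  then have "\<rho> g \<le> 1" using g(2) by order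
  then show False using C(2)[OF g(1), of 1] j g(3) by simp
qed

definition block_sequence :: "nat \<Rightarrow> real \<Rightarrow> real" where "block_sequence n = block_part 0 (Suc n) n"

lemma block_sequence_heart: "block_sequence n \<in> H" unfolding block_sequence_def by (rule block_part_heart)

lemma block_sequence_bounded: "norm_bounded \<phi> block_sequence" by (rule norm_boundedI) (simp add: block_sequence_def block_part_modular)

text \<open>
  The tails are uniformly small by \<open>tail_small\<close>, and the finitely many remaining blocks are sequences of bounded
  orthogonal functions.
\<close>

lemma block_sequence_weakly_null: "weakly_null \<phi> block_sequence"
  unfolding weakly_null_def
proof
  fix L assume L: "L \<in> heart_dual \<phi>"
  show "(\<lambda>n. L (block_sequence n)) \<longlonglongrightarrow> 0"
  proof (rule LIMSEQ_I)
    fix e :: real assume e: "e > 0"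
    obtain K where K: "\<And>N n. \<bar>L (block_part K N n)\<bar> < e/2" using tail_small[OF L, of "e/2"] e by auto
    have "(\<lambda>n. \<Sum>k=0..<K. a k * L (digit_sign k n)) \<longlonglongrightarrow> (\<Sum>k=0..<K. a k * 0)"
      by (intro tendsto_sum tendsto_mult_left orthogonal_weakly_null[OF _ _ _ L])
        (auto simp: digit_sign_bound digit_sign_orthogonal)
    then have "(\<lambda>n. L (block_part 0 K n)) \<longlonglongrightarrow> 0"
      unfolding block_part_def using dual_sum[OF L, of _ "\<lambda>k. digit_sign k n" a for n]
      by (subst dual_sum[OF L]) (auto intro!: heart_bounded[of _ 1] simp: digit_sign_bound)
    then obtain n0 where n0: "\<And>n. n \<ge> n0 \<Longrightarrow> \<bar>L (block_part 0 K n)\<bar> < e/2" using LIMSEQ_D[of _ 0 "e/2"] e by fastforce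
    have "norm (L (block_sequence n) - 0) < e" if n: "n \<ge> max n0 K" for n
    proof -
      have "block_sequence n = (\<lambda>t. block_part 0 K n t + block_part K (Suc n) n t)"
        unfolding block_sequence_def block_part_def using n by (auto simp: sum.atLeastLessThan_concat)
      then have "L (block_sequence n) = L (block_part 0 K n) + L (block_part K (Suc n) n)"
        using dual_add[OF L block_part_heart block_part_heart, of 0 K n K "Suc n" n] by simp
      then show ?thesis using K[of "Suc n" n] n0[of n] n by auto
    qed
    then show "\<exists>no. \<forall>n\<ge>no. norm (L (block_sequence n) - 0) < e" by blast
  qed
qed

lemma block_sequence_cell: 
  assumes "t \<in> cell k F S" shows "block_sequence n t = (if k \<le> n then a k * digit_sign k n t else 0)"
proof -
  have "(\<Sum>j=0..<Suc n. a j * digit_sign j n t) = (\<Sum>j=0..<Suc n. if j = k then a k * digit_sign k n t else 0)"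
  proof (intro sum.cong refl)
    fix j
    show "a j * digit_sign j n t = (if j = k then a k * digit_sign k n t else 0)"
      using cell_disjoint[OF assms, of j "{n}" "\<lambda>_. {0,1}"] digit_sign_support[of j n t] by auto
  qed
  then show ?thesis by (simp add: block_sequence_def block_part_def)
qed

end

section \<open>Necessity of the growth conditions\<close>

context orlicz
begin

lemma modular_ge_sum:
  assumes "finite J" and E: "\<And>j. j \<in> J \<Longrightarrow> E j \<in> sets unit_interval" and disj: "disjoint_family_on E J"
    and le: "\<And>j. j \<in> J \<Longrightarrow> AE t in unit_interval. t \<in> E j \<longrightarrow> y j \<le> \<phi> \<bar>g t\<bar>"
  shows "(\<Sum>j\<in>J. ennreal (y j) * emeasure unit_interval (E j)) \<le> \<rho> g"
proof -
  have "(\<Sum>j\<in>J. ennreal (y j) * emeasure unit_interval (E j)) = (\<integral>\<^sup>+t. (\<Sum>j\<in>J. ennreal (y j) * indicator (E j) t) \<partial>unit_interval)"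
    using E by (subst nn_integral_sum) (auto simp: nn_integral_cmult_indicator)
  also have "\<dots> \<le> \<rho> g" unfolding modular_def
  proof (rule nn_integral_mono_AE)
    have "AE t in unit_interval. \<forall>j\<in>J. t \<in> E j \<longrightarrow> y j \<le> \<phi> \<bar>g t\<bar>"
      using le \<open>finite J\<close> by (intro AE_finite_allI) auto
    then show "AE t in unit_interval. (\<Sum>j\<in>J. ennreal (y j) * indicator (E j) t) \<le> ennreal (\<phi> \<bar>g t\<bar>)"
    proof eventually_elim
      case (elim t)
      show ?case
      proof (cases "\<exists>i\<in>J. t \<in> E i")
        case True
        then obtain i where i: "i \<in> J" "t \<in> E i" by blast
        have "(\<Sum>j\<in>J. ennreal (y j) * indicator (E j) t) = (\<Sum>j\<in>J. if j = i then ennreal (y i) else 0)"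
          using i disj by (intro sum.cong refl) (auto simp: indicator_def disjoint_family_on_def)
        then show ?thesis using i elim \<open>finite J\<close> by (simp add: ennreal_leI)
      qed (simp add: indicator_def sum.neutral)
    qed
  qed
  finally show ?thesis .
qed

lemma modular_ge:
  assumes "A \<in> sets unit_interval" and "AE t in unit_interval. t \<in> A \<longrightarrow> y \<le> \<phi> \<bar>g t\<bar>"
  shows "ennreal y * emeasure unit_interval A \<le> \<rho> g"
  using modular_ge_sum[of "{0::nat}" "\<lambda>_. A" "\<lambda>_. y" g] assms by (simp add: disjoint_family_on_def)

lemma modular_infinite:
  assumes "\<And>k. ennreal (2 ^ k) \<le> \<rho> g" shows "\<rho> g = \<infinity>"
proof (rule ccontr)
  assume "\<not> ?thesis"
  then have fin: "\<rho> g = ennreal (enn2real (\<rho> g))" by (simp add: less_top)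
  obtain k where "enn2real (\<rho> g) < 2 ^ k" using real_arch_pow[of 2] by auto
  then have "\<rho> g < ennreal (2 ^ k)" by (subst fin) (simp add: ennreal_lessI)
  with assms[of k] show False by simp
qed

lemma not_delta2_sequence:
  assumes "\<not> delta2 \<phi>"
  obtains a where "\<And>k::nat. a k > 0" "\<And>k. \<phi> (a k) \<ge> 1" "\<And>k. 16 ^ Suc k * \<phi> (a k) \<le> \<phi> (2 * a k)"
proof -
  obtain T where T: "T > 0" "\<And>t. t \<ge> T \<Longrightarrow> 1 \<le> \<phi> t" using large[of 1] by blast
  have "\<exists>t>T. 16 ^ Suc k * \<phi> t \<le> \<phi> (2 * t)" for k :: nat
  proof (rule ccontr)
    assume "\<not> ?thesis"
    then have "\<forall>t>T. \<phi> (2 * t) \<le> 16 ^ Suc k * \<phi> t" by (meson linear)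
    moreover have "(16::real) ^ Suc k > 0" by simp
    ultimately show False using assms T(1) unfolding delta2_def by blast
  qed
  then obtain a where a: "\<And>k. a k > T" "\<And>k. 16 ^ Suc k * \<phi> (a k) \<le> \<phi> (2 * a k)" by metis
  have "\<phi> (a k) \<ge> 1" for k using T(2)[of "a k"] a(1)[of k] by simp
  moreover have "a k > 0" for k using a(1)[of k] T(1) by simp
  ultimately show ?thesis using a(2) that by blast
qed

text \<open>
  When the lower growth condition fails for the factor \<open>N\<close>, the slope \<open>\<phi> t / t\<close> at most doubles between some
  large \<open>t\<close> and \<open>a = N t\<close>. Hence \<open>\<phi>\<close> is linear up to a factor 2 on \<open>[a / N, a]\<close>.
\<close>

lemma not_nabla2_point:
  assumes "\<not> nabla2 \<phi>" "N \<ge> 2"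
  obtains a where "a > 0" "\<phi> a \<ge> B" "\<And>m. m < N \<Longrightarrow> \<phi> a / (2 * (real m + 1)) \<le> \<phi> (a / (real m + 1))"
proof -
  obtain T where T: "T > 0" "\<And>t. t \<ge> T \<Longrightarrow> B \<le> \<phi> t" using large[of B] by blast
  have "real N > 1" using assms by simp
  then obtain t where t: "t \<ge> T" "\<phi> (real N * t) < 2 * real N * \<phi> t"
    using assms T(1) unfolding nabla2_def by (meson not_le)
  define a where "a = real N * t"
  have t0: "t > 0" using t T by simp
  have a: "a > 0" using t T \<open>real N > 1\<close> by (simp add: a_def)
  have "t \<le> a" using t T \<open>real N > 1\<close> by (simp add: a_def)
  then have B: "\<phi> a \<ge> B" using T(2)[of a] t by simp
  have "\<phi> a / (2 * (real m + 1)) \<le> \<phi> (a / (real m + 1))" if "m < N" for m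
  proof -
    have "t = a / N" using assms by (simp add: a_def)
    also have "\<dots> \<le> a / (real m + 1)" using that a by (intro divide_left_mono) auto
    finally have "\<phi> t / t \<le> \<phi> (a / (real m + 1)) / (a / (real m + 1))" using t0 by (intro slope) auto
    moreover have "\<phi> a / (2 * a) \<le> \<phi> t / t" using t(2) t0 assms by (simp add: a_def field_simps)
    ultimately have "\<phi> a / (2 * a) \<le> \<phi> (a / (real m + 1)) / (a / (real m + 1))" by linarith
    then show ?thesis using a by (simp add: field_simps)
  qed
  with a B that show ?thesis by blast
qed

abbreviation "bad_sequence f \<equiv> (\<forall>n. f n \<in> H) \<and> norm_bounded \<phi> f \<and> weakly_null \<phi> f \<and>
   (\<forall>r::nat\<Rightarrow>nat. \<forall>h\<in>H. strict_mono r \<longrightarrow> \<not> (AE t in unit_interval. \<forall>m. \<bar>cesaro (f \<circ> r) m t\<bar> \<le> h t))"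

lemma bad_sequence_not_oBSP:
  assumes "bad_sequence f" shows "\<not> oBSP \<phi>" "\<not> w_oBSP \<phi>"
proof -
  have *: "\<not> order_converges \<phi> (cesaro (f \<circ> r)) l" if rl: "strict_mono r" "l \<in> H" for r l
  proof
    assume "order_converges \<phi> (cesaro (f \<circ> r)) l"
    then obtain h where h: "h \<in> H" "AE t in unit_interval. \<forall>m. \<bar>cesaro (f \<circ> r) m t\<bar> \<le> h t"
      using order_converges_dominated[OF rl(2)] by blast
    from assms have "strict_mono r \<longrightarrow> \<not> (AE t in unit_interval. \<forall>m. \<bar>cesaro (f \<circ> r) m t\<bar> \<le> h t)"
      using h(1) by (elim conjE) (erule allE, erule (1) bspec)
    with rl(1) h(2) show False by (elim impE notE)
  qed
  note f = conjunct1[OF assms] conjunct1[OF conjunct2[OF assms]] conjunct1[OF conjunct2[OF conjunct2[OF assms]]]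
  show "\<not> oBSP \<phi>"
  proof
    assume "oBSP \<phi>"
    then obtain r l where "strict_mono r" "l \<in> H" "order_converges \<phi> (cesaro (f \<circ> r)) l"
      unfolding oBSP_def using f(1,2) by blast
    with * show False by blast
  qed
  show "\<not> w_oBSP \<phi>"
  proof
    assume "w_oBSP \<phi>"
    then obtain r l where "strict_mono r" "l \<in> H" "order_converges \<phi> (cesaro (f \<circ> r)) l"
      unfolding w_oBSP_def using f(1,3) by blast
    with * show False by blast
  qed
qed

text \<open>
  With Rademacher signs the event that the first \<open>2 k + 2\<close> selected functions all have sign \<open>1\<close> on the
  \<open>k\<close>-th interval has relative measure \<open>4\<^sup>-\<^sup>k\<^sup>-\<^sup>1\<close>, whatever the subsequence is. At least \<open>k + 2\<close> of these functions
  have index at least \<open>k\<close>, so on this event their average is at least \<open>a k / 2\<close>. A common upper bound \<open>h\<close> of the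
  Cesaro means therefore satisfies \<open>4 h \<ge> 2 a k\<close> there, and the failure of \<open>\<Delta>\<^sub>2\<close> makes the modular of \<open>4 h\<close> infinite.
\<close>

lemma bad_sequence_if_not_delta2:
  assumes "\<not> delta2 \<phi>" shows "\<exists>f. bad_sequence f"
proof -
  obtain a where a: "\<And>k::nat. a k > 0" "\<And>k. \<phi> (a k) \<ge> 1" "\<And>k. 16 ^ Suc k * \<phi> (a k) \<le> \<phi> (2 * a k)"
    using not_delta2_sequence[OF assms] by blast
  have pos: "\<phi> (a k) > 0" for k using a(2)[of k] by simp
  define \<beta> where "\<beta> k = (1/2) ^ Suc k / \<phi> (a k)" for k
  interpret orlicz_blocks \<phi> "\<lambda>_. 2" \<beta> a
  proof
    show "\<beta> k \<le> (1/2) ^ Suc k" for k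
      using a(2)[of k] divide_left_mono[of 1 "\<phi> (a k)" "(1/2) ^ Suc k"] by (simp add: \<beta>_def)
  qed (use pos a in \<open>auto simp: \<beta>_def less_imp_le intro: less_imp_neq[symmetric]\<close>)
  have "\<not> (AE t in unit_interval. \<forall>m. \<bar>cesaro (block_sequence \<circ> r) m t\<bar> \<le> h t)" if r: "strict_mono r" and h: "h \<in> H" for r h
  proof
    assume AE: "AE t in unit_interval. \<forall>m. \<bar>cesaro (block_sequence \<circ> r) m t\<bar> \<le> h t"
    have "ennreal (2 ^ k) \<le> \<rho> (\<lambda>t. 4 * h t)" for k
    proof -
      define A where "A = cell k (r ` {..<2 * k + 2}) (\<lambda>_. {0})"
      have "card (r ` {..<2*k+2}) = 2*k+2" using r by (simp add: card_image strict_mono_imp_inj_on)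
      then have mA: "emeasure unit_interval A = ennreal (\<beta> k * (1/2)^(2*k+2))"
        unfolding A_def by (subst emeasure_cell) auto
      have ge: "a k / 2 \<le> cesaro (block_sequence \<circ> r) (2*k+1) t" if t: "t \<in> A" for t
      proof -
        have xi1: "digit_sign k (r i) t = 1" if "i < 2*k+2" for i
          using t that by (auto simp: A_def digit_sign_def indicator_def cell_iff)
        have "(real k + 1) * a k \<le> (\<Sum>i\<in>{k..<2*k+2}. a k)" using a(1)[of k] by simp
        also have "\<dots> \<le> (\<Sum>i\<in>{k..<2*k+2}. block_sequence (r i) t)"
        proof (intro sum_mono)
          fix i assume "i \<in> {k..<2*k+2}"
          then have "k \<le> r i" "digit_sign k (r i) t = 1" using seq_suble[OF r, of i] xi1 by auto
          then show "a k \<le> block_sequence (r i) t" using block_sequence_cell[OF t[unfolded A_def], of "r i"] by simp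
        qed
        also have "\<dots> \<le> (\<Sum>i<2*k+2. block_sequence (r i) t)"
        proof (rule sum_mono2)
          fix i assume "i \<in> {..<2*k+2} - {k..<2*k+2}"
          then have "digit_sign k (r i) t = 1" using xi1 by auto
          then show "0 \<le> block_sequence (r i) t" using block_sequence_cell[OF t[unfolded A_def], of "r i"] a(1)[of k] by simp
        qed auto
        finally show ?thesis unfolding cesaro_def by (simp add: field_simps)
      qed
      have "ennreal (\<phi> (2 * a k)) * emeasure unit_interval A \<le> \<rho> (\<lambda>t. 4 * h t)"
      proof (rule modular_ge)
        show "AE t in unit_interval. t \<in> A \<longrightarrow> \<phi> (2 * a k) \<le> \<phi> \<bar>4 * h t\<bar>"
          using AE
        proof eventually_elim
          case (elim t)
          show ?case
          proof
            assume "t \<in> A"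
            then have "a k / 2 \<le> h t" using ge[of t] elim by (meson abs_ge_self order_trans)
            then show "\<phi> (2 * a k) \<le> \<phi> \<bar>4 * h t\<bar>" using a(1)[of k] by (intro mono) auto
          qed
        qed
      qed (simp add: A_def)
      moreover have "2 ^ k \<le> \<phi> (2 * a k) * (\<beta> k * (1/2)^(2*k+2))"
      proof -
        have "(2::real) ^ k \<le> 2 ^ Suc k" by simp
        also have "(2::real) ^ Suc k = 16 ^ Suc k * (1/2) ^ Suc k * (1/4) ^ Suc k" 
          unfolding power_mult_distrib[symmetric] by simp
        also have "(1/4::real) ^ Suc k = (1/2)^(2*k+2)" 
          by (simp add: power_mult power2_eq_square power_one_over)
        also have "16 ^ Suc k * (1/2) ^ Suc k * (1/2)^(2*k+2) = (16 ^ Suc k * \<phi> (a k)) * (\<beta> k * (1/2)^(2*k+2))"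
          using pos[of k] by (simp add: \<beta>_def)
        also have "\<dots> \<le> \<phi> (2 * a k) * (\<beta> k * (1/2)^(2*k+2))"
          using a(3)[of k] pos[of k] by (intro mult_right_mono) (auto simp: \<beta>_def)
        finally show ?thesis .
      qed
      moreover have "ennreal (\<phi> (2 * a k)) * ennreal (\<beta> k * (1/2)^(2*k+2)) = ennreal (\<phi> (2 * a k) * (\<beta> k * (1/2)^(2*k+2)))"
        using nonneg[of "2 * a k"] a(1)[of k] by (intro ennreal_mult'[symmetric]) auto
      ultimately show ?thesis unfolding mA by (metis ennreal_leI order_trans)
    qed
    then have "\<rho> (\<lambda>t. 4 * h t) = \<infinity>" by (rule modular_infinite)
    with heartD_mult[OF h, of 4] show False by simp
  qed
  then show ?thesis using block_sequence_heart block_sequence_bounded block_sequence_weakly_null by blast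
qed

lemma harmonic_block: "\<exists>N>k. N \<ge> 2 \<and> B \<le> (\<Sum>m=k..<N. 1 / (real m + 1))"
proof -
  have "\<not> summable (\<lambda>m. 1 / (real m + 1))"
    using not_summable_harmonic[where 'a=real] summable_Suc_iff[of "\<lambda>n. 1 / real n"] by (simp add: inverse_eq_divide add.commute)
  then have "\<exists>N. (\<Sum>m<N. 1 / (real m + 1)) \<ge> x" for x :: real
    using summableI_nonneg_bounded[of "\<lambda>m. 1 / (real m + 1)" x] by (auto simp: not_le) (meson linear)
  then obtain N where N: "(\<Sum>m<N. 1 / (real m + 1)) \<ge> \<bar>B\<bar> + (\<Sum>m<k. 1 / (real m + 1))" by blast
  define N' where "N' = N + k + 2"
  have "(\<Sum>m<N. 1 / (real m + 1)) \<le> (\<Sum>m<N'. 1 / (real m + 1))" by (intro sum_mono2) (auto simp: N'_def)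
  also have "\<dots> = (\<Sum>m<k. 1 / (real m + 1)) + (\<Sum>m=k..<N'. 1 / (real m + 1))"
    unfolding lessThan_atLeast0 by (rule sum.atLeastLessThan_concat[symmetric]) (auto simp: N'_def)
  finally have "B \<le> (\<Sum>m=k..<N'. 1 / (real m + 1))" using N by linarith
  then show ?thesis by (intro exI[of _ N']) (auto simp: N'_def)
qed

text \<open>
  Consecutive Cesaro means recover the terms of the sequence.
\<close>

lemma cesaro_difference:
  assumes "\<forall>m. \<bar>cesaro f m t\<bar> \<le> h"
  shows "\<bar>f m t\<bar> / (real m + 1) \<le> 2 * h"
proof (cases m)
  case 0
  then show ?thesis using assms[rule_format, of 0] by (auto simp: cesaro_def)
next
  case (Suc j)
  have "f m t = real (Suc m) * cesaro f m t - real m * cesaro f j t" by (simp add: cesaro_def Suc)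
  then have "\<bar>f m t\<bar> \<le> real (Suc m) * \<bar>cesaro f m t\<bar> + real m * \<bar>cesaro f j t\<bar>"
    by (metis abs_mult abs_of_nat abs_triangle_ineq4)
  also have "\<dots> \<le> real (Suc m) * h + real (Suc m) * h" 
    using assms[rule_format, of m] assms[rule_format, of j] by (intro add_mono mult_mono) auto
  finally show ?thesis by (simp add: field_simps)
qed

text \<open>
  By \<open>cesaro_difference\<close> a common upper bound \<open>h\<close> of the Cesaro means satisfies \<open>2 h \<ge> a k / (m + 1)\<close> where the
  \<open>m\<close>-th selected function is nonzero on the \<open>k\<close>-th interval. These events have small relative probability
  \<open>2 / b k\<close> and are independent, so for the first \<open>N k = b k / 4\<close> of them they may be made disjoint at the cost
  of half their measure. Since \<open>\<phi> (a k / (m + 1)) \<ge> \<phi> (a k) / (2 (m + 1))\<close>, the modular of \<open>2 h\<close> on the interval is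
  at least the weight of the block times a long piece of the harmonic series.
\<close>

lemma bad_sequence_if_not_nabla2:
  assumes "\<not> nabla2 \<phi>" shows "\<exists>f. bad_sequence f"
proof -
  have "\<exists>N a. k < N \<and> 2 \<le> N \<and> 8 * 4 ^ k \<le> (\<Sum>m=k..<N. 1 / (real m + 1)) \<and> a > 0 \<and> \<phi> a \<ge> 4 * real N \<and>
     (\<forall>m<N. \<phi> a / (2 * (real m + 1)) \<le> \<phi> (a / (real m + 1)))" for k :: nat
  proof -
    obtain N where N: "N > k" "N \<ge> 2" "8 * 4 ^ k \<le> (\<Sum>m=k..<N. 1 / (real m + 1))" using harmonic_block by blast
    obtain a where "a > 0" "\<phi> a \<ge> 4 * real N" "\<And>m. m < N \<Longrightarrow> \<phi> a / (2 * (real m + 1)) \<le> \<phi> (a / (real m + 1))"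
      using not_nabla2_point[OF assms N(2)] by blast
    with N show ?thesis by blast
  qed
  then obtain N a where Na: "\<And>k. k < N k" "\<And>k. 2 \<le> N k" "\<And>k. 8 * 4 ^ k \<le> (\<Sum>m=k..<N k. 1 / (real m + 1))"
     "\<And>k. a k > 0" "\<And>k. \<phi> (a k) \<ge> 4 * real (N k)"
     "\<And>k m. m < N k \<Longrightarrow> \<phi> (a k) / (2 * (real m + 1)) \<le> \<phi> (a k / (real m + 1))"
    by metis
  \<comment> \<open>Then \<open>N k\<close> events of probability \<open>2 / b k\<close> have total probability at most 1/2.\<close>
  define b where "b k = 4 * N k" for k
  have pos: "\<phi> (a k) > 0" for k using Na(5)[of k] Na(2)[of k] by simp
  define \<beta> where "\<beta> k = (1/2) ^ Suc k * (real (b k) / (2 * \<phi> (a k)))" for k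
  have bpos: "real (b k) > 0" for k using Na(2)[of k] by (simp add: b_def)
  interpret orlicz_blocks \<phi> b \<beta> a
  proof
    fix k
    show "2 \<le> b k" using Na(2)[of k] by (simp add: b_def)
    show "0 < \<beta> k" using pos bpos by (simp add: \<beta>_def)
    have "real (b k) / (2 * \<phi> (a k)) \<le> 1" using Na(5)[of k] pos[of k] by (simp add: b_def)
    then show "\<beta> k \<le> (1/2) ^ Suc k" unfolding \<beta>_def by (intro mult_left_le) auto
    show "0 \<le> a k" using Na(4)[of k] by simp
    show "\<phi> (a k) * \<beta> k * (2 / real (b k)) \<le> (1 / 2) ^ Suc k" using pos[of k] bpos[of k] by (simp add: \<beta>_def)
  qed
  have "\<not> (AE t in unit_interval. \<forall>m. \<bar>cesaro (block_sequence \<circ> r) m t\<bar> \<le> h t)" if r: "strict_mono r" and h: "h \<in> H" for r h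
  proof
    assume AE: "AE t in unit_interval. \<forall>m. \<bar>cesaro (block_sequence \<circ> r) m t\<bar> \<le> h t"
    have "ennreal (2 ^ k) \<le> \<rho> (\<lambda>t. 2 * h t)" for k
    proof -
      \<comment> \<open>The \<open>m\<close>-th selected function is nonzero and the earlier ones with index from \<open>k\<close> on vanish.\<close>
      define E where "E m = cell k (r ` {k..m}) (\<lambda>n. if n = r m then {0,1} else - {0,1})" for m
      have E_sets: "E m \<in> sets unit_interval" for m unfolding E_def by (rule cell_sets) simp
      have inj: "r i = r j \<longleftrightarrow> i = j" for i j using r by (simp add: strict_mono_eq)
      have mE: "ennreal (\<beta> k * (1 / b k)) \<le> emeasure unit_interval (E m)" if m: "m \<in> {k..<N k}" for m
      proof -
        have "- {0, 1} \<inter> {0..<int (b k)} = {2..<int (b k)}" by auto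
        then have c2: "real (card (- {0, 1} \<inter> {0..<int (b k)})) = real (b k) - 2"
          using base[of k] by simp
        have "(\<Prod>n\<in>r ` {k..m}. card ((if n = r m then {0,1} else - {0,1}) \<inter> {0..<int (b k)}) / real (b k))
           = (\<Prod>i\<in>{k..m}. card ((if i = m then {0,1} else - {0,1}) \<inter> {0..<int (b k)}) / real (b k))"
          using r by (subst prod.reindex) (auto simp: strict_mono_imp_inj_on inj)
        also have "\<dots> = (\<Prod>i\<in>insert m {k..<m}. card ((if i = m then {0,1} else - {0,1}) \<inter> {0..<int (b k)}) / real (b k))"
          using m by (intro prod.cong) auto
        also have "\<dots> = 2 / b k * (\<Prod>i\<in>{k..<m}. 1 - 2 / b k)"
          using bpos[of k] c2 by (subst prod.insert) (auto simp: card_pair diff_divide_distrib intro!: prod.cong)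
        also have "\<dots> = 2 / b k * (1 + - (2 / b k)) ^ (m - k)" by simp
        finally have eq: "(\<Prod>n\<in>r ` {k..m}. card ((if n = r m then {0,1} else - {0,1}) \<inter> {0..<int (b k)}) / real (b k))
           = 2 / b k * (1 + - (2 / b k)) ^ (m - k)" .
        have "1 + real (m - k) * - (2 / b k) \<le> (1 + - (2 / b k)) ^ (m - k)"
          by (intro Bernoulli_inequality) (use base[of k] bpos[of k] in auto)
        moreover have "1 + real (m - k) * - (2 / b k) \<ge> 1 / 2"
        proof -
          have "4 * real (m - k) \<le> real (b k)" using m by (simp add: b_def)
          then show ?thesis using bpos[of k] by (simp add: field_simps)
        qed
        ultimately have "1 / 2 \<le> (1 + - (2 / b k)) ^ (m - k)" by linarith
        then have "2 / b k * (1 / 2) \<le> 2 / b k * (1 + - (2 / b k)) ^ (m - k)"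
          by (intro mult_left_mono) auto
        then have "1 / b k \<le> (\<Prod>n\<in>r ` {k..m}. card ((if n = r m then {0,1} else - {0,1}) \<inter> {0..<int (b k)}) / real (b k))"
          unfolding eq by simp
        then have "\<beta> k * (1 / b k) \<le> \<beta> k * (\<Prod>n\<in>r ` {k..m}. card ((if n = r m then {0,1} else - {0,1}) \<inter> {0..<int (b k)}) / real (b k))"
          using len(1)[of k] by (intro mult_left_mono) auto
        then show ?thesis unfolding E_def by (subst emeasure_cell) (auto intro: ennreal_leI)
      qed
      have disj: "disjoint_family_on E {k..<N k}"
        unfolding disjoint_family_on_def
      proof (intro ballI impI equals0I)
        fix i j t assume "i \<in> {k..<N k}" "j \<in> {k..<N k}" "i \<noteq> j" "t \<in> E i \<inter> E j"
        then show False unfolding E_def cell_iff Int_iff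
          by (cases "i < j") (auto simp: inj not_less, force+)
      qed
      have abs1: "\<bar>block_sequence (r m) t\<bar> = a k" if "t \<in> E m" "m \<in> {k..<N k}" for m t
      proof -
        have "k \<le> r m" using seq_suble[OF r, of m] that(2) by auto
        moreover have "t \<in> cell k {r m} (\<lambda>_. {0,1})"
        proof -
          have "r m \<in> r ` {k..m}" using that(2) by auto
          moreover have *: "(1/2) ^ Suc k \<le> t" "t < (1/2) ^ Suc k + \<beta> k"
            "\<forall>n\<in>r ` {k..m}. digit (b k) n ((t - (1/2) ^ Suc k) / \<beta> k) \<in> (if n = r m then {0, 1} else - {0, 1})"
            using that(1) unfolding E_def cell_iff by blast+
          ultimately have "digit (b k) (r m) ((t - (1/2) ^ Suc k) / \<beta> k) \<in> {0, 1}" by (metis (mono_tags, lifting))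
          with * show ?thesis unfolding cell_iff by blast
        qed
        ultimately show ?thesis using block_sequence_cell[OF that(1)[unfolded E_def], of "r m"] Na(4)[of k]
          by (simp add: abs_mult digit_sign_abs)
      qed
      have "(\<Sum>m\<in>{k..<N k}. ennreal (\<phi> (a k) / (2 * (real m + 1))) * emeasure unit_interval (E m)) \<le> \<rho> (\<lambda>t. 2 * h t)"
      proof (rule modular_ge_sum[OF _ _ disj])
        fix m assume m: "m \<in> {k..<N k}"
        show "AE t in unit_interval. t \<in> E m \<longrightarrow> \<phi> (a k) / (2 * (real m + 1)) \<le> \<phi> \<bar>2 * h t\<bar>"
          using AE
        proof eventually_elim
          case (elim t)
          show ?case
          proof
            assume "t \<in> E m"
            then have "a k / (real m + 1) \<le> 2 * h t" 
              using cesaro_difference[OF elim, of m] abs1[of t m] m by (simp add: o_def)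
            then have "\<phi> (a k / (real m + 1)) \<le> \<phi> \<bar>2 * h t\<bar>" using Na(4)[of k] by (intro mono) auto
            then show "\<phi> (a k) / (2 * (real m + 1)) \<le> \<phi> \<bar>2 * h t\<bar>" using Na(6)[of m k] m by force
          qed
        qed
      qed (auto simp: E_sets)
      moreover have "ennreal (2 ^ k) \<le> (\<Sum>m\<in>{k..<N k}. ennreal (\<phi> (a k) / (2 * (real m + 1))) * emeasure unit_interval (E m))"
      proof -
        have "(2::real) ^ k = (1/2) ^ Suc k / 4 * (8 * 4 ^ k)"
        proof -
          have "(2::real)^k = ((1/2) * 4)^k" by simp
          then show ?thesis unfolding power_mult_distrib by simp
        qed
        also have "\<dots> \<le> (1/2) ^ Suc k / 4 * (\<Sum>m=k..<N k. 1 / (real m + 1))" by (intro mult_left_mono Na) auto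
        also have "\<dots> = (\<Sum>m=k..<N k. \<phi> (a k) / (2 * (real m + 1)) * (\<beta> k * (1 / b k)))"
          unfolding sum_distrib_left using pos[of k] bpos[of k] by (intro sum.cong refl) (simp add: \<beta>_def)
        finally have "ennreal (2 ^ k) \<le> (\<Sum>m=k..<N k. ennreal (\<phi> (a k) / (2 * (real m + 1)) * (\<beta> k * (1 / b k))))"
          using pos[of k] bpos[of k] len(1)[of k] by (subst sum_ennreal) (auto intro: ennreal_leI less_imp_le)
        also have "\<dots> \<le> (\<Sum>m\<in>{k..<N k}. ennreal (\<phi> (a k) / (2 * (real m + 1))) * emeasure unit_interval (E m))"
          using pos[of k] mE by (intro sum_mono, subst ennreal_mult') (auto intro!: mult_left_mono simp: less_imp_le)
        finally show ?thesis .
      qed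
      ultimately show ?thesis by order
    qed
    then have "\<rho> (\<lambda>t. 2 * h t) = \<infinity>" by (rule modular_infinite)
    with heartD_mult[OF h, of 2] show False by simp
  qed
  then show ?thesis using block_sequence_heart block_sequence_bounded block_sequence_weakly_null by blast
qed


lemma norm_converges_L1:
  assumes f: "\<And>n. f n \<in> borel_measurable unit_interval" and l: "l \<in> borel_measurable unit_interval"
    and conv: "norm_converges \<phi> f l" and e: "e > 0"
  shows "\<forall>\<^sub>F n in sequentially. (\<integral>\<^sup>+t. ennreal \<bar>f n t - l t\<bar> \<partial>unit_interval) \<le> ennreal e"
proof -
  obtain K where K: "K > 0" "\<And>f c. f \<in> borel_measurable unit_interval \<Longrightarrow> c > 0 \<Longrightarrow> \<rho> (\<lambda>t. f t / c) \<le> 1 \<Longrightarrow>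
     (\<integral>\<^sup>+ t. ennreal \<bar>f t\<bar> \<partial>unit_interval) \<le> ennreal (K * c)" using L1_bound by blast
  have "\<forall>\<^sub>F n in sequentially. \<rho> (\<lambda>t. (f n t - l t) / (e / K)) \<le> 1"
    by (rule norm_convergesD[OF conv]) (use e K in simp)
  then show ?thesis
  proof eventually_elim
    case (elim n)
    note [measurable] = f l
    have "(\<lambda>t. f n t - l t) \<in> borel_measurable unit_interval" by measurable
    from K(2)[OF this _ elim] K(1) e show ?case by simp
  qed
qed

text \<open>
  Norm convergence implies convergence in \<open>L\<^sup>1\<close>, under which the total violation of the two bounds by
  the limit is zero.
\<close>

lemma norm_limit_closed:
  assumes f: "\<And>n. f n \<in> borel_measurable unit_interval" and l: "l \<in> borel_measurable unit_interval"
    and conv: "norm_converges \<phi> f l" and A: "A \<in> sets unit_interval"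
    and y: "\<forall>\<^sub>F n in sequentially. \<forall>t\<in>A. z \<le> f n t \<and> f n t \<le> y"
  shows "AE t in unit_interval. t \<in> A \<longrightarrow> z \<le> l t \<and> l t \<le> y"
proof -
  note [measurable] = f l A
  let ?d = "\<lambda>t. ennreal (max (z - l t) (l t - y)) * indicator A t"
  have le: "(\<integral>\<^sup>+t. ?d t \<partial>unit_interval) \<le> ennreal e" if e: "e > 0" for e
  proof -
    have "\<forall>\<^sub>F n in sequentially. (\<integral>\<^sup>+t. ?d t \<partial>unit_interval) \<le> ennreal e"
      using y norm_converges_L1[OF f l conv e]
    proof eventually_elim
      case (elim n)
      have "(\<integral>\<^sup>+t. ?d t \<partial>unit_interval) \<le> (\<integral>\<^sup>+t. ennreal \<bar>f n t - l t\<bar> \<partial>unit_interval)"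
        by (intro nn_integral_mono) (use elim(1) in \<open>force simp: indicator_def intro!: ennreal_leI\<close>)
      with elim(2) show ?case by order
    qed
    then show ?thesis by (simp add: eventually_const)
  qed
  have "(\<integral>\<^sup>+t. ?d t \<partial>unit_interval) = 0"
  proof (rule ccontr)
    assume "(\<integral>\<^sup>+t. ?d t \<partial>unit_interval) \<noteq> 0"
    then have "0 < (\<integral>\<^sup>+t. ?d t \<partial>unit_interval)" by (simp add: zero_less_iff_neq_zero)
    then obtain e where "0 < e" "ennreal e < (\<integral>\<^sup>+t. ?d t \<partial>unit_interval)"
      using ennreal_between by blast
    with le[of e] show False by simp
  qed
  then have "AE t in unit_interval. ?d t = 0" by (subst (asm) nn_integral_0_iff_AE) auto
  then show ?thesis
    by eventually_elim (auto simp: indicator_def ennreal_eq_0_iff split: if_splits)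
qed

lemma cesaro_measurable:
  assumes "\<And>n. f n \<in> borel_measurable M" shows "cesaro f m \<in> borel_measurable M"
proof -
  note [measurable] = assms
  show ?thesis unfolding cesaro_def by measurable
qed

text \<open>
  The functions \<open>\<bar>f n\<bar>\<close> for the block sequence \<open>f\<close> in base 2 equal \<open>a k\<close> on the \<open>k\<close>-th interval as soon
  as \<open>k \<le> n\<close>. Their modulars are at most 1, but a norm limit of Cesaro means of a subsequence is at least \<open>a k / 2\<close>
  on every interval, and then the failure of \<open>\<Delta>\<^sub>2\<close> makes the modular of 4 times the limit infinite.
\<close>

lemma not_BSP_if_not_delta2:
  assumes "\<not> delta2 \<phi>" shows "\<not> BSP \<phi>"
proof
  assume BSP: "BSP \<phi>"
  obtain a where a: "\<And>k::nat. a k > 0" "\<And>k. \<phi> (a k) \<ge> 1" "\<And>k. 16 ^ Suc k * \<phi> (a k) \<le> \<phi> (2 * a k)"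
    using not_delta2_sequence[OF assms] by blast
  have pos: "\<phi> (a k) > 0" for k using a(2)[of k] by simp
  define \<beta> where "\<beta> k = (1/2) ^ Suc k / \<phi> (a k)" for k
  interpret orlicz_blocks \<phi> "\<lambda>_. 2" \<beta> a
  proof
    show "\<beta> k \<le> (1/2) ^ Suc k" for k
      using a(2)[of k] divide_left_mono[of 1 "\<phi> (a k)" "(1/2) ^ Suc k"] by (simp add: \<beta>_def)
  qed (use pos a in \<open>auto simp: \<beta>_def less_imp_le intro: less_imp_neq[symmetric]\<close>)
  define s where "s n t = \<bar>block_sequence n t\<bar>" for n t
  have sH: "s n \<in> H" for n unfolding s_def by (intro heart_abs block_sequence_heart)
  have "\<rho> (s n) \<le> 1" for n
    using block_part_modular[of 0 "Suc n" n] by (simp add: modular_def s_def block_sequence_def)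
  then have "norm_bounded \<phi> s" by (rule norm_boundedI)
  then obtain r l where r: "strict_mono r" and l: "l \<in> H" and conv: "norm_converges \<phi> (cesaro (s \<circ> r)) l"
    using BSP sH unfolding BSP_def by blast
  have "ennreal (2 ^ k) \<le> \<rho> (\<lambda>t. 4 * l t)" for k
  proof -
    define A where "A = cell k {} (\<lambda>_. UNIV)"
    have mA: "emeasure unit_interval A = ennreal (\<beta> k)" unfolding A_def by (subst emeasure_cell) auto
    have A_sets: "A \<in> sets unit_interval" unfolding A_def by (rule cell_sets) simp
    have s: "s n t = (if k \<le> n then a k else 0)" if "t \<in> A" for n t
    proof -
      have "digit 2 n ((t - (1/2) ^ Suc k) / \<beta> k) \<in> {0..<2}" using digit_range[of 2 n] by simp
      then have "digit 2 n ((t - (1/2) ^ Suc k) / \<beta> k) \<in> {0, 1}" by auto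
      then have "t \<in> cell k {n} (\<lambda>_. {0, 1})" using that unfolding A_def cell_iff by auto
      then show ?thesis using block_sequence_cell[OF that[unfolded A_def], of n] a(1)[of k]
        by (simp add: s_def abs_mult digit_sign_abs)
    qed
    have "AE t in unit_interval. t \<in> A \<longrightarrow> a k / 2 \<le> l t \<and> l t \<le> a k"
    proof (rule norm_limit_closed[OF _ heartD(1)[OF l] conv A_sets])
      show "cesaro (s \<circ> r) m \<in> borel_measurable unit_interval" for m
        by (intro cesaro_measurable) (simp add: heartD(1)[OF sH])
      show "\<forall>\<^sub>F m in sequentially. \<forall>t\<in>A. a k / 2 \<le> cesaro (s \<circ> r) m t \<and> cesaro (s \<circ> r) m t \<le> a k"
        using eventually_ge_at_top[of "2 * k"]
      proof eventually_elim
        case (elim m)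
        show ?case
        proof
          fix t assume t: "t \<in> A"
          have "(\<Sum>n<Suc m. s (r n) t) \<le> (\<Sum>n<Suc m. a k)"
            using a(1)[of k] by (intro sum_mono) (simp add: s[OF t])
          moreover have "(\<Sum>n\<in>{k..<Suc m}. a k) \<le> (\<Sum>n<Suc m. s (r n) t)"
          proof -
            have "(\<Sum>n\<in>{k..<Suc m}. a k) = (\<Sum>n\<in>{k..<Suc m}. s (r n) t)"
              by (intro sum.cong refl) (use seq_suble[OF r] in \<open>auto simp: s[OF t] intro: order_trans\<close>)
            also have "\<dots> \<le> (\<Sum>n<Suc m. s (r n) t)" by (intro sum_mono2) (auto simp: s_def)
            finally show ?thesis .
          qed
          moreover have "real (Suc m) * (a k / 2) \<le> real (Suc m - k) * a k"
          proof -
            have "real (Suc m) / 2 \<le> real (Suc m - k)" using elim by (simp add: of_nat_diff)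
            from mult_right_mono[OF this, of "a k"] a(1)[of k] show ?thesis by simp
          qed
          ultimately show "a k / 2 \<le> cesaro (s \<circ> r) m t \<and> cesaro (s \<circ> r) m t \<le> a k"
            unfolding cesaro_def o_def by (simp add: field_simps)
        qed
      qed
    qed
    then have "ennreal (\<phi> (2 * a k)) * emeasure unit_interval A \<le> \<rho> (\<lambda>t. 4 * l t)"
      by (intro modular_ge[OF A_sets], elim eventually_mono) (use a(1)[of k] in \<open>auto intro!: mono\<close>)
    moreover have "2 ^ k \<le> \<phi> (2 * a k) * \<beta> k"
    proof -
      have "(2::real) ^ k \<le> 8 ^ Suc k" by (rule order_trans[OF power_mono[of 2 8 k]]) auto
      also have "(8::real) ^ Suc k = 16 ^ Suc k * (1/2) ^ Suc k" unfolding power_mult_distrib[symmetric] by simp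
      also have "\<dots> = (16 ^ Suc k * \<phi> (a k)) * \<beta> k" using pos[of k] by (simp add: \<beta>_def)
      also have "\<dots> \<le> \<phi> (2 * a k) * \<beta> k" using a(3)[of k] len(1)[of k] by (intro mult_right_mono) auto
      finally show ?thesis .
    qed
    moreover have "ennreal (\<phi> (2 * a k)) * ennreal (\<beta> k) = ennreal (\<phi> (2 * a k) * \<beta> k)"
      using nonneg[of "2 * a k"] a(1)[of k] by (intro ennreal_mult'[symmetric]) auto
    ultimately show ?thesis unfolding mA by (metis ennreal_leI order_trans)
  qed
  then have "\<rho> (\<lambda>t. 4 * l t) = \<infinity>" by (rule modular_infinite)
  with heartD_mult[OF l, of 4] show False by simp
qed

text \<open>
  The functions \<open>a n\<close> on \<open>[0, 1 / \<phi> (a n)]\<close> have modular 1 and tend to zero at every \<open>t > 0\<close>, so 0 is the only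
  possible norm limit of Cesaro means. Superadditivity bounds the modular of 8 times the \<open>m\<close>-th Cesaro
  mean below by the sum of the modulars of \<open>8 f n / (m + 1)\<close>. Almost linearity of \<open>\<phi>\<close> below \<open>a n\<close> makes each of
  them at least \<open>4 / (m + 1)\<close> for the upper half of the indices, as in \<open>l\<^sup>1\<close>.
\<close>

lemma not_BSP_if_not_nabla2:
  assumes "\<not> nabla2 \<phi>" shows "\<not> BSP \<phi>"
proof
  assume BSP: "BSP \<phi>"
  have "\<exists>a>0. \<phi> a \<ge> real n + 1 \<and> (\<forall>m<2*n+2. \<phi> a / (2 * (real m + 1)) \<le> \<phi> (a / (real m + 1)))" for n :: nat
    using not_nabla2_point[OF assms, of "2*n+2" "real n + 1"] by auto
  then obtain a where a: "\<And>n. a n > 0" "\<And>n. \<phi> (a n) \<ge> real n + 1"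
    "\<And>n m. m < 2*n+2 \<Longrightarrow> \<phi> (a n) / (2 * (real m + 1)) \<le> \<phi> (a n / (real m + 1))" by metis
  have pos: "\<phi> (a n) > 0" for n using a(2)[of n] by simp
  define A where "A n = {0..1 / \<phi> (a n)}" for n
  have A1: "A n \<subseteq> {0..1}" for n
  proof -
    have "1 / \<phi> (a n) \<le> 1" using a(2)[of n] by simp
    then show ?thesis by (auto simp: A_def)
  qed
  have A_sets [measurable]: "A n \<in> sets unit_interval" for n
    using A1[of n] by (simp add: sets_restrict_space_iff A_def)
  have mA: "emeasure unit_interval (A n) = ennreal (1 / \<phi> (a n))" for n
    using A1[of n] pos[of n] by (subst emeasure_restrict_space) (auto simp: A_def)
  define f where "f n t = a n * indicator (A n) t" for n t
  have f_meas [measurable]: "f n \<in> borel_measurable unit_interval" for n unfolding f_def by measurable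
  have fH: "f n \<in> H" for n
    by (rule heart_bounded[of _ "a n"]) (use a(1)[of n] in \<open>auto simp: f_def indicator_def\<close>)
  have f_nonneg: "f n t \<ge> 0" for n t using a(1)[of n] by (simp add: f_def)
  have f_mod: "\<rho> (\<lambda>t. c * f n t) = ennreal (\<phi> (c * a n) / \<phi> (a n))" if "c \<ge> 0" for c n
  proof -
    have "\<rho> (\<lambda>t. c * f n t) = (\<integral>\<^sup>+t. ennreal (\<phi> (c * a n)) * indicator (A n) t \<partial>unit_interval)"
      unfolding modular_def f_def using that a(1)[of n] by (intro nn_integral_cong) (auto simp: indicator_def abs_mult)
    also have "\<dots> = ennreal (\<phi> (c * a n)) * ennreal (1 / \<phi> (a n))" by (simp add: nn_integral_cmult_indicator mA)
    finally show ?thesis using that a(1)[of n] pos[of n] nonneg[of "c * a n"] by (simp add: ennreal_mult'[symmetric])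
  qed
  have "\<rho> (f n) \<le> 1" for n using f_mod[of 1 n] pos[of n] by simp
  then have "norm_bounded \<phi> f" by (rule norm_boundedI)
  then obtain r l where r: "strict_mono r" and l: "l \<in> H" and conv: "norm_converges \<phi> (cesaro (f \<circ> r)) l"
    using BSP fH unfolding BSP_def by blast
  let ?C = "cesaro (f \<circ> r)"
  have C_meas: "?C m \<in> borel_measurable unit_interval" for m
    by (intro cesaro_measurable) simp
  have "AE t in unit_interval. t \<in> {1/(real q+1)..1} \<longrightarrow> - (1/(real p+1)) \<le> l t \<and> l t \<le> 1/(real p+1)" for q p :: nat
  proof (rule norm_limit_closed[OF C_meas heartD(1)[OF l] conv])
    show "{1/(real q+1)..1} \<in> sets unit_interval" by (simp add: sets_restrict_space_iff)
    define S where "S = (\<Sum>n\<le>q. a (r n))"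
    have S: "(\<Sum>n<Suc m. f (r n) t) \<le> S" if t: "t \<in> {1/(real q+1)..1}" for m t
    proof -
      have "f (r n) t = 0" if "n > q" for n
      proof -
        have "real q + 1 < \<phi> (a (r n))" using a(2)[of "r n"] seq_suble[OF r, of n] that by simp
        then have "1 / \<phi> (a (r n)) < 1/(real q+1)" by (intro divide_strict_left_mono) auto
        then show ?thesis using t by (auto simp: f_def A_def)
      qed
      then have "(\<Sum>n<Suc m. f (r n) t) = (\<Sum>n\<in>{..<Suc m} \<inter> {..q}. f (r n) t)"
        by (intro sum.mono_neutral_right) (auto simp: not_le[symmetric])
      also have "\<dots> \<le> (\<Sum>n\<in>{..<Suc m} \<inter> {..q}. a (r n))"
        using a(1) by (intro sum_mono) (auto simp: f_def indicator_def less_imp_le)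
      also have "\<dots> \<le> S" unfolding S_def using a(1) by (intro sum_mono2) (auto simp: less_imp_le)
      finally show ?thesis .
    qed
    have "\<forall>\<^sub>F m in sequentially. S * (real p + 1) \<le> real m" using eventually_ge_at_top[of "nat \<lceil>S * (real p + 1)\<rceil>"]
      by eventually_elim linarith
    then show "\<forall>\<^sub>F m in sequentially. \<forall>t\<in>{1/(real q+1)..1}. - (1/(real p+1)) \<le> ?C m t \<and> ?C m t \<le> 1/(real p+1)"
    proof eventually_elim
      case (elim m)
      show ?case
      proof
        fix t assume t: "t \<in> {1/(real q+1)..1}"
        have 0: "0 \<le> ?C m t" unfolding cesaro_def by (intro divide_nonneg_nonneg sum_nonneg) (auto simp: f_nonneg)
        have "?C m t \<le> S / real (Suc m)" unfolding cesaro_def o_def by (intro divide_right_mono S t) auto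
        also have "\<dots> \<le> 1/(real p+1)" using elim by (simp add: field_simps)
        finally show "- (1/(real p+1)) \<le> ?C m t \<and> ?C m t \<le> 1/(real p+1)"
          using 0 by (auto intro: order_trans[of _ 0])
      qed
    qed
  qed
  then have "AE t in unit_interval. \<forall>q p::nat. t \<in> {1/(real q+1)..1} \<longrightarrow> - (1/(real p+1)) \<le> l t \<and> l t \<le> 1/(real p+1)"
    unfolding AE_all_countable by blast
  moreover have "AE t in unit_interval. t \<noteq> 0"
  proof (rule AE_I)
    show "emeasure unit_interval {0} = 0" by (subst emeasure_restrict_space) auto
    show "{0} \<in> sets unit_interval" by (simp add: sets_restrict_space_iff)
  qed auto
  moreover have "AE t in unit_interval. t \<in> {0..1}" by (intro AE_I2) simp
  ultimately have l0: "AE t in unit_interval. l t = 0"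
  proof eventually_elim
    case (elim t)
    then have "t > 0" by simp
    then obtain q :: nat where q: "inverse (real (Suc q)) < t" using reals_Archimedean by blast
    then have "t \<in> {1/(real q+1)..1}" using elim by (simp add: inverse_eq_divide add.commute)
    then have *: "\<bar>l t\<bar> \<le> 1/(real p+1)" for p :: nat using elim(1) by (simp add: abs_le_iff) (metis minus_le_iff)
    show "l t = 0"
    proof (rule ccontr)
      assume "l t \<noteq> 0"
      then obtain p :: nat where "inverse (real (Suc p)) < \<bar>l t\<bar>" using reals_Archimedean[of "\<bar>l t\<bar>"] by auto
      with *[of p] show False by (simp add: inverse_eq_divide add.commute)
    qed
  qed
  obtain m where m: "\<rho> (\<lambda>t. (?C m t - l t) / (1/8)) \<le> 1"
    using norm_convergesD[OF conv, of "1/8"] by (auto simp: eventually_sequentially)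
  let ?J = "{m div 2..<Suc m}"
  have "ennreal 2 \<le> (\<Sum>n\<in>?J. ennreal (4 / real (Suc m)))"
  proof -
    have "real (Suc m) \<le> 2 * real (card ?J)" by simp
    then have "2 \<le> (\<Sum>n\<in>?J. 4 / real (Suc m))" by (simp add: field_simps)
    then show ?thesis by (subst sum_ennreal) (auto intro: ennreal_leI)
  qed
  also have "\<dots> \<le> (\<Sum>n\<in>?J. \<rho> (\<lambda>t. 8 / real (Suc m) * f (r n) t))"
  proof (intro sum_mono)
    fix n assume n: "n \<in> ?J"
    let ?a = "a (r n)"
    have "m < 2 * r n + 2" using n seq_suble[OF r, of n] by auto
    then have "\<phi> ?a / (2 * (real m + 1)) \<le> \<phi> (?a / (real m + 1))" by (rule a(3))
    also have "\<dots> \<le> 1/8 * \<phi> (8 / real (Suc m) * ?a)"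
      using scale[of "1/8" "8 / real (Suc m) * ?a"] a(1)[of "r n"] by (simp add: add.commute)
    finally have "4 / real (Suc m) \<le> \<phi> (8 / real (Suc m) * ?a) / \<phi> ?a" using pos[of "r n"] by (simp add: field_simps)
    then show "ennreal (4 / real (Suc m)) \<le> \<rho> (\<lambda>t. 8 / real (Suc m) * f (r n) t)"
      by (subst f_mod) (auto intro: ennreal_leI)
  qed
  also have "\<dots> = (\<integral>\<^sup>+t. (\<Sum>n\<in>?J. ennreal (\<phi> \<bar>8 / real (Suc m) * f (r n) t\<bar>)) \<partial>unit_interval)"
    unfolding modular_def by (rule nn_integral_sum[symmetric]) measurable
  also have "\<dots> \<le> \<rho> (\<lambda>t. (?C m t - l t) / (1/8))"
    unfolding modular_def
  proof (rule nn_integral_mono_AE)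
    show "AE t in unit_interval. (\<Sum>n\<in>?J. ennreal (\<phi> \<bar>8 / real (Suc m) * f (r n) t\<bar>)) \<le> ennreal (\<phi> \<bar>(?C m t - l t) / (1/8)\<bar>)"
      using l0
    proof eventually_elim
      case (elim t)
      have "(\<Sum>n\<in>?J. \<phi> \<bar>8 / real (Suc m) * f (r n) t\<bar>) \<le> (\<Sum>n<Suc m. \<phi> (8 / real (Suc m) * f (r n) t))"
        using f_nonneg by (subst abs_of_nonneg) (auto intro!: sum_mono2 nonneg mult_nonneg_nonneg)
      also have "\<dots> \<le> \<phi> (\<Sum>n<Suc m. 8 / real (Suc m) * f (r n) t)"
        using f_nonneg by (intro superadd_sum) auto
      also have "(\<Sum>n<Suc m. 8 / real (Suc m) * f (r n) t) = (?C m t - l t) / (1/8)"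
        using elim unfolding cesaro_def sum_distrib_left[symmetric] by simp
      also have "\<dots> = \<bar>(?C m t - l t) / (1/8)\<bar>"
        using f_nonneg elim unfolding cesaro_def o_def by (intro abs_of_nonneg[symmetric]) (auto intro!: divide_nonneg_nonneg sum_nonneg add_nonneg_nonneg mult_nonneg_nonneg)
      finally show ?case by (subst sum_ennreal) (auto intro!: ennreal_leI nonneg)
    qed
  qed
  also have "\<dots> \<le> 1" by (rule m)
  finally show False by simp
qed

theorem necessity:
  assumes "oBSP \<phi> \<or> w_oBSP \<phi> \<or> BSP \<phi>" shows "delta2 \<phi> \<and> nabla2 \<phi>"
  using assms bad_sequence_not_oBSP bad_sequence_if_not_delta2 bad_sequence_if_not_nabla2
    not_BSP_if_not_delta2 not_BSP_if_not_nabla2 by meson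

end

section \<open>Smooth gauges\<close>

text \<open>
  The intended \<open>g\<close> is \<open>\<phi> t / t\<close> for large \<open>t\<close> and linear near 0, and the gauge is its integral \<open>\<Phi>\<close>. The growth condition
  makes \<open>g\<close> grow at least like a positive power. The smoothness condition bounds the
  increments of \<open>g = \<Phi>'\<close> on a multiplicative scale, so that \<open>\<Phi>\<close> behaves as if \<open>x\<^sup>2 \<Phi>'' x\<close> were at most a multiple of
  \<open>\<Phi> x\<close>; for \<open>b = x\<close> it contains the doubling property.
\<close>

locale gauge =
  fixes g :: "real \<Rightarrow> real" and L E :: real
  assumes g_pos: "0 < x \<Longrightarrow> 0 < g x" and g_0: "g 0 = 0"
    and g_mono: "0 \<le> x \<Longrightarrow> x \<le> y \<Longrightarrow> g x \<le> g y"
    and L: "L \<ge> 2" and g_growth: "0 \<le> x \<Longrightarrow> 2 * g x \<le> g (L * x)"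
    and E: "E \<ge> 0" and g_smooth: "0 < x \<Longrightarrow> 0 \<le> b \<Longrightarrow> b \<le> x \<Longrightarrow> g (x + b) - g x \<le> E * (b / x) * g x"
begin

definition \<Phi> :: "real \<Rightarrow> real" where "\<Phi> x = integral {0..x} g"
text \<open>
  The derivative of \<open>\<lambda>a. \<Phi> \<bar>a\<bar>\<close>.
\<close>

definition G :: "real \<Rightarrow> real" where "G a = sgn a * g \<bar>a\<bar>"
text \<open>
  By \<open>g_growth\<close> the function \<open>g\<close> grows with exponent at least \<open>log L 2\<close>, and \<open>\<Phi>\<close> with one more.
\<close>

definition p :: real where "p = 1 + log L 2"
definition D :: real where "D = 1 + E"
text \<open>
  A single constant that is large enough for all estimates below.
\<close>

definition C :: real where "C = 20 * D ^ 3"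

lemma D: "D \<ge> 1" using E by (simp add: D_def)

lemma D_le_C: "4 * D ^ 2 \<le> C" "4 * D \<le> C" "2 * D \<le> C" "1 \<le> C" "0 < C" "8 * D * E \<le> C"
proof -
  have "D ^ 2 \<le> D ^ 3" "D \<le> D ^ 3" "1 \<le> D ^ 3"
    using D power_increasing[of 1 3 D] power_increasing[of 2 3 D] power_increasing[of 0 3 D] by auto
  moreover have "D * E \<le> D ^ 2" using D E by (simp add: D_def power2_eq_square mult_left_mono)
  ultimately show "4 * D ^ 2 \<le> C" "4 * D \<le> C" "2 * D \<le> C" "1 \<le> C" "0 < C" "8 * D * E \<le> C"
    unfolding C_def by linarith+
qed

lemma p: "1 < p" "p \<le> 2"
  using L log_le_cancel_iff[of L 2 L] by (auto simp: p_def)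

lemma g_nonneg: "0 \<le> x \<Longrightarrow> 0 \<le> g x"
  using g_pos[of x] g_0 by (cases "x = 0") auto

lemma g_integrable: "0 \<le> x \<Longrightarrow> g integrable_on {x..y}"
  by (intro integrable_on_mono_on mono_onI) (auto intro: g_mono)

lemma Phi_0 [simp]: "\<Phi> 0 = 0" by (simp add: \<Phi>_def)

text \<open>
  All properties of \<open>\<Phi>\<close> are derived from these two bounds for the integral of a nondecreasing function.
\<close>

lemma Phi_diff:
  assumes "0 \<le> x" "x \<le> y"
  shows "g x * (y - x) \<le> \<Phi> y - \<Phi> x" "\<Phi> y - \<Phi> x \<le> g y * (y - x)"
proof -
  have eq: "\<Phi> y - \<Phi> x = integral {x..y} g"
    using Henstock_Kurzweil_Integration.integral_combine[OF assms(1) assms(2) g_integrable[of 0 y]] by (simp add: \<Phi>_def)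
  have "integral {x..y} (\<lambda>_. g x) \<le> integral {x..y} g"
    by (rule integral_le) (use assms in \<open>auto intro: g_integrable g_mono\<close>)
  then show "g x * (y - x) \<le> \<Phi> y - \<Phi> x" using assms eq by (simp add: mult.commute)
  have "integral {x..y} g \<le> integral {x..y} (\<lambda>_. g y)"
    by (rule integral_le) (use assms in \<open>auto intro: g_integrable g_mono\<close>)
  then show "\<Phi> y - \<Phi> x \<le> g y * (y - x)" using assms eq by (simp add: mult.commute)
qed

lemma Phi_mono: "0 \<le> x \<Longrightarrow> x \<le> y \<Longrightarrow> \<Phi> x \<le> \<Phi> y"
  using Phi_diff(1)[of x y] mult_nonneg_nonneg[OF g_nonneg[of x], of "y - x"] by simp

lemma Phi_nonneg: "0 \<le> x \<Longrightarrow> 0 \<le> \<Phi> x" using Phi_mono[of 0 x] by simp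

lemma Phi_le: "0 \<le> x \<Longrightarrow> \<Phi> x \<le> x * g x" using Phi_diff(2)[of 0 x] by (simp add: mult.commute)

lemma g_double: "0 \<le> x \<Longrightarrow> g (2 * x) \<le> D * g x"
  using g_smooth[of x x] g_0 by (cases "x = 0") (auto simp: D_def algebra_simps)

lemma Phi_ge: "0 \<le> x \<Longrightarrow> x * g x \<le> 2 * D * \<Phi> x"
proof -
  assume x: "0 \<le> x"
  have "x * g x = x * g (2 * (x/2))" by simp
  also have "\<dots> \<le> x * (D * g (x/2))" using x by (intro mult_left_mono g_double) auto
  also have "\<dots> = 2 * D * (g (x/2) * (x - x/2))" by simp
  also have "\<dots> \<le> 2 * D * (\<Phi> x - \<Phi> (x/2))" using x D by (intro mult_left_mono Phi_diff) auto
  also have "\<dots> \<le> 2 * D * \<Phi> x" using Phi_nonneg[of "x/2"] x D by (intro mult_left_mono) auto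
  finally show ?thesis .
qed

lemma Phi_pos: "0 < x \<Longrightarrow> 0 < \<Phi> x"
  using Phi_ge[of x] g_pos[of x] D by (smt (verit) mult_pos_pos mult_nonneg_nonpos)

lemma g_mult_le: "0 \<le> a \<Longrightarrow> 0 \<le> b \<Longrightarrow> g a * b \<le> C * (\<Phi> a + \<Phi> b)"
proof -
  assume a: "0 \<le> a" "0 \<le> b"
  have "g a * b \<le> a * g a + b * g b"
  proof (cases "b \<le> a")
    case True
    then have "g a * b \<le> a * g a" using g_nonneg[of a] a by (simp add: mult.commute mult_right_mono)
    moreover have "0 \<le> b * g b" using a g_nonneg by simp
    ultimately show ?thesis by linarith
  next
    case False
    then have "g a * b \<le> b * g b" using g_mono[of a b] a by (simp add: mult.commute mult_left_mono)
    moreover have "0 \<le> a * g a" using a g_nonneg by simp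
    ultimately show ?thesis by linarith
  qed
  also have "\<dots> \<le> 2 * D * (\<Phi> a + \<Phi> b)" using Phi_ge[of a] Phi_ge[of b] a by (simp add: algebra_simps)
  also have "\<dots> \<le> C * (\<Phi> a + \<Phi> b)" using D_le_C Phi_nonneg a by (intro mult_right_mono) auto
  finally show ?thesis .
qed

lemma Phi_double: "0 \<le> x \<Longrightarrow> \<Phi> (2 * x) \<le> C * \<Phi> x"
proof -
  assume x: "0 \<le> x"
  have "\<Phi> (2 * x) \<le> 2 * x * g (2 * x)" using Phi_le[of "2 * x"] x by simp
  also have "\<dots> \<le> 2 * x * (D * g x)" using x by (intro mult_left_mono g_double) auto
  also have "\<dots> = 2 * D * (x * g x)" by simp
  also have "\<dots> \<le> 2 * D * (2 * D * \<Phi> x)" using x D by (intro mult_left_mono Phi_ge) auto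
  also have "\<dots> = 4 * D^2 * \<Phi> x" by (simp add: power2_eq_square)
  also have "\<dots> \<le> C * \<Phi> x" using D_le_C Phi_nonneg[OF x] by (intro mult_right_mono) auto
  finally show ?thesis .
qed

lemma Phi_power: "0 \<le> x \<Longrightarrow> \<Phi> (2 ^ k * x) \<le> C ^ k * \<Phi> x"
proof (induction k)
  case (Suc k)
  have "\<Phi> (2 ^ Suc k * x) \<le> C * \<Phi> (2 ^ k * x)" using Phi_double[of "2^k * x"] Suc.prems by (simp add: mult.assoc)
  also have "\<dots> \<le> C * (C ^ k * \<Phi> x)" using Suc D_le_C by (intro mult_left_mono) auto
  finally show ?case by (simp add: mult.assoc)
qed simp

lemma g_growth_power: "0 \<le> x \<Longrightarrow> 2 ^ k * g x \<le> g (L ^ k * x)"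
proof (induction k)
  case (Suc k)
  have "2 ^ Suc k * g x \<le> 2 * g (L ^ k * x)" using Suc by simp
  also have "\<dots> \<le> g (L * (L ^ k * x))" using Suc.prems L by (intro g_growth) auto
  finally show ?case by (simp add: mult.assoc)
qed simp

text \<open>
  Multiply \<open>c x\<close> by \<open>L\<close> as often as the result stays below \<open>x\<close>; each time \<open>g\<close> at least doubles.
\<close>

lemma g_scale:
  assumes "0 < c" "c \<le> 1" "0 \<le> x" shows "g (c * x) \<le> 2 * c powr (p - 1) * g x"
proof -
  define y where "y = log L (1 / c)"
  define k where "k = nat \<lfloor>y\<rfloor>"
  have L1: "L > 1" using L by simp
  have y0: "y \<ge> 0" using assms L1 by (simp add: y_def)
  have k: "real k \<le> y" "y < real k + 1" using y0 by (auto simp: k_def)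
  have "L ^ k = L powr real k" using L1 by (simp add: powr_realpow)
  also have "\<dots> \<le> L powr y" using k L1 by simp
  also have "\<dots> = 1 / c" using assms L1 by (simp add: y_def)
  finally have "L ^ k * c \<le> 1" using assms by (simp add: field_simps)
  then have Lk: "L ^ k * (c * x) \<le> x" using assms mult_right_mono[of "L^k * c" 1 x] by (simp add: mult.assoc)
  have "2 ^ k * g (c * x) \<le> g (L ^ k * (c * x))" using assms by (intro g_growth_power) auto
  also have "\<dots> \<le> g x" using Lk assms L1 by (intro g_mono) auto
  finally have 1: "2 ^ k * g (c * x) \<le> g x" .
  have "1 / c powr (p - 1) = 2 powr y"
  proof -
    have "2 powr y = L powr (log L 2 * y)" using L1 by (simp add: powr_powr[symmetric])
    also have "\<dots> = (L powr y) powr log L 2" by (simp add: powr_powr mult.commute)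
    also have "L powr y = 1 / c" using assms L1 by (simp add: y_def)
    finally show ?thesis using assms by (simp add: p_def powr_divide)
  qed
  also have "\<dots> \<le> 2 powr (real k + 1)" using k by simp
  also have "\<dots> = 2 * 2 ^ k" by (simp add: powr_add powr_realpow)
  finally have 2: "1 \<le> 2 * c powr (p - 1) * 2 ^ k" using assms by (simp add: field_simps)
  have "g (c * x) \<le> (2 * c powr (p - 1) * 2 ^ k) * g (c * x)"
    using mult_right_mono[OF 2 g_nonneg[of "c * x"]] assms by simp
  also have "\<dots> = 2 * c powr (p - 1) * (2 ^ k * g (c * x))" by simp
  also have "\<dots> \<le> 2 * c powr (p - 1) * g x" using 1 by (intro mult_left_mono) auto
  finally show ?thesis .
qed

lemma powr_split: "0 \<le> c \<Longrightarrow> c * c powr (p - 1) = c powr p"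
  using powr_add[of c 1 "p - 1"] p by (cases "c = 0") auto

lemma xg_scale:
  assumes "0 \<le> c" "c \<le> 1" "0 \<le> x" shows "c * x * g (c * x) \<le> 2 * c powr p * (x * g x)"
proof (cases "c = 0")
  case False
  then have "c * x * g (c * x) \<le> c * x * (2 * c powr (p - 1) * g x)"
    using assms by (intro mult_left_mono g_scale) auto
  also have "\<dots> = 2 * (c * c powr (p - 1)) * (x * g x)" by simp
  finally show ?thesis unfolding powr_split[OF assms(1)] .
qed simp

lemma Phi_scale:
  assumes "0 \<le> c" "c \<le> 1" "0 \<le> x" shows "\<Phi> (c * x) \<le> C * c powr p * \<Phi> x"
proof -
  have "\<Phi> (c * x) \<le> c * x * g (c * x)" using Phi_le[of "c * x"] assms by simp
  also have "\<dots> \<le> 2 * c powr p * (x * g x)" by (rule xg_scale[OF assms])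
  also have "\<dots> \<le> 2 * c powr p * (2 * D * \<Phi> x)" using assms by (intro mult_left_mono Phi_ge) auto
  also have "\<dots> = 4 * D * (c powr p * \<Phi> x)" by simp
  also have "\<dots> \<le> C * (c powr p * \<Phi> x)" using D_le_C Phi_nonneg assms by (intro mult_right_mono) auto
  finally show ?thesis by (simp add: mult.assoc)
qed

lemma Phi_subgradient: "\<Phi> \<bar>a\<bar> + G a * (x - a) \<le> \<Phi> \<bar>x\<bar>"
proof -
  have "G a * (x - a) \<le> g \<bar>a\<bar> * (\<bar>x\<bar> - \<bar>a\<bar>)"
  proof -
    have "sgn a * (x - a) \<le> \<bar>x\<bar> - \<bar>a\<bar>" by (auto simp: sgn_if abs_if)
    from mult_left_mono[OF this g_nonneg[of "\<bar>a\<bar>"]] show ?thesis by (simp add: G_def ac_simps)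
  qed
  also have "\<dots> \<le> \<Phi> \<bar>x\<bar> - \<Phi> \<bar>a\<bar>"
  proof (cases "\<bar>a\<bar> \<le> \<bar>x\<bar>")
    case True then show ?thesis by (intro Phi_diff) auto
  next
    case False
    then show ?thesis using Phi_diff(2)[of "\<bar>x\<bar>" "\<bar>a\<bar>"] by (simp add: algebra_simps)
  qed
  finally show ?thesis by simp
qed

lemma Phi_convex: "convex_on UNIV (\<lambda>x. \<Phi> \<bar>x\<bar>)"
proof (rule convex_onI)
  fix t x y :: real assume t: "0 < t" "t < 1"
  define a where "a = (1 - t) *\<^sub>R x + t *\<^sub>R y"
  have "(1 - t) * (\<Phi> \<bar>a\<bar> + G a * (x - a)) + t * (\<Phi> \<bar>a\<bar> + G a * (y - a)) \<le> (1 - t) * \<Phi> \<bar>x\<bar> + t * \<Phi> \<bar>y\<bar>"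
    using t by (intro add_mono mult_left_mono Phi_subgradient) auto
  moreover have "(1 - t) * (\<Phi> \<bar>a\<bar> + G a * (x - a)) + t * (\<Phi> \<bar>a\<bar> + G a * (y - a)) = \<Phi> \<bar>a\<bar> + G a * ((1 - t) * x + t * y - a)"
    by (simp add: algebra_simps)
  moreover have "(1 - t) * x + t * y - a = 0" by (simp add: a_def)
  ultimately show "\<Phi> \<bar>(1 - t) *\<^sub>R x + t *\<^sub>R y\<bar> \<le> (1 - t) * \<Phi> \<bar>x\<bar> + t * \<Phi> \<bar>y\<bar>" by (simp add: a_def)
qed simp

text \<open>
  The error of the linear approximation of \<open>\<Phi>\<close> is at most the increment of \<open>g\<close> times \<open>\<bar>b\<bar>\<close>. For negative \<open>b\<close> the
  smoothness of \<open>g\<close> is applied at the left end \<open>a - \<bar>b\<bar> \<ge> a / 2\<close>, which costs the factor 2.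
\<close>

lemma remainder_local:
  assumes a: "0 < a" and b: "\<bar>b\<bar> \<le> a / 2"
  shows "\<Phi> (a + b) - \<Phi> a - g a * b \<le> 2 * E * (b\<^sup>2 / a) * g a"
proof (cases "0 \<le> b")
  case True
  have "\<Phi> (a + b) - \<Phi> a - g a * b \<le> (g (a + b) - g a) * b"
    using Phi_diff(2)[of a "a + b"] a True by (simp add: algebra_simps)
  also have "\<dots> \<le> (E * (b / a) * g a) * b" using a b True by (intro mult_right_mono g_smooth) auto
  also have "\<dots> = E * (b\<^sup>2 / a) * g a" by (simp add: power2_eq_square)
  also have "\<dots> \<le> 2 * (E * (b\<^sup>2 / a) * g a)"
  proof -
    have "0 \<le> E * (b\<^sup>2 / a) * g a" using E a g_nonneg[of a] by (intro mult_nonneg_nonneg) auto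
    then show ?thesis by linarith
  qed
  finally show ?thesis by simp
next
  case False
  define c where "c = - b"
  have c: "0 < c" "c \<le> a / 2" using False b by (auto simp: c_def)
  have "\<Phi> (a + b) - \<Phi> a - g a * b \<le> (g a - g (a - c)) * c"
    using Phi_diff(1)[of "a - c" a] a c by (simp add: c_def algebra_simps)
  also have "\<dots> \<le> (E * (c / (a - c)) * g (a - c)) * c"
    using g_smooth[of "a - c" c] a c by (intro mult_right_mono) auto
  also have "\<dots> \<le> (E * (2 * c / a) * g a) * c"
  proof -
    have "c / (a - c) \<le> 2 * c / a" using a c by (simp add: field_simps)
    then show ?thesis using E a c by (intro mult_right_mono mult_mono mult_left_mono g_mono) (auto intro: g_nonneg)
  qed
  also have "\<dots> = 2 * E * (b\<^sup>2 / a) * g a" by (simp add: power2_eq_square c_def)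
  finally show ?thesis .
qed

text \<open>
  If the step \<open>b = c u\<close> is at most \<open>a / 2\<close>, the remainder is of order \<open>(b / a)\<^sup>2 \<Phi> a \<le> c\<^sup>p (\<bar>u\<bar> / a)\<^sup>p \<Phi> a\<close>, because
  \<open>p \<le> 2\<close>; this is at most \<open>c\<^sup>p \<Phi> a\<close> if \<open>\<bar>u\<bar> \<le> a\<close>, and at most a multiple of \<open>c\<^sup>p \<Phi> \<bar>u\<bar>\<close> otherwise, as \<open>\<Phi>\<close> grows at
  least like the \<open>p\<close>-th power. If \<open>b\<close> is larger, all terms are of order \<open>\<Phi> \<bar>b\<bar>\<close>, which is at most a multiple of
  \<open>c\<^sup>p \<Phi> \<bar>u\<bar>\<close>.
\<close>

lemma Phi_expand_pos:
  assumes a: "0 \<le> a" and c: "0 \<le> c" "c \<le> 1"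
  shows "\<Phi> \<bar>a + c * u\<bar> \<le> \<Phi> a + c * (g a * u) + C * c powr p * (\<Phi> a + \<Phi> \<bar>u\<bar>)"
proof -
  define b where "b = c * u"
  have xgu: "c * \<bar>u\<bar> * g (c * \<bar>u\<bar>) \<le> 4 * D * c powr p * \<Phi> \<bar>u\<bar>"
  proof -
    have "c * \<bar>u\<bar> * g (c * \<bar>u\<bar>) \<le> 2 * c powr p * (\<bar>u\<bar> * g \<bar>u\<bar>)" using c by (intro xg_scale) auto
    also have "\<dots> \<le> 2 * c powr p * (2 * D * \<Phi> \<bar>u\<bar>)" using c by (intro mult_left_mono Phi_ge) auto
    finally show ?thesis by (simp add: ac_simps)
  qed
  have "\<Phi> \<bar>a + b\<bar> - \<Phi> a - g a * b \<le> C * c powr p * (\<Phi> a + \<Phi> \<bar>u\<bar>)"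
  proof (cases "a > 0 \<and> \<bar>b\<bar> \<le> a / 2")
    case True
    then have a0: "a > 0" by simp
    have key: "b\<^sup>2 / a * g a \<le> c powr p * (4 * D * (\<Phi> a + \<Phi> \<bar>u\<bar>))"
    proof (cases "u = 0 \<or> c = 0")
      case True
      then have "b = 0" by (auto simp: b_def)
      moreover have "0 \<le> c powr p * (4 * D * (\<Phi> a + \<Phi> \<bar>u\<bar>))"
        using Phi_nonneg[OF a] Phi_nonneg[of "\<bar>u\<bar>"] D by (intro mult_nonneg_nonneg add_nonneg_nonneg) auto
      ultimately show ?thesis by simp
    next
      case False
      define z where "z = \<bar>u\<bar> / a"
      have z: "z > 0" using False a0 by (simp add: z_def)
      have cz: "\<bar>b\<bar> / a = c * z" using c by (simp add: b_def z_def abs_mult)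
      have "c * z \<le> 1" using True a0 unfolding cz[symmetric] by (simp add: field_simps)
      have "b\<^sup>2 / a * g a = (c * z) powr 2 * (a * g a)"
      proof -
        have "(c * z) powr 2 = (\<bar>b\<bar> / a)^2" unfolding cz using c z False by simp
        then show ?thesis using a0 by (simp add: power2_eq_square)
      qed
      also have "\<dots> \<le> (c * z) powr p * (a * g a)"
        using \<open>c * z \<le> 1\<close> c z p a0 g_nonneg[of a] by (intro mult_right_mono powr_mono') auto
      also have "\<dots> = c powr p * (z powr p * (a * g a))" using c z by (simp add: powr_mult)
      also have "\<dots> \<le> c powr p * (4 * D * (\<Phi> a + \<Phi> \<bar>u\<bar>))"
      proof (intro mult_left_mono)
        show "z powr p * (a * g a) \<le> 4 * D * (\<Phi> a + \<Phi> \<bar>u\<bar>)"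
        proof (cases "z \<le> 1")
          case True
          then have "z powr p \<le> 1" using z p by (simp add: powr_le1)
          then have "z powr p * (a * g a) \<le> 1 * (a * g a)" using a0 g_nonneg[of a] by (intro mult_right_mono) auto
          also have "\<dots> \<le> 2 * D * \<Phi> a" using Phi_ge[OF a] by simp
          also have "\<dots> \<le> 4 * D * (\<Phi> a + \<Phi> \<bar>u\<bar>)" using D Phi_nonneg a by (intro mult_mono) auto
          finally show ?thesis .
        next
          case zF: False
          have "g a = g ((1 / z) * \<bar>u\<bar>)" using False a0 by (simp add: z_def)
          also have "\<dots> \<le> 2 * (1 / z) powr (p - 1) * g \<bar>u\<bar>" using zF z by (intro g_scale) auto
          finally have "z powr p * (a * g a) \<le> z powr p * (a * (2 * (1 / z) powr (p - 1) * g \<bar>u\<bar>))"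
            using a0 by (intro mult_left_mono) auto
          also have "\<dots> = 2 * (z powr p * (1 / z) powr (p - 1)) * a * g \<bar>u\<bar>" by simp
          also have "z powr p * (1 / z) powr (p - 1) = z"
            using z by (simp add: powr_divide powr_diff)
          also have "2 * z * a * g \<bar>u\<bar> = 2 * (\<bar>u\<bar> * g \<bar>u\<bar>)" using a0 by (simp add: z_def)
          also have "\<dots> \<le> 2 * (2 * D * \<Phi> \<bar>u\<bar>)" by (intro mult_left_mono Phi_ge) auto
          also have "\<dots> = 4 * D * \<Phi> \<bar>u\<bar>" by simp
          also have "\<dots> \<le> 4 * D * (\<Phi> a + \<Phi> \<bar>u\<bar>)" using D Phi_nonneg[OF a] by (intro mult_left_mono) auto
          finally show ?thesis .
        qed
      qed simp
      finally show ?thesis .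
    qed
    have "a + b \<ge> 0" using True by linarith
    then have "\<Phi> \<bar>a + b\<bar> - \<Phi> a - g a * b \<le> 2 * E * (b\<^sup>2 / a * g a)"
      using remainder_local[of a b] True by (simp add: mult.assoc)
    also have "\<dots> \<le> 2 * E * (c powr p * (4 * D * (\<Phi> a + \<Phi> \<bar>u\<bar>)))" using E key by (intro mult_left_mono) auto
    also have "\<dots> = (8 * D * E) * (c powr p * (\<Phi> a + \<Phi> \<bar>u\<bar>))" by simp
    also have "\<dots> \<le> C * (c powr p * (\<Phi> a + \<Phi> \<bar>u\<bar>))"
      using D_le_C Phi_nonneg a by (intro mult_right_mono mult_nonneg_nonneg add_nonneg_nonneg) auto
    finally show ?thesis by (simp add: mult.assoc)
  next
    case False
    then have ab: "a \<le> 2 * \<bar>b\<bar>" using a by auto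
    let ?B = "\<bar>b\<bar>"
    have gB: "0 \<le> g ?B" by (simp add: g_nonneg)
    have "\<Phi> \<bar>a + b\<bar> \<le> \<Phi> (4 * ?B)" using ab a by (intro Phi_mono) auto
    also have "\<dots> \<le> 4 * ?B * g (4 * ?B)" using Phi_le[of "4 * ?B"] by simp
    also have "\<dots> \<le> 4 * ?B * (D * (D * g ?B))"
    proof (intro mult_left_mono)
      have "g (4 * ?B) \<le> D * g (2 * ?B)" using g_double[of "2 * ?B"] by simp
      also have "\<dots> \<le> D * (D * g ?B)" using D by (intro mult_left_mono g_double) auto
      finally show "g (4 * ?B) \<le> D * (D * g ?B)" .
    qed simp
    finally have 1: "\<Phi> \<bar>a + b\<bar> \<le> 4 * D\<^sup>2 * (?B * g ?B)" by (simp add: power2_eq_square ac_simps)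
    have "- (g a * b) \<le> g a * ?B" using g_nonneg[OF a] by (metis abs_ge_minus_self minus_mult_right mult_left_mono)
    also have "\<dots> \<le> (D * g ?B) * ?B"
      using g_mono[OF a ab] g_double[of ?B] by (intro mult_right_mono) auto
    also have "\<dots> \<le> D\<^sup>2 * (?B * g ?B)"
    proof -
      have "D \<le> D\<^sup>2" using D by (simp add: power2_eq_square)
      from mult_right_mono[OF this, of "?B * g ?B"] gB show ?thesis by (simp add: ac_simps)
    qed
    finally have "\<Phi> \<bar>a + b\<bar> - \<Phi> a - g a * b \<le> 5 * D\<^sup>2 * (?B * g ?B)" using 1 Phi_nonneg[OF a] by linarith
    also have "?B * g ?B = c * \<bar>u\<bar> * g (c * \<bar>u\<bar>)" using c by (simp add: b_def abs_mult)
    also have "5 * D\<^sup>2 * (c * \<bar>u\<bar> * g (c * \<bar>u\<bar>)) \<le> 5 * D\<^sup>2 * (4 * D * c powr p * \<Phi> \<bar>u\<bar>)"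
      using xgu by (intro mult_left_mono) auto
    also have "\<dots> = C * c powr p * \<Phi> \<bar>u\<bar>" by (simp add: C_def power2_eq_square power3_eq_cube)
    also have "\<dots> \<le> C * c powr p * (\<Phi> a + \<Phi> \<bar>u\<bar>)" using Phi_nonneg[OF a] D_le_C by (intro mult_left_mono) auto
    finally show ?thesis .
  qed
  then show ?thesis by (simp add: b_def algebra_simps)
qed

lemma Phi_expand:
  assumes c: "0 \<le> c" "c \<le> 1"
  shows "\<Phi> \<bar>a + c * u\<bar> \<le> \<Phi> \<bar>a\<bar> + c * (G a * u) + C * c powr p * (\<Phi> \<bar>a\<bar> + \<Phi> \<bar>u\<bar>)"
proof (cases "0 \<le> a")
  case True
  then show ?thesis using Phi_expand_pos[OF True c, of u] g_0 by (cases "a = 0") (auto simp: G_def)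
next
  case False
  have "\<bar>- a + c * - u\<bar> = \<bar>a + c * u\<bar>" by (simp add: abs_if)
  then show ?thesis using Phi_expand_pos[of "-a" c "-u"] c False by (simp add: G_def)
qed

end


context orlicz
begin

text \<open>
  Iterating the inequality makes the factor at least 2, so that the exponent \<open>p\<close> of the gauge is at most 2.
\<close>

lemma nabla2_step:
  assumes "nabla2 \<phi>"
  obtains l t1 where "l \<ge> 2" "t1 > 0" "\<And>t. t \<ge> t1 \<Longrightarrow> 2 * l * \<phi> t \<le> \<phi> (l * t)"
proof -
  obtain l t1 where l: "l > 1" "t1 > 0" "\<And>t. t \<ge> t1 \<Longrightarrow> 2 * l * \<phi> t \<le> \<phi> (l * t)"
    using assms unfolding nabla2_def by blast
  obtain k where k: "2 < l ^ k" using real_arch_pow[OF l(1)] by blast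
  have iter: "2 * l ^ Suc j * \<phi> t \<le> \<phi> (l ^ Suc j * t)" if t: "t \<ge> t1" for j t
  proof (induction j)
    case 0 then show ?case using l(3)[OF t] by simp
  next
    case (Suc j)
    have t0: "t > 0" using t l by simp
    have "1 \<le> l ^ Suc j" using l by (intro one_le_power) simp
    then have "1 * t \<le> l ^ Suc j * t" using t0 by (intro mult_right_mono) auto
    then have "t1 \<le> l ^ Suc j * t" using t by linarith
    have "2 * l ^ Suc (Suc j) * \<phi> t = l * (2 * l ^ Suc j * \<phi> t)" by simp
    also have "\<dots> \<le> l * \<phi> (l ^ Suc j * t)" using Suc l by (intro mult_left_mono) auto
    also have "\<dots> \<le> 2 * l * \<phi> (l ^ Suc j * t)" using l t0 nonneg[of "l ^ Suc j * t"] by simp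
    also have "\<dots> \<le> \<phi> (l * (l ^ Suc j * t))" by (rule l(3)) fact
    finally show ?case by (simp add: mult.assoc)
  qed
  have "k \<noteq> 0" using k by (intro notI) simp
  then obtain j where j: "k = Suc j" using not0_implies_Suc by blast
  show ?thesis by (rule that[of "l ^ k" t1]) (use k l iter in \<open>auto simp: j\<close>)
qed

text \<open>
  Dividing by the variable turns \<open>\<phi> (l t) \<ge> 2 l \<phi> t\<close> into the growth condition for \<open>g = \<phi> t / t\<close>, and convexity with
  \<open>\<Delta>\<^sub>2\<close> bounds the increments of \<open>\<phi>\<close> as smoothness requires. Near 0 neither is available, and \<open>g\<close>
  is replaced by a linear function below a point \<open>T\<close>; this changes \<open>x g x\<close> and \<open>\<phi> x\<close> by bounded amounts only. A factor
  that crosses \<open>T\<close> is the reason for using \<open>l\<^sup>2\<close> in the growth condition.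
\<close>

lemma gauge_exists:
  assumes "delta2 \<phi>" "nabla2 \<phi>"
  obtains g L E B where "gauge g L E" "B \<ge> 0"
    "\<And>x. 0 \<le> x \<Longrightarrow> \<phi> x \<le> B + x * g x" "\<And>x. 0 \<le> x \<Longrightarrow> x * g x \<le> B + \<phi> x"
proof -
  obtain K t0 where K: "K > 0" "t0 > 0" "\<And>t. t > t0 \<Longrightarrow> \<phi> (2 * t) \<le> K * \<phi> t"
    using assms(1) unfolding delta2_def by blast
  obtain l t2 where l: "l \<ge> 2" "t2 > 0" "\<And>t. t \<ge> t2 \<Longrightarrow> 2 * l * \<phi> t \<le> \<phi> (l * t)"
    using nabla2_step[OF assms(2)] by blast
  obtain t3 where t3: "t3 > 0" "\<And>t. t \<ge> t3 \<Longrightarrow> 1 \<le> \<phi> t" using large[of 1] by blast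
  \<comment> \<open>Beyond \<open>T\<close> both growth conditions hold and \<open>\<phi>\<close> is positive.\<close>
  define T where "T = max (t0 + 1) (max t2 t3)"
  have T: "T > 0" "T > t0" "T \<ge> t2" "T \<ge> t3" using K by (auto simp: T_def)
  have phiT: "\<phi> t \<ge> 1" if "t \<ge> T" for t using t3(2)[of t] that T by simp
  define c where "c = \<phi> T / T^2"
  have c: "c > 0" using phiT[of T] T by (simp add: c_def)
  define g where "g s = (if s \<le> T then c * s else \<phi> s / s)" for s
  have gT: "g s = \<phi> s / s" if "s \<ge> T" for s
    using that T by (auto simp: g_def c_def power2_eq_square)
  have gs: "g s = c * s" if "s \<le> T" for s using that by (simp add: g_def)
  have pos: "0 < g x" if "0 < x" for x
    using that c phiT[of x] by (cases "x \<le> T") (auto simp: g_def)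
  have mono: "g x \<le> g y" if xy: "0 \<le> x" "x \<le> y" for x y
  proof -
    have A: "g x \<le> g y" if "x \<le> y" "y \<le> T" for x y using that c by (simp add: gs)
    have B: "g x \<le> g y" if "T \<le> x" "x \<le> y" for x y using that T slope[of x y] by (simp add: gT)
    show ?thesis using A[of x y] A[of x T] B[of x y] B[of T y] xy by linarith
  qed
  have growth: "2 * g x \<le> g (l\<^sup>2 * x)" if x: "0 \<le> x" for x
  proof -
    have big: "2 * g y \<le> g (l * y)" if y: "T \<le> y" for y
    proof -
      have "T \<le> l * y" using y T l mult_mono[of 1 l T y] by simp
      then show ?thesis using l(3)[of y] y T l(1) by (simp add: gT field_simps)
    qed
    have lx: "x \<le> l * x" "l * x \<le> l * (l * x)" using x l mult_right_mono[of 1 l x] mult_right_mono[of 1 l "l * x"] by auto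
    have "2 * g x \<le> g (l * (l * x))"
    proof -
      consider "T \<le> x" | "l * x \<le> T" | "x < T" "T < l * x" by linarith
      then show ?thesis
      proof cases
        case 1 then show ?thesis using big[OF 1] mono[of "l * x" "l * (l * x)"] lx x l by auto
      next
        case 2
        have "2 * g x \<le> l * (c * x)" using 2 lx gs[of x] x c l mult_right_mono[of 2 l "c * x"] by simp
        also have "\<dots> = g (l * x)" using gs[OF 2] by simp
        also have "\<dots> \<le> g (l * (l * x))" using lx x l by (intro mono) auto
        finally show ?thesis .
      next
        case 3
        have "2 * g x \<le> 2 * g (l * x)" using mono[of x "l * x"] lx x by simp
        also have "\<dots> \<le> g (l * (l * x))" using 3 by (intro big) auto
        finally show ?thesis .
      qed
    qed
    then show ?thesis by (simp add: power2_eq_square mult.assoc)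
  qed
  have smooth_large: "g (x + b) - g x \<le> K * (b / x) * g x" if x: "T \<le> x" and b: "0 \<le> b" "b \<le> x" for x b
  proof -
    have x0: "x > 0" using x T by simp
    have "(1 - b/x) * x + (b/x) * (2 * x) = x + b" using x0 by (simp add: field_simps)
    then have "\<phi> (x + b) \<le> (1 - b/x) * \<phi> x + (b/x) * \<phi> (2 * x)"
      using convex_onD[OF conv, of "b/x" x "2 * x"] x0 b by (simp only: real_scaleR_def) auto
    then have "\<phi> (x + b) - \<phi> x \<le> (b/x) * (\<phi> (2 * x) - \<phi> x)" by (simp add: algebra_simps)
    also have "\<dots> \<le> (b/x) * (K * \<phi> x)" using K(3)[of x] x T x0 b nonneg[of x] by (intro mult_left_mono) auto
    finally have *: "\<phi> (x + b) - \<phi> x \<le> (b/x) * (K * \<phi> x)" .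
    have "g (x + b) - g x = \<phi> (x + b) / (x + b) - \<phi> x / x" using x b by (simp add: gT)
    also have "\<dots> \<le> \<phi> (x + b) / x - \<phi> x / x"
      using x0 b nonneg[of "x + b"] by (intro diff_right_mono divide_left_mono) auto
    also have "\<dots> = (\<phi> (x + b) - \<phi> x) / x" by (simp add: diff_divide_distrib)
    also have "\<dots> \<le> (b/x) * (K * \<phi> x) / x" using * x0 by (intro divide_right_mono) auto
    also have "\<dots> = K * (b / x) * g x" using x by (simp add: gT)
    finally show ?thesis .
  qed
  have smooth: "g (x + b) - g x \<le> (K + 1) * (b / x) * g x" if x: "0 < x" and b: "0 \<le> b" "b \<le> x" for x b
  proof -
    have split: "(K + 1) * (b / x) * g x = K * (b / x) * g x + (b / x) * g x" by (simp only: distrib_right mult_1)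
    have extra: "0 \<le> (b / x) * g x" "0 \<le> K * (b / x) * g x" using x b pos[of x] K by auto
    consider "T \<le> x" | "x + b \<le> T" | "x < T" "T < x + b" by linarith
    then show ?thesis
    proof cases
      case 1 then show ?thesis using smooth_large[OF 1 b] extra split by linarith
    next
      case 2
      have "g (x + b) - g x = (b / x) * g x" using 2 b x by (simp add: gs algebra_simps)
      then show ?thesis using extra split by linarith
    next
      case 3
      have "g (T + (x + b - T)) - g T \<le> K * ((x + b - T) / T) * g T" using 3 b by (intro smooth_large) auto
      also have "\<dots> = K * (c * (x + b - T))" using T by (simp add: gs)
      also have "\<dots> \<le> K * (c * b)" using 3 K c by (intro mult_left_mono) auto
      finally have "g (x + b) - g T \<le> K * (c * b)" by simp
      moreover have "g T - g x \<le> c * b" using 3 c mult_left_mono[of T "x + b" c] by (simp add: gs algebra_simps)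
      moreover have eq: "b / x * g x = c * b" using 3 x by (simp add: gs)
      ultimately show ?thesis unfolding split mult.assoc[of K] eq by linarith
    qed
  qed
  have "gauge g (l\<^sup>2) (K + 1)"
  proof
    show "2 \<le> l\<^sup>2" using l(1) power_mono[of 2 l 2] by simp
  qed (use pos mono growth smooth K T in \<open>auto simp: gs\<close>)
  moreover have "\<phi> x \<le> \<phi> T + x * g x" if "0 \<le> x" for x
  proof (cases "x \<le> T")
    case True
    then show ?thesis using that c orlicz.mono[OF orlicz_axioms that True] by (simp add: gs add_increasing2)
  next
    case False
    then show ?thesis using T nonneg[of T] by (simp add: gT)
  qed
  moreover have "x * g x \<le> \<phi> T + \<phi> x" if x: "0 \<le> x" for x
  proof (cases "x \<le> T")
    case True
    have "x * g x = c * x^2" using True by (simp add: gs power2_eq_square)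
    also have "\<dots> \<le> c * T^2" using c x True by (intro mult_left_mono power_mono) auto
    also have "\<dots> = \<phi> T" using T by (simp add: c_def)
    finally show ?thesis using nonneg[OF x] by simp
  next
    case False
    then show ?thesis using T nonneg[of T] by (simp add: gT)
  qed
  moreover have "\<phi> T \<ge> 0" using T nonneg by simp
  ultimately show ?thesis using that by blast
qed

end

section \<open>Weak compactness\<close>

abbreviation "set_int A f \<equiv> (LINT t|unit_interval. indicator A t * (f t :: real))"

lemma set_int_integrable:
  "integrable unit_interval f \<Longrightarrow> A \<in> sets unit_interval \<Longrightarrow> integrable unit_interval (\<lambda>t. indicator A t * (f t :: real))"
  using integrable_mult_indicator[of A unit_interval f] by simp

lemma set_int_restrict: "set_int A f = set_int (A \<inter> {0..1}) f"
  by (intro Bochner_Integration.integral_cong) (auto simp: indicator_def)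

lemma borel_restrict: "B \<in> sets borel \<Longrightarrow> B \<inter> {0..1::real} \<in> sets unit_interval"
  by (auto simp: sets_restrict_space_iff)

lemma borel_eq_atMost_rat: "(borel :: real measure) = sigma UNIV (range (\<lambda>q::rat. {..real_of_rat q}))"
proof (rule borel_eq_sigmaI1[OF borel_eq_atMost])
  fix X :: "real set" assume "X \<in> range (\<lambda>a. {..a})"
  then obtain a where X: "X = {..a}" by blast
  let ?S = "sigma UNIV (range (\<lambda>q::rat. {..real_of_rat q}))"
  have "X = (\<Inter>q\<in>{q. a < real_of_rat q}. {..real_of_rat q})"
  proof (intro equalityI subsetI)
    fix x assume *: "x \<in> (\<Inter>q\<in>{q. a < real_of_rat q}. {..real_of_rat q})"
    show "x \<in> X"
    proof (rule ccontr)
      assume "x \<notin> X"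
      then have "a < x" using X by simp
      then obtain q where "a < real_of_rat q" "real_of_rat q < x" using of_rat_dense by blast
      with * show False by force
    qed
  qed (auto simp: X)
  also have "\<dots> \<in> sets ?S"
  proof (rule sets.countable_INT'')
    obtain q where "a < real_of_rat q" using of_rat_dense[of a "a+1"] by auto
    show "UNIV \<in> sets ?S" using sets.top[of ?S] by simp
  qed auto
  finally show "X \<in> sets ?S" .
qed auto

locale uniformly_integrable =
  fixes F :: "nat \<Rightarrow> real \<Rightarrow> real" and K :: real
  assumes int: "integrable unit_interval (F n)" and F_nonneg: "0 \<le> F n t"
    and bound: "(LINT t|unit_interval. F n t) \<le> K"
    and ui: "0 < e \<Longrightarrow> \<exists>d>0. \<forall>A\<in>sets unit_interval. measure unit_interval A < d \<longrightarrow> (\<forall>n. set_int A (F n) \<le> e)"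
begin

lemma nonneg: "0 \<le> set_int A (F n)" by (intro integral_nonneg_AE) (simp add: F_nonneg)

lemma set_int_le: "A \<in> sets unit_interval \<Longrightarrow> set_int A (F n) \<le> K"
proof -
  assume A: "A \<in> sets unit_interval"
  have "set_int A (F n) \<le> (LINT t|unit_interval. F n t)"
    by (intro integral_mono set_int_integrable int A mult_left_le_one_le F_nonneg) (auto simp: indicator_def)
  with bound[of n] show ?thesis by linarith
qed

lemma vanishing:
  assumes A: "range A \<subseteq> sets unit_interval" "decseq A" "(\<Inter>i. A i) = {}" and e: "0 < e"
  shows "\<exists>k. \<forall>i\<ge>k. \<forall>n. set_int (A i) (F n) \<le> e"
proof -
  interpret finite_measure unit_interval by (rule finite_measure_unit)
  obtain d where d: "d > 0" "\<And>A n. A\<in>sets unit_interval \<Longrightarrow> measure unit_interval A < d \<Longrightarrow> set_int A (F n) \<le> e"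
    using ui[OF e] by blast
  have "(\<lambda>i. measure unit_interval (A i)) \<longlonglongrightarrow> measure unit_interval (\<Inter>i. A i)"
    using A by (intro finite_Lim_measure_decseq) auto
  then have "(\<lambda>i. measure unit_interval (A i)) \<longlonglongrightarrow> 0" using A(3) by simp
  then have "\<forall>\<^sub>F i in sequentially. measure unit_interval (A i) < d" using d(1) by (rule order_tendstoD)
  then obtain k where "\<And>i. i \<ge> k \<Longrightarrow> measure unit_interval (A i) < d" by (auto simp: eventually_sequentially)
  then show ?thesis using d(2) A(1) by blast
qed

lemma subsequence: "uniformly_integrable (F \<circ> r) K"
proof
  fix e :: real assume "0 < e"
  then obtain d where d: "d > 0" "\<forall>A\<in>sets unit_interval. measure unit_interval A < d \<longrightarrow> (\<forall>n. set_int A (F n) \<le> e)"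
    using ui by blast
  then show "\<exists>d>0. \<forall>A\<in>sets unit_interval. measure unit_interval A < d \<longrightarrow> (\<forall>n. set_int A ((F \<circ> r) n) \<le> e)"
    by (intro exI[of _ d]) simp
qed (simp_all add: int F_nonneg bound)

lemma set_int_add:
  assumes "A \<in> sets unit_interval" "B \<in> sets unit_interval" "A \<inter> B = {}"
  shows "set_int (A \<union> B) (F n) = set_int A (F n) + set_int B (F n)"
proof -
  have "set_int (A \<union> B) (F n) = (LINT t|unit_interval. indicator A t * F n t + indicator B t * F n t)"
    using assms by (intro Bochner_Integration.integral_cong) (auto simp: indicator_def)
  then show ?thesis by (simp add: set_int_integrable[OF int] assms)
qed

lemma set_int_UN:
  fixes A :: "nat \<Rightarrow> real set"
  assumes "range A \<subseteq> sets unit_interval" "disjoint_family A"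
  shows "set_int (\<Union>i<k. A i) (F n) = (\<Sum>i<k. set_int (A i) (F n))"
proof (induction k)
  case (Suc k)
  have "(\<Union>i<Suc k. A i) = (\<Union>i<k. A i) \<union> A k" by (auto simp: less_Suc_eq)
  moreover have "(\<Union>i<k. A i) \<inter> A k = {}"  proof (rule equals0I)
    fix x assume "x \<in> (\<Union>i<k. A i) \<inter> A k"
    then obtain i where i: "i < k" "x \<in> A i" "x \<in> A k" by blast
    have "A i \<inter> A k = {}" using disjoint_family_onD[OF assms(2), of i k] i(1) by simp
    with i show False by blast
  qed
  moreover have "(\<Union>i<k. A i) \<in> sets unit_interval" "A k \<in> sets unit_interval" using assms(1) by auto
  ultimately have "set_int (\<Union>i<Suc k. A i) (F n) = set_int (\<Union>i<k. A i) (F n) + set_int (A k) (F n)"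
    using set_int_add[of "\<Union>i<k. A i" "A k" n] by (simp only:)
  then show ?case unfolding Suc by (simp only: sum.lessThan_Suc)
qed simp

definition conv_set where "conv_set A \<longleftrightarrow> convergent (\<lambda>n. set_int A (F n))"

text \<open>
  Dynkin's argument: the sets over which the integrals converge are closed under complements, and under disjoint
  unions because uniform integrability makes the tail of a union negligible uniformly in \<open>n\<close>.
\<close>

lemma conv_borel:
  assumes rat: "\<And>q. conv_set {..real_of_rat q}" and A: "A \<in> sets borel"
  shows "conv_set A"
proof -
  have mem: "A \<in> sigma_sets UNIV (range (\<lambda>q::rat. {..real_of_rat q}))"
    using A by (subst (asm) borel_eq_atMost_rat) simp
  have IS: "Int_stable (range (\<lambda>q::rat. {..real_of_rat q}))"
  proof (rule Int_stableI_image)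
    fix q q' :: rat
    have "{..real_of_rat q} \<inter> {..real_of_rat q'} = {..real_of_rat (min q q')}"
      by (auto simp: min_def of_rat_less_eq)
    then show "\<exists>k\<in>UNIV. {..real_of_rat q} \<inter> {..real_of_rat q'} = {..real_of_rat k}" by blast
  qed
  have sub: "range (\<lambda>q::rat. {..real_of_rat q}) \<subseteq> Pow UNIV" by simp
  show ?thesis
  proof (rule sigma_sets_induct_disjoint[OF IS sub mem, of conv_set])
    fix A assume "A \<in> range (\<lambda>q::rat. {..real_of_rat q})" then show "conv_set A" using rat by auto
  next
    show "conv_set {}" by (simp add: conv_set_def convergent_const)
  next
    fix A assume compl: "A \<in> sigma_sets UNIV (range (\<lambda>q::rat. {..real_of_rat q}))" "conv_set A"
    have A: "A \<inter> {0..1} \<in> sets unit_interval" using compl(1) by (intro borel_restrict, subst borel_eq_atMost_rat) simp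
    have eq: "set_int (UNIV - A) (F n) = set_int {..real_of_rat 1} (F n) - set_int A (F n)" for n
    proof -
      have *: "{0..1} \<in> sets unit_interval" by (simp add: sets_restrict_space_iff)
      have "set_int (A \<inter> {0..1} \<union> ({0..1} - A \<inter> {0..1})) (F n) = set_int (A \<inter> {0..1}) (F n) + set_int ({0..1} - A \<inter> {0..1}) (F n)"
        using A * by (intro set_int_add) auto
      moreover have "A \<inter> {0..1} \<union> ({0..1} - A \<inter> {0..1}) = {..real_of_rat 1} \<inter> {0..1}" 
        "{0..1} - A \<inter> {0..1} = (UNIV - A) \<inter> {0..1}" by auto
      ultimately show ?thesis unfolding set_int_restrict[of "UNIV - A"] set_int_restrict[of A] set_int_restrict[of "{..real_of_rat 1}"]
        by simp
    qed
    show "conv_set (UNIV - A)" unfolding conv_set_def eq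
      by (intro convergent_diff) (use rat[of 1] compl(2) in \<open>auto simp: conv_set_def\<close>)
  next
    fix A :: "nat \<Rightarrow> real set"
    assume union: "disjoint_family A" "range A \<subseteq> sigma_sets UNIV (range (\<lambda>q::rat. {..real_of_rat q}))" "\<And>i. conv_set (A i)"
    define B where "B i = A i \<inter> {0..1}" for i
    have Ab: "A i \<in> sets borel" for i using union(2) by (subst borel_eq_atMost_rat) auto
    have B: "range B \<subseteq> sets unit_interval" unfolding B_def using Ab borel_restrict by auto
    have Bk: "\<And>k. (\<Union>i<k. B i) \<in> sets unit_interval" "(\<Union>i. B i) \<in> sets unit_interval" using B by auto
    have dB: "disjoint_family B" using union(1) unfolding disjoint_family_on_def B_def by blast
    have "Cauchy (\<lambda>n. set_int (\<Union>i. B i) (F n))"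
    proof (rule CauchyI)
      fix e :: real assume e: "e > 0"
      define R where "R k = (\<Union>i. B i) - (\<Union>i<k. B i)" for k
      have "\<exists>k. \<forall>i\<ge>k. \<forall>n. set_int (R i) (F n) \<le> e/4"
      proof (rule vanishing)
        show "range R \<subseteq> sets unit_interval" using Bk by (auto simp: R_def)
        show "decseq R" by (rule decseq_SucI) (auto simp: R_def less_Suc_eq)
        show "(\<Inter>i. R i) = {}" by (auto simp: R_def)
      qed (use e in simp)
      then obtain k where k: "\<And>n. set_int (R k) (F n) \<le> e/4" by blast
      have split: "set_int (\<Union>i. B i) (F n) = (\<Sum>i<k. set_int (B i) (F n)) + set_int (R k) (F n)" for n
      proof -
        have 1: "(\<Union>i. B i) = (\<Union>i<k. B i) \<union> R k" and 2: "(\<Union>i<k. B i) \<inter> R k = {}" by (auto simp: R_def)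
        have "R k \<in> sets unit_interval" unfolding R_def using Bk by (intro sets.Diff) auto
        from set_int_add[OF Bk(1) this 2, of n] show ?thesis unfolding 1[symmetric] set_int_UN[OF B dB] .
      qed
      have "convergent (\<lambda>n. \<Sum>i<k. set_int (B i) (F n))"
        using union(3) by (intro convergent_sum) (simp add: conv_set_def B_def set_int_restrict[symmetric])
      then obtain N where N: "\<And>m n. m \<ge> N \<Longrightarrow> n \<ge> N \<Longrightarrow> \<bar>(\<Sum>i<k. set_int (B i) (F m)) - (\<Sum>i<k. set_int (B i) (F n))\<bar> < e/4"
        using CauchyD[OF convergent_Cauchy, of "\<lambda>n. \<Sum>i<k. set_int (B i) (F n)" "e/4"] e unfolding real_norm_def by auto
      have "norm (set_int (\<Union>i. B i) (F m) - set_int (\<Union>i. B i) (F n)) < e" if "m \<ge> N" "n \<ge> N" for m n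
        using N[OF that] k[of m] k[of n] nonneg[of "R k" m] nonneg[of "R k" n] e unfolding split real_norm_def by linarith
      then show "\<exists>M. \<forall>m\<ge>M. \<forall>n\<ge>M. norm (set_int (\<Union>i. B i) (F m) - set_int (\<Union>i. B i) (F n)) < e" by blast
    qed
    then have "convergent (\<lambda>n. set_int (\<Union>i. B i) (F n))" by (rule Cauchy_convergent)
    moreover have "(\<Union>i. B i) = (\<Union>i. A i) \<inter> {0..1}" by (auto simp: B_def)
    ultimately show "conv_set (\<Union>i. A i)" unfolding conv_set_def set_int_restrict[of "\<Union>i. A i"] by simp
  qed
qed

lemma conv_measurable:
  assumes rat: "\<And>q. conv_set {..real_of_rat q}" and A: "A \<in> sets unit_interval"
  shows "conv_set A"
proof -
  have AL: "A \<in> sets (completion lborel)" using A by (simp add: sets_restrict_space_iff)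
  define B where "B = main_part lborel A"
  have B: "B \<in> sets borel" using main_part_sets[OF AL] by (simp add: B_def)
  have "AE t in lborel. t \<in> A \<longleftrightarrow> t \<in> B"
    using AE_notin_null_part[OF AL] by eventually_elim (use main_part_null_part_Un[OF AL] in \<open>auto simp: B_def\<close>)
  then have "AE t in lebesgue. t \<in> A \<longleftrightarrow> t \<in> B" by (rule AE_completion)
  then have AE: "AE t in unit_interval. t \<in> A \<longleftrightarrow> t \<in> B" by (subst AE_restrict_space_iff) auto
  have mB: "B \<inter> {0..1} \<in> sets unit_interval" by (rule borel_restrict[OF B])
  have "set_int A (F n) = set_int (B \<inter> {0..1}) (F n)" for n
  proof (rule integral_cong_AE)
    show "AE t in unit_interval. indicator A t * F n t = indicator (B \<inter> {0..1}) t * F n t"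
      using AE AE_space by eventually_elim (auto simp: indicator_def)
  qed (use A mB int[of n] in \<open>auto simp: set_int_integrable\<close>)
  then show ?thesis using conv_borel[OF rat B] unfolding conv_set_def set_int_restrict[of B] by simp
qed

text \<open>
  The limits of the integrals form a finite measure, countably additive by uniform integrability, and
  Radon-Nikodym provides its density.
\<close>

lemma density_exists:
  assumes rat: "\<And>q. conv_set {..real_of_rat q}"
  shows "\<exists>f. integrable unit_interval f \<and> (\<forall>A\<in>sets unit_interval. (\<lambda>n. set_int A (F n)) \<longlonglongrightarrow> set_int A f)"
proof -
  interpret U: finite_measure unit_interval by (rule finite_measure_unit)
  define \<nu> where "\<nu> A = lim (\<lambda>n. set_int A (F n))" for A
  have lim: "(\<lambda>n. set_int A (F n)) \<longlonglongrightarrow> \<nu> A" if "A \<in> sets unit_interval" for A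
    using conv_measurable[OF rat that] unfolding conv_set_def \<nu>_def by (simp add: convergent_LIMSEQ_iff)
  have nu0: "0 \<le> \<nu> A" if "A \<in> sets unit_interval" for A
    by (rule LIMSEQ_le_const[OF lim[OF that]]) (simp add: nonneg)
  have add: "\<nu> (A \<union> B) = \<nu> A + \<nu> B" if "A \<in> sets unit_interval" "B \<in> sets unit_interval" "A \<inter> B = {}" for A B
  proof (rule LIMSEQ_unique[OF lim])
    show "(\<lambda>n. set_int (A \<union> B) (F n)) \<longlonglongrightarrow> \<nu> A + \<nu> B"
      unfolding set_int_add[OF that] by (intro tendsto_add lim that)
  qed (use that in auto)
  define N where "N = measure_of (space unit_interval) (sets unit_interval) (\<lambda>A. ennreal (\<nu> A))"
  have pos: "positive (sets unit_interval) (\<lambda>A. ennreal (\<nu> A))" by (simp add: positive_def \<nu>_def)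
  have ca: "countably_additive (sets unit_interval) (\<lambda>A. ennreal (\<nu> A))"
  proof (rule sets.empty_continuous_imp_countably_additive[OF pos])
    show "additive (sets unit_interval) (\<lambda>A. ennreal (\<nu> A))"
      unfolding additive_def by (auto simp: add nu0)
  next
    fix A :: "nat \<Rightarrow> real set" assume A: "range A \<subseteq> sets unit_interval" "decseq A" "(\<Inter>i. A i) = {}"
    have "(\<lambda>i. \<nu> (A i)) \<longlonglongrightarrow> 0"
    proof (rule LIMSEQ_I)
      fix e :: real assume e: "e > 0"
      then obtain k where k: "\<And>i n. i \<ge> k \<Longrightarrow> set_int (A i) (F n) \<le> e/2" using vanishing[OF A, of "e/2"] by auto
      have "norm (\<nu> (A i) - 0) < e" if i: "i \<ge> k" for i
      proof -
        have Ai: "A i \<in> sets unit_interval" using A(1) by auto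
        have "\<nu> (A i) \<le> e/2" by (rule LIMSEQ_le_const2[OF lim[OF Ai]]) (use k[OF i] in auto)
        then show ?thesis using nu0[OF Ai] e by simp
      qed
      then show "\<exists>no. \<forall>n\<ge>no. norm (\<nu> (A n) - 0) < e" by blast
    qed
    then show "(\<lambda>i. ennreal (\<nu> (A i))) \<longlonglongrightarrow> 0" using tendsto_ennrealI[of _ 0] by fastforce
  qed simp
  have eN: "emeasure N A = ennreal (\<nu> A)" if "A \<in> sets unit_interval" for A
    unfolding N_def by (rule emeasure_measure_of_sigma[OF sets.sigma_algebra_axioms pos ca that])
  have sN: "sets N = sets unit_interval" unfolding N_def by (rule sets.sets_measure_of_eq)
  have ac: "absolutely_continuous unit_interval N"
    unfolding absolutely_continuous_def
  proof
    fix A assume A: "A \<in> null_sets unit_interval"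
    then have As: "A \<in> sets unit_interval" by auto
    have "set_int A (F n) = 0" for n
      by (rule integral_eq_zero_AE) (use AE_not_in[OF A] in eventually_elim, simp)
    then have "(\<lambda>n. 0) \<longlonglongrightarrow> \<nu> A" using lim[OF As] by simp
    then have "\<nu> A = 0" by (simp add: LIMSEQ_const_iff)
    then show "A \<in> null_sets N" using As by (simp add: null_sets_def sN eN)
  qed
  obtain h where h [measurable]: "h \<in> borel_measurable unit_interval" and dN: "density unit_interval h = N"
    using U.Radon_Nikodym[OF ac sN] by blast
  have hA: "(\<integral>\<^sup>+t. h t * indicator A t \<partial>unit_interval) = ennreal (\<nu> A)" if "A \<in> sets unit_interval" for A
    using emeasure_density[OF h that] eN[OF that] dN by simp
  have "(\<integral>\<^sup>+t. h t \<partial>unit_interval) = (\<integral>\<^sup>+t. h t * indicator (space unit_interval) t \<partial>unit_interval)"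
    by (intro nn_integral_cong) (simp add: indicator_def)
  also have "\<dots> = ennreal (\<nu> (space unit_interval))" by (rule hA) (rule sets.top)
  finally have "(\<integral>\<^sup>+t. h t \<partial>unit_interval) \<noteq> \<infinity>" by simp
  then have hfin: "AE t in unit_interval. h t \<noteq> \<infinity>" by (intro nn_integral_PInf_AE h)
  define f where "f t = enn2real (h t)" for t
  have [measurable]: "f \<in> borel_measurable unit_interval" unfolding f_def by measurable
  have eq: "(\<integral>\<^sup>+t. ennreal (indicator A t * f t) \<partial>unit_interval) = ennreal (\<nu> A)" if "A \<in> sets unit_interval" for A
  proof (subst hA[OF that, symmetric], rule nn_integral_cong_AE)
    show "AE t in unit_interval. ennreal (indicator A t * f t) = h t * indicator A t"
      using hfin AE_space by eventually_elim (auto simp: indicator_def f_def less_top)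
  qed
  have "integrable unit_interval f"
  proof (rule integrableI_nonneg)
    have "(\<integral>\<^sup>+t. ennreal (f t) \<partial>unit_interval) = (\<integral>\<^sup>+t. ennreal (indicator (space unit_interval) t * f t) \<partial>unit_interval)"
      by (intro nn_integral_cong) (auto simp: indicator_def)
    then show "(\<integral>\<^sup>+t. ennreal (f t) \<partial>unit_interval) < \<infinity>" by (subst (asm) eq) auto
  qed (auto simp: f_def)
  moreover have "set_int A f = \<nu> A" if A: "A \<in> sets unit_interval" for A
  proof -
    have "set_int A f = enn2real (\<integral>\<^sup>+t. ennreal (indicator A t * f t) \<partial>unit_interval)"
      by (rule integral_eq_nn_integral) (use A in \<open>auto simp: f_def\<close>)
    then show ?thesis using eq[OF A] nu0[OF A] by simp
  qed
  ultimately show ?thesis using lim by (intro exI[of _ f]) auto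
qed

end

lemma uniformly_integrable_weak_limit:
  assumes "uniformly_integrable F K"
  shows "\<exists>r f. strict_mono (r::nat\<Rightarrow>nat) \<and> integrable unit_interval f \<and>
     (\<forall>A\<in>sets unit_interval. (\<lambda>n. set_int A (F (r n))) \<longlonglongrightarrow> set_int A f)"
proof -
  interpret uniformly_integrable F K by fact
  define I where "I k n = set_int {..real_of_rat (nat_to_rat_surj k)} (F n)" for k n
  interpret subseqs "\<lambda>k s. convergent (\<lambda>n. I k (s n))"
  proof
    fix k and s :: "nat \<Rightarrow> nat" assume "strict_mono s"
    have "I k (s n) \<in> {0..K}" for n
      unfolding I_def set_int_restrict[of "{..real_of_rat (nat_to_rat_surj k)}"] atLeastAtMost_iff
      by (intro conjI nonneg set_int_le borel_restrict) simp
    then obtain l r where "strict_mono r" "((\<lambda>n. I k (s n)) \<circ> r) \<longlonglongrightarrow> l"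
      using compact_Icc[of 0 K, unfolded compact_def, rule_format, of "\<lambda>n. I k (s n)"] by auto
    then show "\<exists>r'. strict_mono r' \<and> convergent (\<lambda>n. I k ((s \<circ> r') n))" by (auto simp: convergent_def o_def)
  qed
  have conv: "convergent (\<lambda>n. I k (diagseq n))" for k
  proof -
    have "convergent (\<lambda>n. I k ((diagseq \<circ> ((+) (Suc k))) n))"
    proof (rule diagseq_holds)
      fix r s :: "nat \<Rightarrow> nat" and n assume "strict_mono r" "convergent (\<lambda>i. I n (s i))"
      then show "convergent (\<lambda>i. I n ((s \<circ> r) i))"
        using convergent_subseq_convergent[of "\<lambda>i. I n (s i)" r] by (simp add: o_def)
    qed
    then show ?thesis using convergent_ignore_initial_segment[of "\<lambda>n. I k (diagseq n)" "Suc k"] by (simp add: o_def add.commute)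
  qed
  interpret S: uniformly_integrable "F \<circ> diagseq" K by (rule subsequence)
  have "S.conv_set {..real_of_rat q}" for q
  proof -
    obtain k where "q = nat_to_rat_surj k" using surj_nat_to_rat_surj by (metis surjD)
    then have "convergent (\<lambda>n. set_int {..real_of_rat q} ((F \<circ> diagseq) n))" using conv[of k] by (simp only: I_def o_def)
    then show ?thesis unfolding S.conv_set_def .
  qed
  from S.density_exists[OF this] show ?thesis using subseq_diagseq by (auto simp: o_def)
qed

lemma bounded_mult_integrable:
  assumes "w \<in> borel_measurable unit_interval" "\<And>t. \<bar>w t\<bar> \<le> (b::real)" "integrable unit_interval u"
  shows "integrable unit_interval (\<lambda>t. w t * u t :: real)"
proof (rule Bochner_Integration.integrable_bound[of _ "\<lambda>t. b * \<bar>u t\<bar>"])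
  show "integrable unit_interval (\<lambda>t. b * \<bar>u t\<bar>)" using assms by simp
  show "(\<lambda>t. w t * u t) \<in> borel_measurable unit_interval" using assms by measurable
  show "AE t in unit_interval. norm (w t * u t) \<le> norm (b * \<bar>u t\<bar>)"
  proof (rule AE_I2)
    fix t
    have "norm (w t * u t) \<le> b * \<bar>u t\<bar>" using assms(2)[of t] by (simp add: abs_mult mult_right_mono)
    also have "\<dots> \<le> norm (b * \<bar>u t\<bar>)" unfolding real_norm_def by (rule abs_ge_self)
    finally show "norm (w t * u t) \<le> norm (b * \<bar>u t\<bar>)" .
  qed
qed

text \<open>
  Rounding \<open>h\<close> down to multiples of \<open>d\<close> leaves finitely many values, for which the convergence over sets
  suffices.
\<close>

lemma weak_limit_bounded:
  fixes f :: "nat \<Rightarrow> real \<Rightarrow> real"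
  assumes f: "\<And>n. integrable unit_interval (f n)" and l: "integrable unit_interval l"
    and bound: "\<And>n. (LINT t|unit_interval. \<bar>f n t\<bar>) \<le> K"
    and lim: "\<And>A. A \<in> sets unit_interval \<Longrightarrow> (\<lambda>n. set_int A (f n)) \<longlonglongrightarrow> set_int A l"
    and h [measurable]: "h \<in> borel_measurable unit_interval" and hB: "\<And>t. \<bar>h t\<bar> \<le> B"
  shows "(\<lambda>n. LINT t|unit_interval. h t * f n t) \<longlonglongrightarrow> (LINT t|unit_interval. h t * l t)"
proof (rule LIMSEQ_I)
  fix e :: real assume e: "e > 0"
  define Q where "Q = \<bar>K\<bar> + (LINT t|unit_interval. \<bar>l t\<bar>) + 1"
  have l0: "0 \<le> (LINT t|unit_interval. \<bar>l t\<bar>)" by (intro integral_nonneg_AE AE_I2) (rule abs_ge_zero)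
  have Q: "Q > 0" "(LINT t|unit_interval. \<bar>l t\<bar>) \<le> Q" "K \<le> Q"
    using l0 abs_ge_zero[of K] abs_ge_self[of K] unfolding Q_def by linarith+
  define d where "d = e / (4 * Q)"
  have d: "d > 0" "d * Q = e / 4" using e Q(1) by (auto simp: d_def)
  define m where "m = \<lceil>B / d\<rceil> + 1"
  define A where "A j = {t\<in>space unit_interval. \<lfloor>h t / d\<rfloor> = j}" for j :: int
  have A: "A j \<in> sets unit_interval" for j unfolding A_def by measurable
  define s where "s t = d * of_int \<lfloor>h t / d\<rfloor>" for t
  have s_meas [measurable]: "s \<in> borel_measurable unit_interval" unfolding s_def by measurable
  have hs: "\<bar>h t - s t\<bar> \<le> d" for t
  proof -
    have "h t = d * (h t / d)" using d(1) by simp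
    then have "h t - s t = d * (h t / d - of_int \<lfloor>h t / d\<rfloor>)" by (simp add: s_def right_diff_distrib)
    moreover have "\<bar>h t / d - of_int \<lfloor>h t / d\<rfloor>\<bar> \<le> 1" by linarith
    ultimately show ?thesis using d(1) by (simp add: abs_mult mult_left_le)
  qed
  have s_bound: "\<bar>s t\<bar> \<le> B + d" for t using hs[of t] hB[of t] by linarith
  have s_eq: "(LINT t|unit_interval. s t * u t) = (\<Sum>j=-m..m. d * of_int j * set_int (A j) u)" 
    if u: "integrable unit_interval u" for u
  proof -
    have "(LINT t|unit_interval. s t * u t) = (LINT t|unit_interval. (\<Sum>j=-m..m. d * of_int j * (indicator (A j) t * u t)))"
    proof (intro Bochner_Integration.integral_cong refl)
      fix t assume t: "t \<in> space unit_interval"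
      have "\<bar>h t / d\<bar> \<le> B / d" using hB[of t] d(1) by (simp add: divide_right_mono)
      then have "- (B / d) \<le> h t / d" "h t / d \<le> B / d" by (auto simp only: abs_le_iff)
      moreover have "B / d \<le> of_int \<lceil>B / d\<rceil>" by (rule le_of_int_ceiling)
      ultimately have mem: "\<lfloor>h t / d\<rfloor> \<in> {-m..m}" unfolding m_def
        by (simp only: atLeastAtMost_iff le_floor_iff floor_le_iff of_int_add of_int_minus of_int_1) linarith
      define i where "i = \<lfloor>h t / d\<rfloor>"
      have "d * of_int j * (indicator (A j) t * u t) = (if j = i then s t * u t else 0)" for j
        using t by (cases "j = i") (simp_all only: A_def s_def indicator_def i_def mem_Collect_eq if_True simp_thms, simp_all)
      then have "(\<Sum>j=-m..m. d * of_int j * (indicator (A j) t * u t)) = (\<Sum>j\<in>{-m..m}. if j = i then s t * u t else 0)"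
        by (simp only:)
      also have "\<dots> = s t * u t" unfolding sum.delta[OF finite_atLeastAtMost_int] using mem by (simp only: i_def if_True)
      finally show "s t * u t = (\<Sum>j=-m..m. d * of_int j * (indicator (A j) t * u t))" by (rule sym)
    qed
    also have "\<dots> = (\<Sum>j=-m..m. LINT t|unit_interval. d * of_int j * (indicator (A j) t * u t))"
      by (intro Bochner_Integration.integral_sum integrable_mult_right set_int_integrable[OF u A])
    finally show ?thesis by (simp only: integral_mult_right_zero)
  qed
  have near: "\<bar>(LINT t|unit_interval. h t * u t) - (LINT t|unit_interval. s t * u t)\<bar> \<le> e/4"
    if u: "integrable unit_interval u" "(LINT t|unit_interval. \<bar>u t\<bar>) \<le> Q" for u
  proof -
    have i: "integrable unit_interval (\<lambda>t. h t * u t)" "integrable unit_interval (\<lambda>t. s t * u t)"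
      by (rule bounded_mult_integrable[OF h hB u(1)], rule bounded_mult_integrable[OF s_meas s_bound u(1)])
    have "\<bar>(LINT t|unit_interval. h t * u t) - (LINT t|unit_interval. s t * u t)\<bar> = \<bar>LINT t|unit_interval. h t * u t - s t * u t\<bar>"
      using i by simp
    also have "\<dots> \<le> (LINT t|unit_interval. \<bar>h t * u t - s t * u t\<bar>)" by (rule integral_abs_bound)
    also have "\<dots> \<le> (LINT t|unit_interval. d * \<bar>u t\<bar>)"
    proof (intro integral_mono integrable_abs Bochner_Integration.integrable_diff i integrable_mult_right u(1))
      fix t
      have "\<bar>h t * u t - s t * u t\<bar> = \<bar>h t - s t\<bar> * \<bar>u t\<bar>" by (simp add: left_diff_distrib flip: abs_mult)
      also have "\<dots> \<le> d * \<bar>u t\<bar>" by (intro mult_right_mono hs) auto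
      finally show "\<bar>h t * u t - s t * u t\<bar> \<le> d * \<bar>u t\<bar>" .
    qed
    also have "\<dots> \<le> d * Q" using u(2) d(1) by (simp add: mult_left_mono)
    finally show ?thesis using d(2) by simp
  qed
  have "(\<lambda>n. LINT t|unit_interval. s t * f n t) \<longlonglongrightarrow> (LINT t|unit_interval. s t * l t)"
    unfolding s_eq[OF f] s_eq[OF l] by (intro tendsto_sum tendsto_mult_left lim A)
  then obtain N where N: "\<And>n. n \<ge> N \<Longrightarrow> \<bar>(LINT t|unit_interval. s t * f n t) - (LINT t|unit_interval. s t * l t)\<bar> < e/4"
    using LIMSEQ_D[of "\<lambda>n. LINT t|unit_interval. s t * f n t" _ "e/4"] e unfolding real_norm_def by auto
  have "norm ((LINT t|unit_interval. h t * f n t) - (LINT t|unit_interval. h t * l t)) < e" if "n \<ge> N" for n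
    using N[OF that] near[OF f[of n] order_trans[OF bound Q(3)]] near[OF l Q(2)] e unfolding real_norm_def by linarith
  then show "\<exists>no. \<forall>n\<ge>no. norm ((LINT t|unit_interval. h t * f n t) - (LINT t|unit_interval. h t * l t)) < e" by blast
qed

context gauge
begin

lemma Phi_measurable [measurable]:
  assumes "v \<in> borel_measurable M" shows "(\<lambda>t. \<Phi> \<bar>v t\<bar>) \<in> borel_measurable M"
proof -
  have "mono (\<lambda>x. \<Phi> (max 0 x))" by (rule monoI) (auto intro!: Phi_mono)
  then have "(\<lambda>x. \<Phi> (max 0 x)) \<in> borel_measurable borel" by (rule borel_measurable_mono)
  from measurable_compose[OF _ this, of "\<lambda>t. \<bar>v t\<bar>" M] assms show ?thesis by simp
qed

lemma G_measurable [measurable]: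
  assumes "v \<in> borel_measurable M" shows "(\<lambda>t. G (v t)) \<in> borel_measurable M"
proof -
  have "mono (\<lambda>x. g (max 0 x))" by (rule monoI) (auto intro!: g_mono)
  then have "(\<lambda>x. g (max 0 x)) \<in> borel_measurable borel" by (rule borel_measurable_mono)
  from measurable_compose[OF _ this, of "\<lambda>t. \<bar>v t\<bar>" M] assms
  have [measurable]: "(\<lambda>t. g \<bar>v t\<bar>) \<in> borel_measurable M" by simp
  show ?thesis using assms unfolding G_def by measurable
qed

definition finite_energy :: "(real \<Rightarrow> real) \<Rightarrow> bool" where
  "finite_energy v \<longleftrightarrow> v \<in> borel_measurable unit_interval \<and> integrable unit_interval (\<lambda>t. \<Phi> \<bar>v t\<bar>)"

definition energy :: "(real \<Rightarrow> real) \<Rightarrow> real" where "energy v = (LINT t|unit_interval. \<Phi> \<bar>v t\<bar>)"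

lemma finite_energyD [dest]: "finite_energy v \<Longrightarrow> v \<in> borel_measurable unit_interval" "finite_energy v \<Longrightarrow> integrable unit_interval (\<lambda>t. \<Phi> \<bar>v t\<bar>)"
  by (simp_all add: finite_energy_def)

lemma energy_nonneg: "0 \<le> energy v" unfolding energy_def by (intro integral_nonneg_AE AE_I2 Phi_nonneg) simp

lemma finite_energy_dominated:
  assumes "v \<in> borel_measurable unit_interval" "integrable unit_interval b" "\<And>t. \<Phi> \<bar>v t\<bar> \<le> b t"
  shows "finite_energy v" "energy v \<le> (LINT t|unit_interval. b t)"
proof -
  show "finite_energy v" unfolding finite_energy_def
  proof
    show "integrable unit_interval (\<lambda>t. \<Phi> \<bar>v t\<bar>)"
      by (rule Bochner_Integration.integrable_bound[OF assms(2)])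
        (use assms in \<open>auto intro!: AE_I2 simp: abs_of_nonneg Phi_nonneg intro: order_trans[OF _ abs_ge_self]\<close>)
  qed fact
  then show "energy v \<le> (LINT t|unit_interval. b t)" unfolding energy_def
    by (intro integral_mono finite_energyD assms)
qed

lemma Phi_add: "\<Phi> \<bar>x + y\<bar> \<le> C * (\<Phi> \<bar>x\<bar> + \<Phi> \<bar>y\<bar>)"
proof -
  have "\<Phi> \<bar>x + y\<bar> \<le> \<Phi> (2 * max \<bar>x\<bar> \<bar>y\<bar>)" by (intro Phi_mono) auto
  also have "\<dots> \<le> C * \<Phi> (max \<bar>x\<bar> \<bar>y\<bar>)" by (intro Phi_double) auto
  also have "\<dots> \<le> C * (\<Phi> \<bar>x\<bar> + \<Phi> \<bar>y\<bar>)"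
    using Phi_nonneg[of "\<bar>x\<bar>"] Phi_nonneg[of "\<bar>y\<bar>"] D_le_C by (intro mult_left_mono) (auto simp: max_def)
  finally show ?thesis .
qed

lemma finite_energy_add: "finite_energy v \<Longrightarrow> finite_energy w \<Longrightarrow> finite_energy (\<lambda>t. v t + w t)"
  by (rule finite_energy_dominated(1)[of _ "\<lambda>t. C * (\<Phi> \<bar>v t\<bar> + \<Phi> \<bar>w t\<bar>)"])
    (auto simp: Phi_add intro!: borel_measurable_add)

lemma finite_energy_scale: 
  assumes "finite_energy v" "\<bar>c\<bar> \<le> 1" shows "finite_energy (\<lambda>t. c * v t)"
  by (rule finite_energy_dominated(1)[of _ "\<lambda>t. \<Phi> \<bar>v t\<bar>"])
    (use assms in \<open>auto intro!: Phi_mono simp: abs_mult mult_left_le_one_le\<close>)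

lemma finite_energy_0: "finite_energy (\<lambda>t. 0)" by (simp add: finite_energy_def)

lemma abs_G: "\<bar>G a\<bar> = g \<bar>a\<bar>" using g_nonneg[of "\<bar>a\<bar>"] g_0 by (auto simp: G_def abs_mult sgn_if)

lemma G_integrable:
  assumes "finite_energy v" "finite_energy w" shows "integrable unit_interval (\<lambda>t. G (v t) * w t)"
proof (rule Bochner_Integration.integrable_bound)
  show "integrable unit_interval (\<lambda>t. C * (\<Phi> \<bar>v t\<bar> + \<Phi> \<bar>w t\<bar>))" using assms by auto
  show "(\<lambda>t. G (v t) * w t) \<in> borel_measurable unit_interval" using finite_energyD(1)[OF assms(1)] finite_energyD(1)[OF assms(2)] by measurable
  show "AE t in unit_interval. norm (G (v t) * w t) \<le> norm (C * (\<Phi> \<bar>v t\<bar> + \<Phi> \<bar>w t\<bar>))"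
  proof (rule AE_I2)
    fix t
    have "norm (G (v t) * w t) = g \<bar>v t\<bar> * \<bar>w t\<bar>" by (simp add: abs_mult abs_G)
    also have "\<dots> \<le> C * (\<Phi> \<bar>v t\<bar> + \<Phi> \<bar>w t\<bar>)" by (intro g_mult_le) auto
    also have "\<dots> \<le> norm (C * (\<Phi> \<bar>v t\<bar> + \<Phi> \<bar>w t\<bar>))" unfolding real_norm_def by (rule abs_ge_self)
    finally show "norm (G (v t) * w t) \<le> norm (C * (\<Phi> \<bar>v t\<bar> + \<Phi> \<bar>w t\<bar>))" .
  qed
qed

text \<open>
  Young's inequality with a small factor on one side: the exponent \<open>p > 1\<close> makes \<open>\<Phi> (c b) / c\<close> small compared with \<open>\<Phi> b\<close>.
\<close>

lemma young_eps:
  assumes "e > 0" obtains B where "B \<ge> 0" "\<And>a b. 0 \<le> a \<Longrightarrow> 0 \<le> b \<Longrightarrow> g a * b \<le> B * \<Phi> a + e * \<Phi> b"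
proof -
  \<comment> \<open>Chosen such that \<open>C\<^sup>2 c\<^sup>p\<^sup>-\<^sup>1 \<le> e\<close>.\<close>
  define c where "c = min 1 ((e / C\<^sup>2) powr (1 / (p - 1)))"
  have C2: "C\<^sup>2 > 0" using D_le_C by simp
  have c: "0 < c" "c \<le> 1" using assms C2 by (auto simp: c_def)
  have "c powr (p - 1) \<le> ((e / C\<^sup>2) powr (1 / (p - 1))) powr (p - 1)"
    using c p by (intro powr_mono2) (auto simp: c_def)
  also have "\<dots> = e / C\<^sup>2" using p assms C2 by (simp add: powr_powr)
  finally have cp: "C\<^sup>2 * c powr (p - 1) \<le> e" using C2 by (simp add: field_simps)
  have "g a * b \<le> C / c * \<Phi> a + e * \<Phi> b" if ab: "0 \<le> a" "0 \<le> b" for a b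
  proof -
    have "g a * b = (g a * (c * b)) / c" using c by simp
    also have "\<dots> \<le> (C * (\<Phi> a + \<Phi> (c * b))) / c" using c ab by (intro divide_right_mono g_mult_le) auto
    also have "\<dots> = C / c * \<Phi> a + C / c * \<Phi> (c * b)" by (simp add: distrib_left add_divide_distrib)
    also have "C / c * \<Phi> (c * b) \<le> C / c * (C * c powr p * \<Phi> b)"
      using c ab D_le_C by (intro mult_left_mono Phi_scale) auto
    also have "\<dots> = (C\<^sup>2 * c powr (p - 1)) * \<Phi> b" using c by (simp add: powr_diff power2_eq_square)
    also have "\<dots> \<le> e * \<Phi> b" using cp Phi_nonneg ab by (intro mult_right_mono) auto
    finally show ?thesis by simp
  qed
  moreover have "C / c \<ge> 0" using c D_le_C by simp
  ultimately show ?thesis using that by blast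
qed

lemma superlinear:
  assumes "e > 0" obtains B where "B \<ge> 0" "\<And>y. 0 \<le> y \<Longrightarrow> y \<le> B + e * \<Phi> y"
proof -
  have g1: "g 1 > 0" by (rule g_pos) simp
  obtain B where B: "B \<ge> 0" "\<And>a b. 0 \<le> a \<Longrightarrow> 0 \<le> b \<Longrightarrow> g a * b \<le> B * \<Phi> a + (e * g 1) * \<Phi> b"
    using young_eps[of "e * g 1"] assms g1 by auto
  have "y \<le> B * \<Phi> 1 / g 1 + e * \<Phi> y" if "0 \<le> y" for y
    using B(2)[of 1 y] that g1 by (simp add: field_simps)
  moreover have "B * \<Phi> 1 / g 1 \<ge> 0" using B(1) g1 Phi_nonneg[of 1] by simp
  ultimately show ?thesis using that by blast
qed

lemma finite_energy_integrable: 
  assumes "finite_energy v" shows "integrable unit_interval v"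
proof -
  obtain B where B: "B \<ge> 0" "\<And>y. 0 \<le> y \<Longrightarrow> y \<le> B + 1 * \<Phi> y" using superlinear[of 1] by auto
  interpret U: finite_measure unit_interval by (rule finite_measure_unit)
  show ?thesis
  proof (rule Bochner_Integration.integrable_bound)
    show "integrable unit_interval (\<lambda>t. B + \<Phi> \<bar>v t\<bar>)" using assms by auto
    show "AE t in unit_interval. norm (v t) \<le> norm (B + \<Phi> \<bar>v t\<bar>)"
    proof (rule AE_I2)
      fix t show "norm (v t) \<le> norm (B + \<Phi> \<bar>v t\<bar>)" using B(2)[of "\<bar>v t\<bar>"] by simp
    qed
  qed (use assms in auto)
qed

text \<open>
  \<open>\<Phi>\<close> is superlinear, so a bound on the energies makes a sequence and its positive and negative parts uniformly
  integrable.
\<close>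

lemma uniformly_integrable_parts:
  assumes f: "\<And>n. finite_energy (f n)" and K: "\<And>n. energy (f n) \<le> K"
    and F: "\<And>n. F n \<in> borel_measurable unit_interval" "\<And>n t. 0 \<le> F n t" "\<And>n t. F n t \<le> \<bar>f n t\<bar>"
  shows "\<exists>K'. uniformly_integrable F K'"
proof -
  interpret U: finite_measure unit_interval by (rule finite_measure_unit)
  note [measurable] = F(1)
  have K0: "K \<ge> 0" using energy_nonneg[of "f 0"] K[of 0] by linarith
  have Fint: "integrable unit_interval (F n)" for n
    by (rule Bochner_Integration.integrable_bound[OF integrable_abs[OF finite_energy_integrable[OF f[of n]]]])
      (use F in \<open>auto intro!: AE_I2\<close>)
  have split: "set_int A (F n) \<le> B * measure unit_interval A + e * K"
    if A: "A \<in> sets unit_interval" and B: "\<And>y. 0 \<le> y \<Longrightarrow> y \<le> B + e * \<Phi> y" and e: "e \<ge> 0" for A B e n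
  proof -
    have i1: "integrable unit_interval (\<lambda>t. B * indicator A t)" using A by (intro integrable_mult_right) (auto simp: less_top[symmetric])
    have i2: "integrable unit_interval (\<lambda>t. e * \<Phi> \<bar>f n t\<bar>)" using finite_energyD(2)[OF f[of n]] by simp
    have "set_int A (F n) \<le> (LINT t|unit_interval. B * indicator A t + e * \<Phi> \<bar>f n t\<bar>)"
    proof (intro integral_mono set_int_integrable Fint A Bochner_Integration.integrable_add i1 i2)
      fix t
      have "F n t \<le> B + e * \<Phi> \<bar>f n t\<bar>" using F(3)[of n t] B[of "\<bar>f n t\<bar>"] by simp
      moreover have "0 \<le> e * \<Phi> \<bar>f n t\<bar>" using e Phi_nonneg by simp
      ultimately show "indicator A t * F n t \<le> B * indicator A t + e * \<Phi> \<bar>f n t\<bar>" by (auto simp: indicator_def)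
    qed
    also have "\<dots> = B * (LINT t|unit_interval. indicator A t) + e * energy (f n)" using i1 i2 unfolding energy_def by simp
    also have "(LINT t|unit_interval. indicator A t) = measure unit_interval A"
      using sets.sets_into_space[OF A] by (simp add: Int_absorb2)
    also have "B * measure unit_interval A + e * energy (f n) \<le> B * measure unit_interval A + e * K"
      using K e by (intro add_left_mono mult_left_mono)
    finally show ?thesis .
  qed
  obtain B1 where B1: "B1 \<ge> 0" "\<And>y. 0 \<le> y \<Longrightarrow> y \<le> B1 + 1 * \<Phi> y" using superlinear[of 1] by auto
  have "uniformly_integrable F (B1 * 1 + 1 * K)"
  proof
    fix n
    have "(LINT t|unit_interval. F n t) = set_int (space unit_interval) (F n)"
      by (intro Bochner_Integration.integral_cong) auto
    also have "\<dots> \<le> B1 * measure unit_interval (space unit_interval) + 1 * K"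
      by (rule split[OF sets.top B1(2) zero_le_one])
    finally show "(LINT t|unit_interval. F n t) \<le> B1 * 1 + 1 * K" unfolding measure_unit .
  next
    fix e :: real assume e: "e > 0"
    obtain B where B: "B \<ge> 0" "\<And>y. 0 \<le> y \<Longrightarrow> y \<le> B + e / (2 * (K + 1)) * \<Phi> y"
      using superlinear[of "e / (2 * (K + 1))"] e K0 by auto
    have "set_int A (F n) \<le> e" if A: "A \<in> sets unit_interval" and m: "measure unit_interval A < e / (2 * (B + 1))" for A n
    proof -
      have "set_int A (F n) \<le> B * measure unit_interval A + e / (2 * (K + 1)) * K"
        using e K0 by (intro split[OF A B(2)]) auto
      also have "B * measure unit_interval A \<le> B * (e / (2 * (B + 1)))" using m B(1) by (intro mult_left_mono) auto
      also have "\<dots> \<le> e / 2" using B(1) e by (simp add: field_simps)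
      also have "e / (2 * (K + 1)) * K \<le> e / 2" using K0 e by (simp add: field_simps)
      finally show ?thesis by simp
    qed
    moreover have "e / (2 * (B + 1)) > 0" using e B(1) by simp
    ultimately show "\<exists>d>0. \<forall>A\<in>sets unit_interval. measure unit_interval A < d \<longrightarrow> (\<forall>n. set_int A (F n) \<le> e)" by blast
  qed (use Fint F(2) in auto)
  then show ?thesis by blast
qed

lemma weak_limit_sets:
  assumes f: "\<And>n. finite_energy (f n)" and K: "\<And>n. energy (f n) \<le> K"
  obtains r l where "strict_mono (r::nat\<Rightarrow>nat)" "integrable unit_interval l"
    "\<And>A. A\<in>sets unit_interval \<Longrightarrow> (\<lambda>n. set_int A (f (r n))) \<longlonglongrightarrow> set_int A l"
proof -
  note [measurable] = finite_energyD(1)[OF f]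
  define Fp where "Fp n t = max 0 (f n t)" for n t
  define Fn where "Fn n t = max 0 (- f n t)" for n t
  have [measurable]: "Fp n \<in> borel_measurable unit_interval" "Fn n \<in> borel_measurable unit_interval" for n
    unfolding Fp_def Fn_def by measurable
  have "\<exists>K1. uniformly_integrable Fp K1" "\<exists>K2. uniformly_integrable Fn K2"
    by (rule uniformly_integrable_parts[of f K], simp_all add: f K Fp_def Fn_def)+
  then obtain K1 K2 where K1: "uniformly_integrable Fp K1" and K2: "uniformly_integrable Fn K2" by blast
  obtain r1 lp where r1: "strict_mono r1" "integrable unit_interval lp"
     "\<And>A. A\<in>sets unit_interval \<Longrightarrow> (\<lambda>n. set_int A (Fp (r1 n))) \<longlonglongrightarrow> set_int A lp"
    using uniformly_integrable_weak_limit[OF K1] by blast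
  obtain r2 ln where r2: "strict_mono r2" "integrable unit_interval ln"
     "\<And>A. A\<in>sets unit_interval \<Longrightarrow> (\<lambda>n. set_int A ((Fn \<circ> r1) (r2 n))) \<longlonglongrightarrow> set_int A ln"
    using uniformly_integrable_weak_limit[OF uniformly_integrable.subsequence[OF K2]] by blast
  show ?thesis
  proof (rule that)
    show "strict_mono (r1 \<circ> r2)" using r1 r2 by (intro strict_mono_o)
    show "integrable unit_interval (\<lambda>t. lp t - ln t)" using r1 r2 by simp
    fix A assume A: "A \<in> sets unit_interval"
    have "(\<lambda>n. set_int A (Fp (r1 (r2 n)))) \<longlonglongrightarrow> set_int A lp"
      using LIMSEQ_subseq_LIMSEQ[OF r1(3)[OF A] r2(1)] by (simp add: o_def)
    then have "(\<lambda>n. set_int A (Fp (r1 (r2 n))) - set_int A (Fn (r1 (r2 n)))) \<longlonglongrightarrow> set_int A lp - set_int A ln"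
      using r2(3)[OF A] by (intro tendsto_diff) (simp_all add: o_def)
    moreover have "set_int A (Fp (r1 (r2 n))) - set_int A (Fn (r1 (r2 n))) = set_int A (f ((r1 \<circ> r2) n))" for n
    proof -
      have "set_int A (Fp m) - set_int A (Fn m) = set_int A (f m)" for m
      proof -
        have "set_int A (f m) = (LINT t|unit_interval. indicator A t * Fp m t - indicator A t * Fn m t)"
          by (intro Bochner_Integration.integral_cong) (auto simp: Fp_def Fn_def indicator_def)
        then show ?thesis
          using set_int_integrable[OF uniformly_integrable.int[OF K1] A] set_int_integrable[OF uniformly_integrable.int[OF K2] A] by simp
      qed
      then show ?thesis by simp
    qed
    moreover have "set_int A lp - set_int A ln = set_int A (\<lambda>t. lp t - ln t)"
      using set_int_integrable[OF r1(2) A] set_int_integrable[OF r2(2) A] by (simp add: right_diff_distrib)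
    ultimately show "(\<lambda>n. set_int A (f ((r1 \<circ> r2) n))) \<longlonglongrightarrow> set_int A (\<lambda>t. lp t - ln t)" by simp
  qed
qed

text \<open>
  Bounded energy implies uniform integrability, which gives a limit \<open>l\<close> against bounded test functions. Testing
  against a truncation of \<open>G(l)\<close> and using the subgradient inequality shows that \<open>l\<close> has finite energy. A test function
  \<open>G(v)\<close> is truncated as well, and \<open>young_eps\<close> makes the discarded part small uniformly in \<open>n\<close>.
\<close>

lemma weak_compactness:
  assumes f: "\<And>n. finite_energy (f n)" and K: "\<And>n. energy (f n) \<le> K"
  shows "\<exists>r l. strict_mono (r::nat\<Rightarrow>nat) \<and> finite_energy l \<and>
    (\<forall>v. finite_energy v \<longrightarrow> (\<lambda>n. LINT t|unit_interval. G (v t) * (f (r n) t - l t)) \<longlonglongrightarrow> 0)"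
proof -
  obtain r l where r: "strict_mono r" and l: "integrable unit_interval l"
    and lim: "\<And>A. A\<in>sets unit_interval \<Longrightarrow> (\<lambda>n. set_int A (f (r n))) \<longlonglongrightarrow> set_int A l"
    by (rule weak_limit_sets[of f K, OF f K]) (rule that)
  note [measurable] = finite_energyD(1)[OF f] borel_measurable_integrable[OF l]
  have fi: "integrable unit_interval (f n)" for n by (rule finite_energy_integrable[OF f])
  obtain B1 where B1: "B1 \<ge> 0" "\<And>y. 0 \<le> y \<Longrightarrow> y \<le> B1 + 1 * \<Phi> y" using superlinear[of 1] by auto
  interpret U: finite_measure unit_interval by (rule finite_measure_unit)
  have fb: "(LINT t|unit_interval. \<bar>f n t\<bar>) \<le> B1 + K" for n
  proof -
    have "(LINT t|unit_interval. \<bar>f n t\<bar>) \<le> (LINT t|unit_interval. B1 + \<Phi> \<bar>f n t\<bar>)"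
    proof (intro integral_mono integrable_abs fi)
      show "integrable unit_interval (\<lambda>t. B1 + \<Phi> \<bar>f n t\<bar>)" using finite_energyD(2)[OF f] by simp
      show "\<bar>f n t\<bar> \<le> B1 + \<Phi> \<bar>f n t\<bar>" for t using B1(2)[of "\<bar>f n t\<bar>"] by simp
    qed
    also have "\<dots> = B1 * measure unit_interval (space unit_interval) + energy (f n)"
      unfolding energy_def using finite_energyD(2)[OF f] by simp
    finally show ?thesis using K[of n] unfolding measure_unit by simp
  qed
  have weak: "(\<lambda>n. LINT t|unit_interval. h t * f (r n) t) \<longlonglongrightarrow> (LINT t|unit_interval. h t * l t)"
    if "h \<in> borel_measurable unit_interval" "\<And>t. \<bar>h t\<bar> \<le> B" for h B
    by (rule weak_limit_bounded[OF fi l fb lim that])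
  note bint = bounded_mult_integrable
  define cut where "cut v T t = (if \<bar>v t\<bar> \<le> real T then G (v t) else 0)" for v :: "real \<Rightarrow> real" and T :: nat and t
  have cut_m: "cut v T \<in> borel_measurable unit_interval" if [measurable]: "v \<in> borel_measurable unit_interval" for v T
    unfolding cut_def by measurable
  have cut_b: "\<bar>cut v T t\<bar> \<le> g (real T)" for v T t
    unfolding cut_def using g_mono[of "\<bar>v t\<bar>" "real T"] g_nonneg[of "real T"] by (auto simp: abs_G)
  have l_part: "(LINT t|unit_interval. (if \<bar>l t\<bar> \<le> real T then \<Phi> \<bar>l t\<bar> else 0)) \<le> K" 
      "integrable unit_interval (\<lambda>t. if \<bar>l t\<bar> \<le> real T then \<Phi> \<bar>l t\<bar> else 0)" for T
  proof -
    let ?h = "cut l T" and ?L = "\<lambda>t. if \<bar>l t\<bar> \<le> real T then \<Phi> \<bar>l t\<bar> else 0"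
    have [measurable]: "?h \<in> borel_measurable unit_interval" by (rule cut_m) measurable
    have Lm [measurable]: "?L \<in> borel_measurable unit_interval" by measurable
    show Li: "integrable unit_interval ?L"
      by (rule U.integrable_const_bound[of _ "\<Phi> (real T)"]) (auto intro!: AE_I2 Phi_mono simp: Phi_nonneg abs_of_nonneg)
    have le: "(LINT t|unit_interval. ?L t) + ((LINT t|unit_interval. ?h t * f (r n) t) - (LINT t|unit_interval. ?h t * l t)) \<le> K" for n
    proof -
      have i: "integrable unit_interval (\<lambda>t. ?h t * f (r n) t)" "integrable unit_interval (\<lambda>t. ?h t * l t)"
        using bint[OF _ cut_b fi] bint[OF _ cut_b l] by auto
      have "(LINT t|unit_interval. ?L t) + ((LINT t|unit_interval. ?h t * f (r n) t) - (LINT t|unit_interval. ?h t * l t))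
        = (LINT t|unit_interval. ?L t + (?h t * f (r n) t - ?h t * l t))" using i Li by simp
      also have "\<dots> \<le> energy (f (r n))" unfolding energy_def
      proof (intro integral_mono Bochner_Integration.integrable_add Bochner_Integration.integrable_diff i Li finite_energyD f)
        fix t
        show "?L t + (?h t * f (r n) t - ?h t * l t) \<le> \<Phi> \<bar>f (r n) t\<bar>"
          using Phi_subgradient[of "l t" "f (r n) t"] Phi_nonneg[of "\<bar>f (r n) t\<bar>"] by (simp add: cut_def right_diff_distrib)
      qed
      finally show ?thesis using K[of "r n"] by linarith
    qed
    have "(\<lambda>n. (LINT t|unit_interval. ?L t) + ((LINT t|unit_interval. ?h t * f (r n) t) - (LINT t|unit_interval. ?h t * l t)))
       \<longlonglongrightarrow> (LINT t|unit_interval. ?L t) + ((LINT t|unit_interval. ?h t * l t) - (LINT t|unit_interval. ?h t * l t))"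
      by (intro tendsto_intros weak[of _ "g (real T)"] cut_b) measurable
    from LIMSEQ_le_const2[OF this] le show "(LINT t|unit_interval. ?L t) \<le> K" by auto
  qed
  have finl: "finite_energy l" and Pl: "energy l \<le> K"
  proof -
    let ?L = "\<lambda>T t. if \<bar>l t\<bar> \<le> real T then \<Phi> \<bar>l t\<bar> else 0"
    have K0: "K \<ge> 0" using energy_nonneg[of "f 0"] K[of 0] by linarith
    have sup: "(SUP T. ennreal (?L T t)) = ennreal (\<Phi> \<bar>l t\<bar>)" for t
    proof (rule antisym)
      show "(SUP T. ennreal (?L T t)) \<le> ennreal (\<Phi> \<bar>l t\<bar>)"
        by (intro SUP_least ennreal_leI) (simp add: Phi_nonneg)
      obtain T :: nat where "\<bar>l t\<bar> \<le> real T" using real_arch_simple by blast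
      then show "ennreal (\<Phi> \<bar>l t\<bar>) \<le> (SUP T. ennreal (?L T t))" by (intro SUP_upper2[of T]) auto
    qed
    have "(\<integral>\<^sup>+t. ennreal (\<Phi> \<bar>l t\<bar>) \<partial>unit_interval) = (SUP T. \<integral>\<^sup>+t. ennreal (?L T t) \<partial>unit_interval)"
      unfolding sup[symmetric]
    proof (rule nn_integral_monotone_convergence_SUP)
      show "incseq (\<lambda>T t. ennreal (?L T t))"
        by (intro incseq_SucI le_funI ennreal_leI) (auto simp: Phi_nonneg)
    qed measurable
    also have "\<dots> \<le> ennreal K"
    proof (rule SUP_least)
      fix T
      have "(\<integral>\<^sup>+t. ennreal (?L T t) \<partial>unit_interval) = ennreal (LINT t|unit_interval. ?L T t)"
        by (intro nn_integral_eq_integral l_part AE_I2) (simp add: Phi_nonneg)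
      then show "(\<integral>\<^sup>+t. ennreal (?L T t) \<partial>unit_interval) \<le> ennreal K" using l_part(1)[of T] by (simp add: ennreal_leI)
    qed
    finally have nn: "(\<integral>\<^sup>+t. ennreal (\<Phi> \<bar>l t\<bar>) \<partial>unit_interval) \<le> ennreal K" .
    have i: "integrable unit_interval (\<lambda>t. \<Phi> \<bar>l t\<bar>)"
      by (rule integrableI_nonneg) (use nn in \<open>auto simp: Phi_nonneg intro: le_less_trans\<close>)
    then show "finite_energy l" by (simp add: finite_energy_def)
    have "ennreal (energy l) \<le> ennreal K"
      using nn nn_integral_eq_integral[OF i] by (simp add: energy_def Phi_nonneg)
    then show "energy l \<le> K" using K0 by simp
  qed
  have "(\<lambda>n. LINT t|unit_interval. G (v t) * (f (r n) t - l t)) \<longlonglongrightarrow> 0" if v: "finite_energy v" for v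
  proof (rule LIMSEQ_I)
    fix e :: real assume e: "e > 0"
    have K0: "K \<ge> 0" using energy_nonneg[of "f 0"] K[of 0] by linarith
    note [measurable] = finite_energyD(1)[OF v]
    obtain B where B: "B \<ge> 0" "\<And>a b. 0 \<le> a \<Longrightarrow> 0 \<le> b \<Longrightarrow> g a * b \<le> B * \<Phi> a + e / (8 * (K + 1)) * \<Phi> b"
      using young_eps[of "e / (8 * (K + 1))"] e K0 by auto
    let ?R = "\<lambda>T t. if \<bar>v t\<bar> \<le> real T then 0 else \<Phi> \<bar>v t\<bar>"
    have Ri: "integrable unit_interval (?R T)" for T
      by (rule Bochner_Integration.integrable_bound[OF finite_energyD(2)[OF v]]) (auto intro!: AE_I2 simp: Phi_nonneg)
    have "(\<lambda>T. LINT t|unit_interval. ?R T t) \<longlonglongrightarrow> (LINT t|unit_interval. 0)"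
    proof (rule integral_dominated_convergence[where w="\<lambda>t. \<Phi> \<bar>v t\<bar>"])
      show "AE t in unit_interval. (\<lambda>T. ?R T t) \<longlonglongrightarrow> 0"
      proof (rule AE_I2)
        fix t
        obtain T0 :: nat where "\<bar>v t\<bar> \<le> real T0" using real_arch_simple by blast
        then have "\<forall>\<^sub>F T in sequentially. ?R T t = 0" by (intro eventually_sequentiallyI[of T0]) simp
        then show "(\<lambda>T. ?R T t) \<longlonglongrightarrow> 0" by (rule tendsto_eventually)
      qed
    qed (use finite_energyD(2)[OF v] in \<open>auto intro!: AE_I2 simp: Phi_nonneg\<close>)
    then have "\<forall>\<^sub>F T in sequentially. (LINT t|unit_interval. ?R T t) < e / (8 * (B + 1))"
      using e B(1) by (intro order_tendstoD(2)) auto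
    then obtain T where T: "(LINT t|unit_interval. ?R T t) < e / (8 * (B + 1))" by (auto simp: eventually_sequentially)
    have rest: "\<bar>(LINT t|unit_interval. G (v t) * w t) - (LINT t|unit_interval. cut v T t * w t)\<bar> \<le> e / 4"
      if w: "finite_energy w" "energy w \<le> K" for w
    proof -
      note [measurable] = finite_energyD(1)[OF w(1)] 
      have i: "integrable unit_interval (\<lambda>t. G (v t) * w t)" "integrable unit_interval (\<lambda>t. cut v T t * w t)"
        using G_integrable[OF v w(1)] bint[OF cut_m cut_b finite_energy_integrable[OF w(1)]] by auto
      have "\<bar>(LINT t|unit_interval. G (v t) * w t) - (LINT t|unit_interval. cut v T t * w t)\<bar>
        = \<bar>LINT t|unit_interval. G (v t) * w t - cut v T t * w t\<bar>" using i by simp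
      also have "\<dots> \<le> (LINT t|unit_interval. \<bar>G (v t) * w t - cut v T t * w t\<bar>)" by (rule integral_abs_bound)
      also have "\<dots> \<le> (LINT t|unit_interval. B * ?R T t + e / (8 * (K + 1)) * \<Phi> \<bar>w t\<bar>)"
      proof (intro integral_mono integrable_abs Bochner_Integration.integrable_diff i Bochner_Integration.integrable_add integrable_mult_right Ri finite_energyD w)
        fix t
        show "\<bar>G (v t) * w t - cut v T t * w t\<bar> \<le> B * ?R T t + e / (8 * (K + 1)) * \<Phi> \<bar>w t\<bar>"
          using B(2)[of "\<bar>v t\<bar>" "\<bar>w t\<bar>"] e K0 Phi_nonneg[of "\<bar>w t\<bar>"] by (simp add: cut_def abs_mult abs_G)
      qed
      also have "\<dots> = B * (LINT t|unit_interval. ?R T t) + e / (8 * (K + 1)) * energy w"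
        unfolding energy_def using Ri finite_energyD(2)[OF w(1)] by (subst Bochner_Integration.integral_add) simp_all
      also have "\<dots> \<le> B * (e / (8 * (B + 1))) + e / (8 * (K + 1)) * K"
        using T B(1) w(2) e K0 by (intro add_mono mult_left_mono) auto
      also have "\<dots> \<le> e / 8 + e / 8" using B(1) e K0 by (intro add_mono) (simp_all add: field_simps)
      finally show ?thesis by simp
    qed
    have "(\<lambda>n. LINT t|unit_interval. cut v T t * f (r n) t) \<longlonglongrightarrow> (LINT t|unit_interval. cut v T t * l t)"
      by (rule weak[OF cut_m cut_b]) measurable
    then obtain N where N: "\<And>n. n \<ge> N \<Longrightarrow> \<bar>(LINT t|unit_interval. cut v T t * f (r n) t) - (LINT t|unit_interval. cut v T t * l t)\<bar> < e / 4"
      using LIMSEQ_D[of "\<lambda>n. LINT t|unit_interval. cut v T t * f (r n) t" _ "e / 4"] e unfolding real_norm_def by auto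
    have "norm ((LINT t|unit_interval. G (v t) * (f (r n) t - l t)) - 0) < e" if n: "n \<ge> N" for n
    proof -
      have "(LINT t|unit_interval. G (v t) * (f (r n) t - l t)) = (LINT t|unit_interval. G (v t) * f (r n) t) - (LINT t|unit_interval. G (v t) * l t)"
        using G_integrable[OF v f] G_integrable[OF v finl] by (simp add: right_diff_distrib)
      then show ?thesis using N[OF n] rest[OF f K, of "r n"] rest[OF finl Pl] e unfolding real_norm_def by linarith
    qed
    then show "\<exists>no. \<forall>n\<ge>no. norm ((LINT t|unit_interval. G (v t) * (f (r n) t - l t)) - 0) < e" by blast
  qed
  then show ?thesis using r finl by blast
qed

end

section \<open>Dominated Cesaro means\<close>

lemma gronwall:
  fixes u \<eta> :: "nat \<Rightarrow> real"
  assumes u: "\<And>n. 0 \<le> u n" "\<And>n. u (Suc n) \<le> u n * (1 + c * \<eta> n)" and c: "0 \<le> c" "\<And>n. 0 \<le> \<eta> n" and s: "summable \<eta>"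
  shows "u n \<le> u 0 * exp (c * suminf \<eta>)"
proof -
  have "u n \<le> u 0 * exp (c * (\<Sum>i<n. \<eta> i))"
  proof (induction n)
    case (Suc n)
    have "u (Suc n) \<le> u n * (1 + c * \<eta> n)" by (rule u)
    also have "\<dots> \<le> u n * exp (c * \<eta> n)" by (intro mult_left_mono exp_ge_add_one_self u)
    also have "\<dots> \<le> (u 0 * exp (c * (\<Sum>i<n. \<eta> i))) * exp (c * \<eta> n)" by (intro mult_right_mono Suc) simp
    also have "\<dots> = u 0 * exp (c * (\<Sum>i<Suc n. \<eta> i))" by (simp add: distrib_left exp_add)
    finally show ?case .
  qed simp
  also have "\<dots> \<le> u 0 * exp (c * suminf \<eta>)"
    using sum_le_suminf[OF s, of "{..<n}"] c u(1)[of 0] by (intro mult_left_mono) (auto intro: mult_left_mono)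
  finally show ?thesis .
qed

lemma power_gap:
  fixes x :: real
  assumes "0 \<le> x" "x \<le> 1" shows "(1 + x) ^ a \<le> 1 + (2 ^ a - 1) * x"
proof (induction a)
  case (Suc a)
  have "(1 + x) ^ Suc a \<le> (1 + (2 ^ a - 1) * x) * (1 + x)" using Suc assms by (simp add: mult.commute mult_left_mono)
  also have "\<dots> = 1 + 2 ^ a * x + (2 ^ a - 1) * (x * x)" by (simp add: algebra_simps)
  also have "\<dots> \<le> 1 + 2 ^ a * x + (2 ^ a - 1) * x"
    using assms by (intro add_left_mono mult_left_mono) (auto simp: mult_left_le_one_le)
  also have "\<dots> = 1 + (2 ^ Suc a - 1) * x" by (simp add: algebra_simps)
  finally show ?case .
qed simp

text \<open>
  Consecutive grid points \<open>n = j\<^sup>a\<close> differ by a fraction of order \<open>1 / j\<close>.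
\<close>

lemma grid_gap:
  "real ((j + 2) ^ a) - real ((j + 1) ^ a) \<le> 2 ^ a / real (j + 1) * real ((j + 1) ^ a)"
proof -
  define x where "x = 1 / real (j + 1)"
  have x: "0 \<le> x" "x \<le> 1" by (auto simp: x_def)
  have "real (j + 2) = (1 + x) * real (j + 1)" by (simp add: x_def field_simps)
  then have "real ((j + 2) ^ a) = (1 + x) ^ a * real ((j + 1) ^ a)" by (simp add: power_mult_distrib)
  also have "\<dots> \<le> (1 + 2 ^ a * x) * real ((j + 1) ^ a)"
    using power_gap[OF x, of a] x by (intro mult_right_mono) (auto simp: algebra_simps)
  finally show ?thesis by (simp add: x_def algebra_simps)
qed

lemma grid_index:
  fixes n a :: nat
  assumes "1 \<le> n" "1 \<le> a" obtains j where "(j + 1) ^ a \<le> n" "n < (j + 2) ^ a"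
proof -
  define j where "j = (LEAST j. n < (j + 2) ^ a)"
  have "n < (n + 2) ^ a" using assms(2) self_le_power[of "n + 2" a] by simp
  then have 1: "n < (j + 2) ^ a" unfolding j_def by (rule LeastI)
  have 2: "(j + 1) ^ a \<le> n"
  proof (cases j)
    case (Suc i)
    have "\<not> n < (i + 2) ^ a" by (rule not_less_Least) (use Suc j_def in simp)
    then show ?thesis using Suc by simp
  qed (use assms in simp)
  show ?thesis using that 1 2 by blast
qed

context gauge
begin

lemma energy_expand:
  assumes v: "finite_energy v" and u: "finite_energy u" and c: "0 \<le> c" "c \<le> 1"
  shows "energy (\<lambda>t. v t + c * u t) \<le> energy v + c * (LINT t|unit_interval. G (v t) * u t) + C * c powr p * (energy v + energy u)"
proof -
  note i = finite_energyD(2)[OF v] finite_energyD(2)[OF u] G_integrable[OF v u]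
  have "energy (\<lambda>t. v t + c * u t) \<le> (LINT t|unit_interval. \<Phi> \<bar>v t\<bar> + c * (G (v t) * u t) + C * c powr p * (\<Phi> \<bar>v t\<bar> + \<Phi> \<bar>u t\<bar>))"
    by (rule finite_energy_dominated(2)) (use i Phi_expand[OF c] finite_energyD(1)[OF v] finite_energyD(1)[OF u] in auto)
  also have "\<dots> = energy v + c * (LINT t|unit_interval. G (v t) * u t) + C * c powr p * (energy v + energy u)"
    unfolding energy_def using i by simp
  finally show ?thesis .
qed

lemma energy_scale:
  assumes v: "finite_energy v" and c: "0 \<le> c" "c \<le> 1" shows "energy (\<lambda>t. c * v t) \<le> C * c powr p * energy v"
proof -
  have "energy (\<lambda>t. c * v t) \<le> (LINT t|unit_interval. C * c powr p * \<Phi> \<bar>v t\<bar>)"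
  proof (rule finite_energy_dominated(2))
    show "\<Phi> \<bar>c * v t\<bar> \<le> C * c powr p * \<Phi> \<bar>v t\<bar>" for t
      using Phi_scale[of c "\<bar>v t\<bar>"] c by (simp add: abs_mult)
    show "(\<lambda>t. c * v t) \<in> borel_measurable unit_interval" using finite_energyD(1)[OF v] by measurable
    show "integrable unit_interval (\<lambda>t. C * c powr p * \<Phi> \<bar>v t\<bar>)" using finite_energyD(2)[OF v] by simp
  qed
  then show ?thesis unfolding energy_def by simp
qed

lemma energy_mono_scale:
  assumes v: "finite_energy v" and c: "0 \<le> c" "c \<le> 1" shows "energy (\<lambda>t. c * v t) \<le> energy v"
  unfolding energy_def
proof (intro integral_mono finite_energyD v)
  show "finite_energy (\<lambda>t. c * v t)" using finite_energy_scale[OF v, of c] c by simp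
  show "\<Phi> \<bar>c * v t\<bar> \<le> \<Phi> \<bar>v t\<bar>" for t using c by (intro Phi_mono) (auto simp: abs_mult mult_left_le_one_le)
qed

text \<open>
  Scaling by the decreasing factors \<open>lam n = (n + 1)\<^sup>-\<^sup>\<theta>\<close> and choosing the next term almost orthogonal to \<open>G\<close> of the
  current scaled sum, the energy plus a constant grows in each step at most by a factor \<open>1 + O((n + 1)\<^sup>-\<^sup>\<theta>\<^sup>p)\<close>; the product of these factors converges.
\<close>

lemma selection:
  assumes d: "\<And>n. finite_energy (d n)" and K: "\<And>n. energy (d n) \<le> K"
    and weak: "\<And>v. finite_energy v \<Longrightarrow> (\<lambda>n. LINT t|unit_interval. G (v t) * d n t) \<longlonglongrightarrow> 0"
    and \<theta>: "0 < \<theta>" "1 < \<theta> * p"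
  obtains r B where "strict_mono (r::nat\<Rightarrow>nat)" "0 \<le> B"
    "\<And>n. finite_energy (\<lambda>t. real (Suc n) powr - \<theta> * (\<Sum>i<n. d (r i) t))"
    "\<And>n. energy (\<lambda>t. real (Suc n) powr - \<theta> * (\<Sum>i<n. d (r i) t)) \<le> B"
proof -
  define lam where "lam n = real (Suc n) powr - \<theta>" for n
  have lam: "0 < lam n" "lam n \<le> 1" for n
  proof -
    show "0 < lam n" by (simp add: lam_def)
    have "real (Suc n) powr - \<theta> \<le> real (Suc n) powr 0" using \<theta> by (intro powr_mono) auto
    then show "lam n \<le> 1" by (simp add: lam_def)
  qed
  have lam_dec: "lam (Suc n) \<le> lam n" for n
    unfolding lam_def using \<theta> by (intro powr_mono2') auto
  define eta where "eta n = lam n powr p" for n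
  have eta: "0 < eta n" for n using lam[of n] by (simp add: eta_def)
  have "summable (\<lambda>n. real n powr - (\<theta> * p))" using \<theta> by (simp add: summable_real_powr_iff)
  then have "summable (\<lambda>n. real (Suc n) powr - (\<theta> * p))" by (rule summable_Suc_iff[THEN iffD2])
  moreover have "eta = (\<lambda>n. real (Suc n) powr - (\<theta> * p))"
    by (rule ext) (simp add: eta_def lam_def powr_powr del: of_nat_Suc)
  ultimately have eta_sum: "summable eta" by simp
  \<comment> \<open>A state consists of the sum of the terms chosen so far and the index of the next term.\<close>
  define Q where "Q n x \<longleftrightarrow> finite_energy (fst x) \<and> (LINT t|unit_interval. G (lam n * fst x t) * d (snd x) t) \<le> eta n \<and> (n = 0 \<longrightarrow> fst x = (\<lambda>t. 0))"
    for n and x :: "(real \<Rightarrow> real) \<times> nat"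
  define R where "R x y \<longleftrightarrow> snd x < snd y \<and> fst y = (\<lambda>t. fst x t + d (snd x) t)" for x y :: "(real \<Rightarrow> real) \<times> nat"
  have choose: "\<exists>k>m. (LINT t|unit_interval. G (lam n * S t) * d k t) \<le> eta n" if S: "finite_energy S" for S m n
  proof -
    have "finite_energy (\<lambda>t. lam n * S t)" using lam[of n] by (intro finite_energy_scale S) auto
    from order_tendstoD(2)[OF weak[OF this] eta[of n]]
    obtain N where N: "\<And>k. k \<ge> N \<Longrightarrow> (LINT t|unit_interval. G (lam n * S t) * d k t) < eta n"
      by (auto simp: eventually_sequentially)
    show ?thesis using N[of "max N (Suc m)"] by (intro exI[of _ "max N (Suc m)"]) auto
  qed
  have "\<exists>f. \<forall>n. Q n (f n) \<and> R (f n) (f (Suc n))"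
  proof (rule dependent_nat_choice)
    obtain k where "(LINT t|unit_interval. G (lam 0 * 0) * d k t) \<le> eta 0" using choose[OF finite_energy_0, of 0 0] by blast
    then show "\<exists>x. Q 0 x" by (intro exI[of _ "(\<lambda>t. 0, k)"]) (simp add: Q_def finite_energy_0)
  next
    fix x n assume x: "Q n x"
    have f: "finite_energy (\<lambda>t. fst x t + d (snd x) t)" using x d by (intro finite_energy_add) (auto simp: Q_def)
    obtain k where "k > snd x" "(LINT t|unit_interval. G (lam (Suc n) * (fst x t + d (snd x) t)) * d k t) \<le> eta (Suc n)"
      using choose[OF f] by blast
    then show "\<exists>y. Q (Suc n) y \<and> R x y"
      by (intro exI[of _ "(\<lambda>t. fst x t + d (snd x) t, k)"]) (simp add: Q_def R_def f)
  qed
  then obtain f where f: "\<And>n. Q n (f n)" "\<And>n. R (f n) (f (Suc n))" by blast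
  define r where "r n = snd (f n)" for n
  define S where "S n = fst (f n)" for n
  have r: "strict_mono r" unfolding strict_mono_Suc_iff using f(2) by (simp add: R_def r_def)
  have S_Suc: "S (Suc n) = (\<lambda>t. S n t + d (r n) t)" for n using f(2)[of n] by (simp add: R_def r_def S_def)
  have S0: "S 0 = (\<lambda>t. 0)" using f(1)[of 0] by (simp add: Q_def S_def)
  have S_eq: "S n = (\<lambda>t. \<Sum>i<n. d (r i) t)" for n by (induction n) (simp_all add: S0 S_Suc)
  have S_fin: "finite_energy (S n)" and S_small: "(LINT t|unit_interval. G (lam n * S n t) * d (r n) t) \<le> eta n" for n
    using f(1)[of n] by (simp_all add: Q_def S_def r_def)
  have fins: "finite_energy (\<lambda>t. lam n * S n t)" for n using lam[of n] by (intro finite_energy_scale S_fin) auto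
  define E where "E n = energy (\<lambda>t. lam n * S n t)" for n
  have K0: "K \<ge> 0" using energy_nonneg[of "d 0"] K[of 0] by linarith
  \<comment> \<open>The shift by \<open>K + 1\<close> absorbs the energy of the new term and the error of the almost orthogonality.\<close>
  have step: "E (Suc n) + (K + 1) \<le> (E n + (K + 1)) * (1 + C * eta n)" for n
  proof -
    have f': "finite_energy (\<lambda>t. lam n * S (Suc n) t)" using lam[of n] by (intro finite_energy_scale S_fin) auto
    have "E (Suc n) = energy (\<lambda>t. (lam (Suc n) / lam n) * (lam n * S (Suc n) t))" using lam[of n] by (simp add: E_def)
    also have "\<dots> \<le> energy (\<lambda>t. lam n * S (Suc n) t)"
      using lam[of n] lam[of "Suc n"] lam_dec[of n] by (intro energy_mono_scale f') auto
    also have "\<dots> = energy (\<lambda>t. lam n * S n t + lam n * d (r n) t)" by (simp add: S_Suc distrib_left)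
    also have "\<dots> \<le> E n + lam n * (LINT t|unit_interval. G (lam n * S n t) * d (r n) t) + C * lam n powr p * (E n + energy (d (r n)))"
      unfolding E_def using lam[of n] by (intro energy_expand fins d) auto
    also have "lam n * (LINT t|unit_interval. G (lam n * S n t) * d (r n) t) \<le> 1 * eta n"
      using S_small[of n] lam[of n] eta[of n] mult_left_mono[OF S_small[of n], of "lam n"] mult_right_mono[of "lam n" 1 "eta n"] by linarith
    also have "C * lam n powr p * (E n + energy (d (r n))) \<le> C * eta n * (E n + K)"
      unfolding eta_def using K[of "r n"] D_le_C by (intro mult_left_mono) auto
    also have "1 * eta n \<le> C * eta n" using D_le_C eta[of n] by (intro mult_right_mono) auto
    finally show ?thesis by (simp add: algebra_simps)
  qed
  have "E n + (K + 1) \<le> (E 0 + (K + 1)) * exp (C * suminf eta)" for n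
    by (rule gronwall[of "\<lambda>n. E n + (K + 1)"])
      (use step K0 D_le_C eta eta_sum energy_nonneg in \<open>auto simp: E_def less_imp_le add_nonneg_nonneg\<close>)
  then have "E n \<le> (E 0 + (K + 1)) * exp (C * suminf eta)" for n using K0 by (smt (verit))
  moreover have "0 \<le> (E 0 + (K + 1)) * exp (C * suminf eta)" using K0 energy_nonneg by (simp add: E_def)
  ultimately show ?thesis
    using that[OF r, of "(E 0 + (K + 1)) * exp (C * suminf eta)"] fins unfolding E_def lam_def S_eq by blast
qed

lemma Phi_average:
  assumes I: "finite I" "I \<noteq> {}" and c: "0 \<le> c" "c \<le> 1"
  shows "\<Phi> (c * ((\<Sum>i\<in>I. \<bar>x i\<bar>) / card I)) \<le> C * c powr p * ((\<Sum>i\<in>I. \<Phi> \<bar>x i\<bar>) / card I)"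
proof -
  let ?a = "(\<Sum>i\<in>I. \<bar>x i\<bar>) / card I"
  have a0: "0 \<le> ?a" by (intro divide_nonneg_nonneg sum_nonneg) auto
  have "\<Phi> (c * ?a) \<le> C * c powr p * \<Phi> ?a" by (rule Phi_scale[OF c a0])
  also have "\<Phi> ?a \<le> (\<Sum>i\<in>I. \<Phi> \<bar>x i\<bar>) / card I"
  proof -
    have "(\<lambda>x. \<Phi> \<bar>x\<bar>) (\<Sum>i\<in>I. (1 / card I) *\<^sub>R \<bar>x i\<bar>) \<le> (\<Sum>i\<in>I. (1 / card I) * \<Phi> \<bar>\<bar>x i\<bar>\<bar>)"
      using I by (intro convex_on_sum[OF _ _ Phi_convex]) auto
    moreover have "(\<Sum>i\<in>I. (1 / card I) *\<^sub>R \<bar>x i\<bar>) = ?a" by (simp add: sum_divide_distrib)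
    moreover have "(\<Sum>i\<in>I. (1 / card I) * \<Phi> \<bar>\<bar>x i\<bar>\<bar>) = (\<Sum>i\<in>I. \<Phi> \<bar>x i\<bar>) / card I" by (simp add: sum_divide_distrib)
    ultimately show ?thesis using a0 by simp
  qed
  finally show ?thesis using D_le_C by (simp add: mult_left_mono)
qed

lemma exponents:
  obtains \<theta> and a :: nat where "0 < \<theta>" "\<theta> < 1" "1 < \<theta> * p" "1 \<le> a" "1 < real a * (1 - \<theta>) * p"
proof -
  define \<theta> where "\<theta> = (1 + 1 / p) / 2"
  have "1 / p < 1" using p by simp
  then have \<theta>: "0 < \<theta>" "\<theta> < 1" "1 < \<theta> * p" using p by (auto simp: \<theta>_def field_simps)
  have "(1 - \<theta>) * p > 0" using \<theta> p by simp
  then obtain a :: nat where a: "1 < real a * ((1 - \<theta>) * p)" using ex_less_of_nat_mult by blast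
  then have "a \<noteq> 0" by (intro notI) simp
  then have "1 \<le> a" by simp
  then show ?thesis using that \<theta> a by (simp add: mult.assoc)
qed


text \<open>
  For \<open>N j \<le> m + 2 < N (j + 1)\<close> the \<open>m\<close>-th Cesaro mean is controlled by the mean \<open>U j\<close> at the grid point and the contribution
  \<open>Y j\<close> of the gap. Both have summable energies, so the sum \<open>Z\<close> over all grid points is finite almost everywhere and dominates
  all Cesaro means; the terms of a convergent series tend to zero, which gives the almost everywhere limit.
\<close>

lemma cesaro_dominated:
  assumes d: "\<And>n. finite_energy (d n)" and K: "\<And>n. energy (d n) \<le> K"
    and weak: "\<And>v. finite_energy v \<Longrightarrow> (\<lambda>n. LINT t|unit_interval. G (v t) * d n t) \<longlonglongrightarrow> 0"
  obtains r Z c where "strict_mono (r::nat\<Rightarrow>nat)" "(\<integral>\<^sup>+t. Z t \<partial>unit_interval) < \<infinity>" "Z \<in> borel_measurable unit_interval" "c > 0"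
    "\<And>m t. ennreal (\<Phi> (\<bar>cesaro (d \<circ> r) m t\<bar> / c)) \<le> Z t"
    "AE t in unit_interval. (\<lambda>m. cesaro (d \<circ> r) m t) \<longlonglongrightarrow> 0"
proof -
  obtain \<theta> and a :: nat where \<theta>: "0 < \<theta>" "\<theta> < 1" "1 < \<theta> * p" "1 \<le> a" "1 < real a * (1 - \<theta>) * p"
    using exponents by blast
  obtain r B where r: "strict_mono (r::nat\<Rightarrow>nat)" and B: "0 \<le> B"
    "\<And>n. finite_energy (\<lambda>t. real (Suc n) powr - \<theta> * (\<Sum>i<n. d (r i) t))"
    "\<And>n. energy (\<lambda>t. real (Suc n) powr - \<theta> * (\<Sum>i<n. d (r i) t)) \<le> B"
    using selection[OF d K weak \<theta>(1,3)] by blast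
  have K0: "K \<ge> 0" using energy_nonneg[of "d 0"] K[of 0] by linarith
  define N where "N j = (j + 1) ^ a" for j :: nat
  have N1: "1 \<le> N j" for j by (simp add: N_def)
  have NS: "N (Suc j) = (j + 2) ^ a" for j by (simp add: N_def)
  have N_less: "N j < N (Suc j)" for j unfolding N_def using \<theta>(4) by (intro power_strict_mono) auto
  define I where "I j = {N j - 1..<N (Suc j) - 1}" for j
  have cI: "card (I j) = N (Suc j) - N j" for j using N1[of j] by (simp add: I_def)
  have fI: "finite (I j)" "I j \<noteq> {}" for j using N_less[of j] N1[of j] by (auto simp: I_def)
  define U where "U j t = \<bar>\<Sum>i<N j - 1. d (r i) t\<bar> / real (N j)" for j t
  define Y where "Y j t = (\<Sum>i\<in>I j. \<bar>d (r i) t\<bar>) / (2 ^ a * real (N j))" for j t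
  have U0: "0 \<le> U j t" and Y0: "0 \<le> Y j t" for j t by (auto simp: U_def Y_def intro!: divide_nonneg_nonneg sum_nonneg)
  have PU: "finite_energy (U j) \<and> energy (U j) \<le> C * B * real (Suc j) powr - (real a * (1 - \<theta>) * p)" for j
  proof -
    define v where "v t = real (Suc (N j - 1)) powr - \<theta> * (\<Sum>i<N j - 1. d (r i) t)" for t
    define c where "c = real (N j) powr (\<theta> - 1)"
    have "c \<le> real (N j) powr 0" unfolding c_def using N1[of j] \<theta> by (intro powr_mono) auto
    then have c: "0 \<le> c" "c \<le> 1" using N1[of j] by (auto simp: c_def)
    have v: "finite_energy v" "energy v \<le> B" unfolding v_def using B by auto
    have "Suc (N j - 1) = N j" using N1[of j] by simp
    then have Uv: "\<bar>U j t\<bar> = \<bar>c * v t\<bar>" for t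
    proof -
      have "c * v t = (real (N j) powr (\<theta> - 1) * real (N j) powr - \<theta>) * (\<Sum>i<N j - 1. d (r i) t)"
        using \<open>Suc (N j - 1) = N j\<close> by (simp add: c_def v_def)
      also have "real (N j) powr (\<theta> - 1) * real (N j) powr - \<theta> = 1 / real (N j)"
      proof -
        have "real (N j) powr (\<theta> - 1) * real (N j) powr - \<theta> = real (N j) powr (- 1)"
          unfolding powr_add[symmetric] by simp
        then show ?thesis using N1[of j] by (simp add: powr_minus_divide)
      qed
      finally show ?thesis by (simp add: U_def)
    qed
    have "finite_energy (\<lambda>t. c * v t)" using c by (intro finite_energy_scale v) auto
    moreover have [measurable]: "U j \<in> borel_measurable unit_interval" unfolding U_def using finite_energyD(1)[OF d] by measurable
    ultimately have "finite_energy (U j)" using Uv by (simp add: finite_energy_def)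
    moreover have "energy (U j) \<le> C * B * real (Suc j) powr - (real a * (1 - \<theta>) * p)"
    proof -
      have "energy (U j) = energy (\<lambda>t. c * v t)" unfolding energy_def Uv ..
      also have "\<dots> \<le> C * c powr p * energy v" by (rule energy_scale[OF v(1) c])
      also have "\<dots> \<le> C * c powr p * B" using D_le_C v by (intro mult_left_mono) auto
      also have "c powr p = real (Suc j) powr - (real a * (1 - \<theta>) * p)"
      proof -
        have "real (N j) = real (Suc j) powr real a" by (simp add: N_def powr_realpow)
        then show ?thesis by (simp add: c_def powr_powr algebra_simps)
      qed
      finally show ?thesis by (simp add: ac_simps)
    qed
    ultimately show ?thesis by blast
  qed
  have PY: "finite_energy (Y j) \<and> energy (Y j) \<le> C * K * real (Suc j) powr - p" for j
  proof -
    define c where "c = card (I j) / (2 ^ a * real (N j))"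
    have c0: "0 \<le> c" by (simp add: c_def)
    have gap: "real (card (I j)) \<le> 2 ^ a / real (j + 1) * real (N j)"
      using grid_gap[of j a] N_less[of j] unfolding cI NS[symmetric] N_def[symmetric] by (simp add: of_nat_diff)
    have "c \<le> 1 / real (j + 1)"
      unfolding c_def using gap N1[of j] by (simp add: divide_simps mult.commute)
    then have c1: "c \<le> 1 / real (Suc j)" by simp
    have c2: "c \<le> 1" using c1 by (rule order_trans) simp
    have Yc: "Y j t = c * ((\<Sum>i\<in>I j. \<bar>d (r i) t\<bar>) / card (I j))" for t
      using fI[of j] by (simp add: Y_def c_def card_gt_0_iff)
    have S: "integrable unit_interval (\<lambda>t. \<Sum>i\<in>I j. \<Phi> \<bar>d (r i) t\<bar>)" using finite_energyD(2)[OF d] by simp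
    have b: "\<Phi> \<bar>Y j t\<bar> \<le> C * c powr p * ((\<Sum>i\<in>I j. \<Phi> \<bar>d (r i) t\<bar>) / card (I j))" for t
      using Phi_average[of "I j" c "\<lambda>i. d (r i) t", OF fI[of j] c0 c2] Y0[of j t] unfolding Yc[symmetric] by simp
    have m: "Y j \<in> borel_measurable unit_interval" unfolding Y_def using finite_energyD(1)[OF d] by measurable
    have i: "integrable unit_interval (\<lambda>t. C * c powr p * ((\<Sum>i\<in>I j. \<Phi> \<bar>d (r i) t\<bar>) / card (I j)))" using S by simp
    have "energy (Y j) \<le> (LINT t|unit_interval. C * c powr p * ((\<Sum>i\<in>I j. \<Phi> \<bar>d (r i) t\<bar>) / card (I j)))"
      by (rule finite_energy_dominated(2)[OF m i b])
    also have "\<dots> = C * c powr p * ((\<Sum>i\<in>I j. energy (d (r i))) / card (I j))"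
      unfolding energy_def using finite_energyD(2)[OF d] by simp
    also have "\<dots> \<le> C * c powr p * K"
    proof (intro mult_left_mono)
      have "(\<Sum>i\<in>I j. energy (d (r i))) \<le> real (card (I j)) * K" using K by (intro sum_bounded_above) auto
      then show "(\<Sum>i\<in>I j. energy (d (r i))) / card (I j) \<le> K" using fI[of j] by (simp add: divide_simps card_gt_0_iff mult.commute)
    qed (use D_le_C in simp)
    also have "\<dots> \<le> C * (1 / real (Suc j)) powr p * K"
      using c0 c1 p D_le_C K0 by (intro mult_right_mono mult_left_mono powr_mono2) auto
    also have "\<dots> = C * K * real (Suc j) powr - p" by (simp add: powr_divide powr_minus_divide)
    finally show ?thesis using finite_energy_dominated(1)[OF m i b] by blast
  qed
  define w where "w j t = \<Phi> (U j t) + \<Phi> (Y j t)" for j t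
  have w0: "0 \<le> w j t" for j t using Phi_nonneg U0 Y0 by (simp add: w_def)
  have w_abs: "w j t = \<Phi> \<bar>U j t\<bar> + \<Phi> \<bar>Y j t\<bar>" for j t using U0 Y0 by (simp add: w_def)
  have w_int: "integrable unit_interval (w j)" for j
    unfolding w_abs using PU[of j] PY[of j] finite_energyD(2) by simp
  have w_le: "(LINT t|unit_interval. w j t) \<le> C * B * real (Suc j) powr - (real a * (1 - \<theta>) * p) + C * K * real (Suc j) powr - p" for j
  proof -
    have "(LINT t|unit_interval. w j t) = energy (U j) + energy (Y j)"
      unfolding w_abs energy_def using PU[of j] PY[of j] finite_energyD(2) by simp
    then show ?thesis using PU[of j] PY[of j] by linarith
  qed
  have summ: "summable (\<lambda>j. real (Suc j) powr - x)" if "x > 1" for x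
  proof -
    have "summable (\<lambda>j. real j powr - x)" using that by (simp add: summable_real_powr_iff)
    then show ?thesis by (rule summable_Suc_iff[THEN iffD2])
  qed
  have sumw: "summable (\<lambda>j. LINT t|unit_interval. w j t)"
  proof (rule summable_comparison_test')
    show "summable (\<lambda>j. C * B * real (Suc j) powr - (real a * (1 - \<theta>) * p) + C * K * real (Suc j) powr - p)"
      using \<theta> p by (intro summable_add summable_mult summ) auto
    show "norm (LINT t|unit_interval. w j t) \<le> C * B * real (Suc j) powr - (real a * (1 - \<theta>) * p) + C * K * real (Suc j) powr - p" for j
      using w_le[of j] integral_nonneg_AE[of "w j" unit_interval] w0 by simp
  qed
  define Z where "Z t = (\<Sum>j. ennreal (w j t))" for t
  have w_meas [measurable]: "w j \<in> borel_measurable unit_interval" for j using w_int by auto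
  have Z_meas: "Z \<in> borel_measurable unit_interval" unfolding Z_def by measurable
  have "(\<integral>\<^sup>+t. Z t \<partial>unit_interval) = (\<Sum>j. \<integral>\<^sup>+t. ennreal (w j t) \<partial>unit_interval)"
    unfolding Z_def by (rule nn_integral_suminf) measurable
  also have "\<dots> = (\<Sum>j. ennreal (LINT t|unit_interval. w j t))"
    using w_int w0 by (simp add: nn_integral_eq_integral)
  also have "\<dots> = ennreal (\<Sum>j. LINT t|unit_interval. w j t)"
    by (rule suminf_ennreal2[OF _ sumw]) (intro integral_nonneg_AE AE_I2 w0)
  finally have Zfin: "(\<integral>\<^sup>+t. Z t \<partial>unit_interval) < \<infinity>" by simp
  \<comment> \<open>The factor collects \<open>2\<^sup>a\<close> from \<open>Y j\<close>, 2 from the maximum of two terms and 2 from \<open>N j \<le> 2 (m + 1)\<close>.\<close>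
  define c where "c = (2::real) ^ (a + 2)"
  have c: "c > 0" by (simp add: c_def)
  have key: "\<exists>j. m + 2 < N (Suc j) \<and> \<Phi> (\<bar>cesaro (d \<circ> r) m t\<bar> / c) \<le> w j t" for m t
  proof -
    obtain j where j: "N j \<le> m + 2" "m + 2 < N (Suc j)"
      using grid_index[of "m + 2" a] \<theta>(4) unfolding N_def by auto
    let ?S = "\<Sum>i<Suc m. d (r i) t"
    have split: "{..<Suc m} = {..<N j - 1} \<union> {N j - 1..<Suc m}" using j(1) by auto
    have "?S = (\<Sum>i<N j - 1. d (r i) t) + (\<Sum>i\<in>{N j - 1..<Suc m}. d (r i) t)"
      unfolding split by (rule sum.union_disjoint) auto
    then have "\<bar>?S\<bar> \<le> \<bar>\<Sum>i<N j - 1. d (r i) t\<bar> + \<bar>\<Sum>i\<in>{N j - 1..<Suc m}. d (r i) t\<bar>"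
      by (simp only: abs_triangle_ineq)
    also have "\<bar>\<Sum>i\<in>{N j - 1..<Suc m}. d (r i) t\<bar> \<le> (\<Sum>i\<in>{N j - 1..<Suc m}. \<bar>d (r i) t\<bar>)" by (rule sum_abs)
    also have "\<dots> \<le> (\<Sum>i\<in>I j. \<bar>d (r i) t\<bar>)" unfolding I_def using j(2) by (intro sum_mono2) auto
    also have "\<bar>\<Sum>i<N j - 1. d (r i) t\<bar> = U j t * N j" using N1[of j] by (simp add: U_def)
    also have "(\<Sum>i\<in>I j. \<bar>d (r i) t\<bar>) = 2 ^ a * Y j t * N j" using N1[of j] by (simp add: Y_def)
    finally have S_le: "\<bar>?S\<bar> \<le> (U j t + 2 ^ a * Y j t) * N j" by (simp add: distrib_right)
    have UY: "0 \<le> U j t + 2 ^ a * Y j t" using U0 Y0 by simp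
    have "\<bar>cesaro (d \<circ> r) m t\<bar> = \<bar>?S\<bar> / real (Suc m)" by (simp add: cesaro_def)
    also have "\<dots> \<le> (U j t + 2 ^ a * Y j t) * N j / real (Suc m)" by (intro divide_right_mono S_le) simp
    also have "\<dots> \<le> (U j t + 2 ^ a * Y j t) * 2"
    proof -
      have "real (N j) / real (Suc m) \<le> 2" using j(1) by (simp add: divide_simps)
      from mult_left_mono[OF this UY] show ?thesis by simp
    qed
    also have "\<dots> \<le> (2 ^ a * U j t + 2 ^ a * Y j t) * 2"
    proof -
      have "(1::real) \<le> 2 ^ a" by simp
      from mult_right_mono[OF this U0[of j t]] show ?thesis by simp
    qed
    also have "\<dots> \<le> c * max (U j t) (Y j t)"
    proof -
      have "2 ^ a * U j t + 2 ^ a * Y j t \<le> 2 ^ a * max (U j t) (Y j t) + 2 ^ a * max (U j t) (Y j t)"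
        by (intro add_mono mult_left_mono) auto
      then show ?thesis by (simp add: c_def power_add)
    qed
    finally have "\<bar>cesaro (d \<circ> r) m t\<bar> / c \<le> max (U j t) (Y j t)" using c by (simp add: divide_simps mult.commute)
    then have "\<Phi> (\<bar>cesaro (d \<circ> r) m t\<bar> / c) \<le> \<Phi> (max (U j t) (Y j t))" using c by (intro Phi_mono) auto
    also have "\<dots> \<le> w j t" using Phi_nonneg[OF U0[of j t]] Phi_nonneg[OF Y0[of j t]] by (auto simp: w_def max_def)
    finally show ?thesis using j(2) by blast
  qed
  have bound: "ennreal (\<Phi> (\<bar>cesaro (d \<circ> r) m t\<bar> / c)) \<le> Z t" for m t
  proof -
    obtain j where "\<Phi> (\<bar>cesaro (d \<circ> r) m t\<bar> / c) \<le> w j t" using key by blast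
    then have "ennreal (\<Phi> (\<bar>cesaro (d \<circ> r) m t\<bar> / c)) \<le> ennreal (w j t)" by (rule ennreal_leI)
    also have "\<dots> \<le> Z t" unfolding Z_def
      using sum_le_suminf[of "\<lambda>j. ennreal (w j t)" "{j}"] by (simp add: summableI)
    finally show ?thesis .
  qed
  have "AE t in unit_interval. Z t \<noteq> \<infinity>" using Zfin by (intro nn_integral_PInf_AE Z_meas) auto
  then have lim: "AE t in unit_interval. (\<lambda>m. cesaro (d \<circ> r) m t) \<longlonglongrightarrow> 0"
  proof eventually_elim
    case (elim t)
    have "summable (\<lambda>j. w j t)"
      by (rule summable_suminf_not_top) (use elim w0 in \<open>auto simp: Z_def\<close>)
    then have w_lim: "(\<lambda>j. w j t) \<longlonglongrightarrow> 0" by (rule summable_LIMSEQ_zero)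
    show ?case
    proof (rule LIMSEQ_I)
      fix e :: real assume e: "e > 0"
      have "\<Phi> (e / c) > 0" using e c by (intro Phi_pos) auto
      then obtain J where J: "\<And>j. j \<ge> J \<Longrightarrow> w j t < \<Phi> (e / c)"
        using order_tendstoD(2)[OF w_lim] by (auto simp: eventually_sequentially)
      have "norm (cesaro (d \<circ> r) m t - 0) < e" if m: "m \<ge> N J" for m
      proof (rule ccontr)
        assume "\<not> norm (cesaro (d \<circ> r) m t - 0) < e"
        then have "e / c \<le> \<bar>cesaro (d \<circ> r) m t\<bar> / c" using c by (simp add: divide_right_mono)
        then have 1: "\<Phi> (e / c) \<le> \<Phi> (\<bar>cesaro (d \<circ> r) m t\<bar> / c)" using e c by (intro Phi_mono) auto
        obtain j where j: "m + 2 < N (Suc j)" "\<Phi> (\<bar>cesaro (d \<circ> r) m t\<bar> / c) \<le> w j t" using key by blast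
        have "J \<le> j"
        proof (rule ccontr)
          assume "\<not> J \<le> j"
          then have "N (Suc j) \<le> N J" unfolding N_def by (intro power_mono) auto
          then show False using j(1) m by simp
        qed
        with J 1 j(2) show False by fastforce
      qed
      then show "\<exists>no. \<forall>m\<ge>no. norm (cesaro (d \<circ> r) m t - 0) < e" by blast
    qed
  qed
  show ?thesis by (rule that[OF r Zfin Z_meas c bound lim])
qed

end

section \<open>Sufficiency of the growth conditions\<close>

context orlicz
begin

lemma heart_dualI:
  assumes add: "\<And>f h. f \<in> H \<Longrightarrow> h \<in> H \<Longrightarrow> L (\<lambda>t. f t + h t) = L f + L h"
    and mult: "\<And>f a. f \<in> H \<Longrightarrow> L (\<lambda>t. a * f t) = a * L f"
    and bound: "\<And>f c. f \<in> H \<Longrightarrow> c > 0 \<Longrightarrow> \<rho> (\<lambda>t. f t / c) \<le> 1 \<Longrightarrow> \<bar>L f\<bar> \<le> A * c"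
  shows "L \<in> heart_dual \<phi>"
proof -
  have "ennreal \<bar>L f\<bar> \<le> ennreal (\<bar>A\<bar> + 1) * luxemburg_norm \<phi> f" if f: "f \<in> H" for f
  proof -
    have "ennreal (\<bar>L f\<bar> / (\<bar>A\<bar> + 1)) \<le> luxemburg_norm \<phi> f"
      unfolding luxemburg_norm_def
    proof (rule INF_greatest)
      fix c assume "c \<in> {c. 0 < c \<and> \<rho> (\<lambda>t. f t / c) \<le> 1}"
      then have c: "0 < c" "\<rho> (\<lambda>t. f t / c) \<le> 1" by auto
      have "\<bar>L f\<bar> \<le> A * c" by (rule bound[OF f c])
      also have "\<dots> \<le> (\<bar>A\<bar> + 1) * c" using c by (intro mult_right_mono) auto
      finally have "\<bar>L f\<bar> / (\<bar>A\<bar> + 1) \<le> c" by (simp add: divide_simps mult.commute)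
      then show "ennreal (\<bar>L f\<bar> / (\<bar>A\<bar> + 1)) \<le> ennreal c" by (rule ennreal_leI)
    qed
    then have "ennreal (\<bar>A\<bar> + 1) * ennreal (\<bar>L f\<bar> / (\<bar>A\<bar> + 1)) \<le> ennreal (\<bar>A\<bar> + 1) * luxemburg_norm \<phi> f"
      by (rule mult_left_mono) simp
    moreover have "ennreal (\<bar>A\<bar> + 1) * ennreal (\<bar>L f\<bar> / (\<bar>A\<bar> + 1)) = ennreal \<bar>L f\<bar>"
      by (subst ennreal_mult[symmetric]) (simp_all add: add_nonneg_eq_0_iff)
    ultimately show ?thesis by (simp only:)
  qed
  then show ?thesis unfolding heart_dual_def using add mult by blast
qed

lemma dominated_norm_converges:
  assumes D: "\<And>m. (\<lambda>t. f m t - l t) \<in> borel_measurable unit_interval" and h: "h \<in> H"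
    and lim: "AE t in unit_interval. (\<lambda>m. f m t - l t) \<longlonglongrightarrow> 0"
    and dom: "AE t in unit_interval. \<forall>m. \<bar>f m t - l t\<bar> \<le> h t"
  shows "norm_converges \<phi> f l"
proof (rule norm_convergesI)
  fix c :: real assume c: "c > 0"
  note [measurable] = D heartD(1)[OF h]
  have "(\<lambda>m. \<integral>\<^sup>+t. ennreal (\<phi> \<bar>(f m t - l t) / c\<bar>) \<partial>unit_interval) \<longlonglongrightarrow> (\<integral>\<^sup>+t. 0 \<partial>unit_interval)"
  proof (rule nn_integral_dominated_convergence[where w="\<lambda>t. ennreal (\<phi> \<bar>h t / c\<bar>)"])
    show "(\<integral>\<^sup>+t. ennreal (\<phi> \<bar>h t / c\<bar>) \<partial>unit_interval) < \<infinity>"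
      using heartD(2)[OF h c] by (simp add: modular_def)
    show "AE t in unit_interval. ennreal (\<phi> \<bar>(f m t - l t) / c\<bar>) \<le> ennreal (\<phi> \<bar>h t / c\<bar>)" for m
      using dom
    proof eventually_elim
      case (elim t)
      have "\<bar>(f m t - l t) / c\<bar> \<le> \<bar>h t / c\<bar>"
        using elim[rule_format, of m] c by (auto simp: abs_divide intro!: divide_right_mono)
      then show ?case by (intro ennreal_leI mono) auto
    qed
    show "AE t in unit_interval. (\<lambda>m. ennreal (\<phi> \<bar>(f m t - l t) / c\<bar>)) \<longlonglongrightarrow> 0"
      using lim
    proof eventually_elim
      case (elim t)
      let ?x = "\<lambda>m. \<bar>(f m t - l t) / c\<bar>"
      have x0: "?x \<longlonglongrightarrow> 0" using tendsto_rabs_zero[OF tendsto_divide_zero[OF elim, of c]] .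
      have "\<forall>\<^sub>F m in sequentially. norm (\<phi> (?x m)) \<le> ?x m * \<phi> 1"
        using order_tendstoD(2)[OF x0, of 1, OF zero_less_one]
      proof eventually_elim
        case (elim m)
        have "\<phi> (?x m) \<le> ?x m * \<phi> 1" using scale[of "?x m" 1] elim by simp
        then show ?case using nonneg[of "?x m"] by simp
      qed
      moreover have "(\<lambda>m. ?x m * \<phi> 1) \<longlonglongrightarrow> 0" using tendsto_mult_left_zero[OF x0] .
      ultimately have "(\<lambda>m. \<phi> (?x m)) \<longlonglongrightarrow> 0" by (rule Lim_null_comparison)
      then show "(\<lambda>m. ennreal (\<phi> (?x m))) \<longlonglongrightarrow> 0" using tendsto_ennrealI[of _ 0] by fastforce
    qed
  qed measurable
  then have "(\<lambda>m. \<rho> (\<lambda>t. (f m t - l t) / c)) \<longlonglongrightarrow> 0" by (simp add: modular_def)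
  from order_tendstoD(2)[OF this, of 1] show "\<forall>\<^sub>F m in sequentially. \<rho> (\<lambda>t. (f m t - l t) / c) \<le> 1"
    by (auto elim: eventually_mono)
qed

text \<open>
  The supremum is taken in the extended reals, where it is always measurable; an infinite supremum becomes 0, but
  the envelope is used only where the sequence converges.
\<close>

definition envelope :: "(nat \<Rightarrow> real \<Rightarrow> real) \<Rightarrow> nat \<Rightarrow> real \<Rightarrow> real" where
  "envelope D n t = real_of_ereal (SUP m\<in>{n..}. ereal \<bar>D m t\<bar>)"

lemma envelope_measurable [measurable]:
  assumes [measurable]: "\<And>m. D m \<in> borel_measurable M" shows "envelope D n \<in> borel_measurable M"
  unfolding envelope_def by measurable

lemma envelope_bounded:
  assumes "(\<lambda>m. D m t) \<longlonglongrightarrow> (0::real)"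
  shows "m \<ge> n \<Longrightarrow> \<bar>D m t\<bar> \<le> envelope D n t"
    and "(\<And>m. m \<ge> n \<Longrightarrow> \<bar>D m t\<bar> \<le> b) \<Longrightarrow> envelope D n t \<le> b"
    and "0 \<le> envelope D n t"
    and "0 < envelope D n t \<Longrightarrow> \<exists>m\<ge>n. envelope D n t / 2 < \<bar>D m t\<bar>"
proof -
  obtain b where b: "\<And>m. \<bar>D m t\<bar> \<le> b"
    using convergent_imp_Bseq[of "\<lambda>m. D m t"] assms by (auto simp: convergent_def Bseq_def)
  let ?S = "SUP m\<in>{n..}. ereal \<bar>D m t\<bar>"
  have "?S \<le> ereal b" by (rule SUP_least) (simp add: b)
  moreover have "0 \<le> ?S" by (rule SUP_upper2[of n]) auto
  ultimately have S: "?S = ereal (envelope D n t)" unfolding envelope_def by (cases ?S) auto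
  show up: "\<bar>D m t\<bar> \<le> envelope D n t" if "m \<ge> n" for m
  proof -
    have "ereal \<bar>D m t\<bar> \<le> ?S" by (rule SUP_upper) (use that in simp)
    then show ?thesis unfolding S by simp
  qed
  show "envelope D n t \<le> b" if "\<And>m. m \<ge> n \<Longrightarrow> \<bar>D m t\<bar> \<le> b" for b
  proof -
    have "?S \<le> ereal b" by (rule SUP_least) (use that in simp)
    then show ?thesis unfolding S by simp
  qed
  show "0 \<le> envelope D n t" using up[of n] by (rule order_trans[rotated]) auto
  assume "0 < envelope D n t"
  then have "ereal (envelope D n t / 2) < ?S" unfolding S by simp
  then show "\<exists>m\<ge>n. envelope D n t / 2 < \<bar>D m t\<bar>" unfolding less_SUP_iff by auto
qed

lemma order_convergesI:
  assumes D: "\<And>m. (\<lambda>t. f m t - l t) \<in> borel_measurable unit_interval"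
    and lim: "AE t in unit_interval. (\<lambda>m. f m t - l t) \<longlonglongrightarrow> 0"
    and h: "envelope (\<lambda>m t. f m t - l t) 0 \<in> H"
  shows "order_converges \<phi> f l" "norm_converges \<phi> f l"
proof -
  let ?g = "envelope (\<lambda>m t. f m t - l t)"
  show "norm_converges \<phi> f l"
    by (rule dominated_norm_converges[OF D h lim]) (use lim in \<open>eventually_elim, auto intro: envelope_bounded(1)\<close>)
  have gm: "?g n \<in> borel_measurable unit_interval" for n by (rule envelope_measurable) (rule D)
  have dec: "AE t in unit_interval. ?g n t \<le> ?g m t" if "m \<le> n" for m n
    using lim by eventually_elim (use that in \<open>auto intro!: envelope_bounded(2) envelope_bounded(1)\<close>)
  have gpos: "AE t in unit_interval. 0 \<le> ?g n t" for n
    using lim by eventually_elim (rule envelope_bounded(3))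
  have gH: "?g n \<in> H" for n
  proof (rule heart_dominated[OF h gm])
    show "AE t in unit_interval. \<bar>?g n t\<bar> \<le> \<bar>?g 0 t\<bar>"
      using dec[of 0 n] gpos[of n] by (auto elim!: eventually_elim2)
  qed
  have "decreases_to_zero \<phi> ?g"
    unfolding decreases_to_zero_def ae_le_def
  proof (intro conjI allI ballI impI)
    show "AE t in unit_interval. ?g (Suc n) t \<le> ?g n t" for n by (rule dec) simp
    show "AE t in unit_interval. 0 \<le> ?g n t" for n by (rule gpos)
    fix k assume "\<forall>n. AE t in unit_interval. k t \<le> ?g n t"
    then have "AE t in unit_interval. \<forall>n. k t \<le> ?g n t" by (simp add: AE_all_countable)
    then show "AE t in unit_interval. k t \<le> 0"
      using lim
    proof eventually_elim
      case (elim t)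
      show ?case
      proof (rule field_le_epsilon)
        fix e :: real assume "e > 0"
        then obtain n where n: "\<And>m. m \<ge> n \<Longrightarrow> \<bar>f m t - l t\<bar> < e" using LIMSEQ_D[OF elim(2)] by auto
        have "?g n t \<le> e" by (rule envelope_bounded(2)[where D="\<lambda>m t. f m t - l t", OF elim(2)]) (use n in \<open>auto intro: less_imp_le\<close>)
        then show "k t \<le> 0 + e" using elim(1)[rule_format, of n] by simp
      qed
    qed
  qed
  moreover have "AE t in unit_interval. \<bar>f n t - l t\<bar> \<le> ?g n t" for n
    using lim by eventually_elim (rule envelope_bounded(1), auto)
  ultimately show "order_converges \<phi> f l"
    unfolding order_converges_def ae_le_def using gH by blast
qed

end

text \<open>
  The constant \<open>B\<close> expresses that \<open>\<phi>\<close> and \<open>x g x\<close>, hence \<open>\<phi>\<close> and \<open>\<Phi>\<close>, are equivalent up to bounded amounts; on a space of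
  finite measure this identifies the heart with the functions of finite energy.
\<close>

locale orlicz_gauge = orlicz \<phi> + gauge g L E for \<phi> g L E +
  fixes B :: real
  assumes B: "0 \<le> B" and phi_le: "0 \<le> x \<Longrightarrow> \<phi> x \<le> B + x * g x" and le_phi: "0 \<le> x \<Longrightarrow> x * g x \<le> B + \<phi> x"
begin

lemma phi_Phi: "0 \<le> x \<Longrightarrow> \<phi> x \<le> B + C * \<Phi> x"
proof -
  assume x: "0 \<le> x"
  have "2 * D * \<Phi> x \<le> C * \<Phi> x" using D_le_C Phi_nonneg[OF x] by (intro mult_right_mono) auto
  then show ?thesis using phi_le[OF x] Phi_ge[OF x] by linarith
qed

lemma Phi_phi: "0 \<le> x \<Longrightarrow> \<Phi> x \<le> B + \<phi> x"
  using le_phi[of x] Phi_le[of x] by linarith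

lemma nn_Phi_le:
  assumes [measurable]: "v \<in> borel_measurable unit_interval"
  shows "(\<integral>\<^sup>+t. ennreal (\<Phi> \<bar>v t\<bar>) \<partial>unit_interval) \<le> ennreal B + \<rho> v"
proof -
  have "(\<integral>\<^sup>+t. ennreal (\<Phi> \<bar>v t\<bar>) \<partial>unit_interval) \<le> (\<integral>\<^sup>+t. ennreal B + ennreal (\<phi> \<bar>v t\<bar>) \<partial>unit_interval)"
    by (intro nn_integral_mono) (use B in \<open>simp add: ennreal_plus[symmetric] nonneg Phi_phi ennreal_leI del: ennreal_plus\<close>)
  also have "\<dots> = ennreal B + \<rho> v" unfolding modular_def
    by (subst nn_integral_add, measurable) (simp only: nn_integral_const emeasure_unit mult_1_right)
  finally show ?thesis .
qed

lemma heart_imp_finite_energy: assumes v: "v \<in> H" shows "finite_energy v"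
proof -
  note m = heartD(1)[OF v]
  have "\<rho> v < \<infinity>" using heartD_mult[OF v, of 1] by simp
  then have "(\<integral>\<^sup>+t. ennreal (\<Phi> \<bar>v t\<bar>) \<partial>unit_interval) < \<infinity>"
    by (intro le_less_trans[OF nn_Phi_le[OF m]]) (simp add: ennreal_add_less_top)
  then show ?thesis unfolding finite_energy_def using m by (intro conjI integrableI_nonneg) (auto simp: Phi_nonneg)
qed

lemma energy_le_if_modular_le:
  assumes v: "v \<in> H" and le: "\<rho> v \<le> 1" shows "energy v \<le> B + 1"
proof -
  have "ennreal (energy v) = (\<integral>\<^sup>+t. ennreal (\<Phi> \<bar>v t\<bar>) \<partial>unit_interval)"
    unfolding energy_def using finite_energyD(2)[OF heart_imp_finite_energy[OF v]] by (intro nn_integral_eq_integral[symmetric]) (auto simp: Phi_nonneg)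
  also have "\<dots> \<le> ennreal B + \<rho> v" by (rule nn_Phi_le[OF heartD(1)[OF v]])
  also have "\<dots> \<le> ennreal B + 1" using le by (rule add_left_mono)
  also have "\<dots> = ennreal (B + 1)" using B by simp
  finally show ?thesis using B by (subst (asm) ennreal_le_iff) auto
qed

lemma finite_energy_imp_heart: assumes v: "finite_energy v" shows "v \<in> H"
proof (rule heartI)
  show [measurable]: "v \<in> borel_measurable unit_interval" by (rule finite_energyD(1)[OF v])
  fix c :: real assume c: "c > 0"
  obtain k :: nat where k: "c \<le> 2 ^ k" using real_arch_pow[of 2 c] by (auto intro: less_imp_le)
  have le: "\<phi> \<bar>c * v t\<bar> \<le> B + C * (C ^ k * \<Phi> \<bar>v t\<bar>)" for t
  proof -
    have "\<phi> \<bar>c * v t\<bar> \<le> \<phi> (2 ^ k * \<bar>v t\<bar>)" using c k by (intro mono) (auto simp: abs_mult mult_right_mono)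
    also have "\<dots> \<le> B + C * \<Phi> (2 ^ k * \<bar>v t\<bar>)" by (rule phi_Phi) simp
    also have "\<dots> \<le> B + C * (C ^ k * \<Phi> \<bar>v t\<bar>)" using D_le_C by (intro add_left_mono mult_left_mono Phi_power) auto
    finally show ?thesis .
  qed
  interpret U: finite_measure unit_interval by (rule finite_measure_unit)
  have i: "integrable unit_interval (\<lambda>t. B + C * (C ^ k * \<Phi> \<bar>v t\<bar>))" using finite_energyD(2)[OF v] by simp
  have "\<rho> (\<lambda>t. c * v t) \<le> (\<integral>\<^sup>+t. ennreal (B + C * (C ^ k * \<Phi> \<bar>v t\<bar>)) \<partial>unit_interval)"
    unfolding modular_def by (intro nn_integral_mono ennreal_leI le)
  also have "\<dots> = ennreal (LINT t|unit_interval. B + C * (C ^ k * \<Phi> \<bar>v t\<bar>))"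
    by (intro nn_integral_eq_integral i AE_I2) (use B D_le_C in \<open>auto intro!: add_nonneg_nonneg mult_nonneg_nonneg Phi_nonneg\<close>)
  finally show "\<rho> (\<lambda>t. c * v t) < \<infinity>" by (rule le_less_trans) simp
qed

lemma energy_power: assumes "finite_energy v" shows "energy (\<lambda>t. 2 ^ k * v t) \<le> C ^ k * energy v"
proof -
  have "energy (\<lambda>t. 2 ^ k * v t) \<le> (LINT t|unit_interval. C ^ k * \<Phi> \<bar>v t\<bar>)"
  proof (rule finite_energy_dominated(2))
    show "\<Phi> \<bar>2 ^ k * v t\<bar> \<le> C ^ k * \<Phi> \<bar>v t\<bar>" for t using Phi_power[of "\<bar>v t\<bar>" k] by (simp add: abs_mult)
    show "(\<lambda>t. 2 ^ k * v t) \<in> borel_measurable unit_interval" using finite_energyD(1)[OF assms] by measurable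
  qed (use finite_energyD(2)[OF assms] in simp)
  then show ?thesis by (simp add: energy_def)
qed

lemma norm_bounded_energy:
  assumes f: "\<And>n. f n \<in> H" and b: "norm_bounded \<phi> f" obtains K where "\<And>n. energy (f n) \<le> K"
proof -
  obtain c where c: "c > 0" "\<And>n. \<rho> (\<lambda>t. f n t / c) \<le> 1" using norm_boundedD[OF b] by blast
  obtain k :: nat where k: "c \<le> 2 ^ k" using real_arch_pow[of 2 c] by (auto intro: less_imp_le)
  have "energy (f n) \<le> C ^ k * (B + 1)" for n
  proof -
    have fc: "(\<lambda>t. f n t / c) \<in> H" using heart_cmult[OF f[of n], of "1/c"] by simp
    have f2: "finite_energy (\<lambda>t. 2 ^ k * (f n t / c))" using heart_imp_finite_energy[OF heart_cmult[OF fc, of "2^k"]] .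
    have "energy (f n) = energy (\<lambda>t. (c / 2 ^ k) * (2 ^ k * (f n t / c)))" using c by simp
    also have "\<dots> \<le> energy (\<lambda>t. 2 ^ k * (f n t / c))" using c k by (intro energy_mono_scale f2) auto
    also have "\<dots> \<le> C ^ k * energy (\<lambda>t. f n t / c)" by (rule energy_power[OF heart_imp_finite_energy[OF fc]])
    also have "\<dots> \<le> C ^ k * (B + 1)" using D_le_C by (intro mult_left_mono energy_le_if_modular_le fc c) auto
    finally show ?thesis .
  qed
  then show ?thesis using that by blast
qed

text \<open>
  The envelope of the Cesaro means inherits the bound by \<open>Z\<close> up to a factor 2, because some term exceeds half of
  a positive supremum.
\<close>

lemma convergent_subsequence:
  assumes f: "\<And>n. f n \<in> H" and l: "l \<in> H" and K: "\<And>n. energy (f n) \<le> K"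
    and weak: "\<And>v. finite_energy v \<Longrightarrow> (\<lambda>n. LINT t|unit_interval. G (v t) * (f n t - l t)) \<longlonglongrightarrow> 0"
  obtains r where "strict_mono (r::nat\<Rightarrow>nat)" "order_converges \<phi> (cesaro (f \<circ> r)) l" "norm_converges \<phi> (cesaro (f \<circ> r)) l"
proof -
  define d where "d n t = f n t - l t" for n t
  have d: "finite_energy (d n)" for n unfolding d_def by (intro heart_imp_finite_energy heart_diff f l)
  have dK: "energy (d n) \<le> C * (K + energy l)" for n
  proof -
    have "energy (d n) \<le> (LINT t|unit_interval. C * (\<Phi> \<bar>f n t\<bar> + \<Phi> \<bar>l t\<bar>))"
    proof (rule finite_energy_dominated(2)[OF finite_energyD(1)[OF d]])
      show "\<Phi> \<bar>d n t\<bar> \<le> C * (\<Phi> \<bar>f n t\<bar> + \<Phi> \<bar>l t\<bar>)" for t using Phi_add[of "f n t" "- l t"] by (simp add: d_def)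
    qed (use finite_energyD(2)[OF heart_imp_finite_energy[OF f]] finite_energyD(2)[OF heart_imp_finite_energy[OF l]] in simp)
    also have "\<dots> = C * (energy (f n) + energy l)"
      unfolding energy_def using finite_energyD(2)[OF heart_imp_finite_energy[OF f]] finite_energyD(2)[OF heart_imp_finite_energy[OF l]] by simp
    also have "\<dots> \<le> C * (K + energy l)" using K D_le_C by (intro mult_left_mono add_right_mono) auto
    finally show ?thesis .
  qed
  obtain r Z c where r: "strict_mono (r::nat\<Rightarrow>nat)" and Z: "(\<integral>\<^sup>+t. Z t \<partial>unit_interval) < \<infinity>" "Z \<in> borel_measurable unit_interval"
    and c: "c > 0" and le: "\<And>m t. ennreal (\<Phi> (\<bar>cesaro (d \<circ> r) m t\<bar> / c)) \<le> Z t"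
    and lim: "AE t in unit_interval. (\<lambda>m. cesaro (d \<circ> r) m t) \<longlonglongrightarrow> 0"
    by (rule cesaro_dominated[of d "C * (K + energy l)"]) (use d dK weak in \<open>auto simp: d_def\<close>)
  have eq: "cesaro (d \<circ> r) m t = cesaro (f \<circ> r) m t - l t" for m t
    by (simp add: cesaro_def d_def sum_subtractf diff_divide_distrib add_divide_distrib del: sum.lessThan_Suc)
  have eq': "cesaro (d \<circ> r) = (\<lambda>m t. cesaro (f \<circ> r) m t - l t)" by (intro ext eq)
  have Dm: "(\<lambda>t. cesaro (f \<circ> r) m t - l t) \<in> borel_measurable unit_interval" for m
    by (intro borel_measurable_diff heartD(1) l cesaro_heart) (simp add: f)
  let ?h = "envelope (cesaro (d \<circ> r)) 0"
  have hm: "?h \<in> borel_measurable unit_interval" by (rule envelope_measurable) (simp add: eq' Dm)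
  have "finite_energy (\<lambda>t. ?h t / (2 * c))" unfolding finite_energy_def
  proof
    show m: "(\<lambda>t. ?h t / (2 * c)) \<in> borel_measurable unit_interval" using hm by measurable
    have "AE t in unit_interval. ennreal (\<Phi> \<bar>?h t / (2 * c)\<bar>) \<le> Z t"
      using lim
    proof eventually_elim
      case (elim t)
      show ?case
      proof (cases "?h t > 0")
        case True
        then obtain m where m: "?h t / 2 < \<bar>cesaro (d \<circ> r) m t\<bar>" using envelope_bounded(4)[where D="cesaro (d \<circ> r)", OF elim] by blast
        have "\<bar>?h t / (2 * c)\<bar> = ?h t / 2 / c" using True c by simp
        also have "\<dots> \<le> \<bar>cesaro (d \<circ> r) m t\<bar> / c" using m c by (intro divide_right_mono) auto
        finally have "ennreal (\<Phi> \<bar>?h t / (2 * c)\<bar>) \<le> ennreal (\<Phi> (\<bar>cesaro (d \<circ> r) m t\<bar> / c))"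
          by (intro ennreal_leI Phi_mono) auto
        also have "\<dots> \<le> Z t" by (rule le)
        finally show ?thesis .
      next
        case False
        then have "?h t = 0" using envelope_bounded(3)[where D="cesaro (d \<circ> r)", OF elim, of 0] by simp
        then show ?thesis by simp
      qed
    qed
    then have "(\<integral>\<^sup>+t. ennreal (\<Phi> \<bar>?h t / (2 * c)\<bar>) \<partial>unit_interval) \<le> (\<integral>\<^sup>+t. Z t \<partial>unit_interval)" by (rule nn_integral_mono_AE)
    then show "integrable unit_interval (\<lambda>t. \<Phi> \<bar>?h t / (2 * c)\<bar>)"
      using Z(1) by (intro integrableI_nonneg Phi_measurable m AE_I2 Phi_nonneg) (auto intro: le_less_trans)
  qed
  then have "(\<lambda>t. ?h t / (2 * c)) \<in> H" by (rule finite_energy_imp_heart)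
  from heart_cmult[OF this, of "2 * c"] have hH: "envelope (\<lambda>m t. cesaro (f \<circ> r) m t - l t) 0 \<in> H"
    using c by (simp add: eq')
  have lim': "AE t in unit_interval. (\<lambda>m. cesaro (f \<circ> r) m t - l t) \<longlonglongrightarrow> 0" using lim unfolding eq .
  show ?thesis using that[OF r] order_convergesI[OF Dm lim' hH] by blast
qed

lemma bounded_convergent_subsequence:
  assumes f: "\<And>n. f n \<in> H" and b: "norm_bounded \<phi> f"
  obtains r l where "strict_mono (r::nat\<Rightarrow>nat)" "l \<in> H" "order_converges \<phi> (cesaro (f \<circ> r)) l" "norm_converges \<phi> (cesaro (f \<circ> r)) l"
proof -
  obtain K where K: "\<And>n. energy (f n) \<le> K" using norm_bounded_energy[OF f b] by blast
  obtain r1 l where r1: "strict_mono r1" "finite_energy l"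
    "\<And>v. finite_energy v \<Longrightarrow> (\<lambda>n. LINT t|unit_interval. G (v t) * (f (r1 n) t - l t)) \<longlonglongrightarrow> 0"
    using weak_compactness[of f K] heart_imp_finite_energy[OF f] K by blast
  obtain r2 where r2: "strict_mono r2" "order_converges \<phi> (cesaro ((f \<circ> r1) \<circ> r2)) l" "norm_converges \<phi> (cesaro ((f \<circ> r1) \<circ> r2)) l"
    by (rule convergent_subsequence[of "f \<circ> r1" l K]) (use f K r1 finite_energy_imp_heart in auto)
  show ?thesis
    by (rule that[of "r1 \<circ> r2" l]) (use r1 r2 finite_energy_imp_heart in \<open>auto simp: o_assoc intro: strict_mono_o\<close>)
qed

lemma pairing_bound:
  assumes v: "finite_energy v" and u: "finite_energy u" shows "\<bar>LINT t|unit_interval. G (v t) * u t\<bar> \<le> C * (energy v + energy u)"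
proof -
  have "\<bar>LINT t|unit_interval. G (v t) * u t\<bar> \<le> (LINT t|unit_interval. \<bar>G (v t) * u t\<bar>)" by (rule integral_abs_bound)
  also have "\<dots> \<le> (LINT t|unit_interval. C * (\<Phi> \<bar>v t\<bar> + \<Phi> \<bar>u t\<bar>))"
  proof (intro integral_mono integrable_abs G_integrable v u)
    show "integrable unit_interval (\<lambda>t. C * (\<Phi> \<bar>v t\<bar> + \<Phi> \<bar>u t\<bar>))" using finite_energyD(2)[OF v] finite_energyD(2)[OF u] by simp
    show "\<bar>G (v t) * u t\<bar> \<le> C * (\<Phi> \<bar>v t\<bar> + \<Phi> \<bar>u t\<bar>)" for t
      using g_mult_le[of "\<bar>v t\<bar>" "\<bar>u t\<bar>"] by (simp add: abs_mult abs_G)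
  qed
  also have "\<dots> = C * (energy v + energy u)" unfolding energy_def using finite_energyD(2)[OF v] finite_energyD(2)[OF u] by simp
  finally show ?thesis .
qed

lemma pairing_scaled_bound:
  assumes v: "finite_energy v" and u: "u \<in> H" and c: "c > 0" "energy (\<lambda>t. u t / c) \<le> q"
  shows "\<bar>LINT t|unit_interval. G (v t) * u t\<bar> \<le> C * (energy v + q) * c"
proof -
  have uc: "finite_energy (\<lambda>t. u t / c)" using heart_imp_finite_energy[OF heart_cmult[OF u, of "1/c"]] by simp
  have "(LINT t|unit_interval. G (v t) * u t) = (LINT t|unit_interval. c * (G (v t) * (u t / c)))"
    using c by (intro Bochner_Integration.integral_cong) auto
  then have "\<bar>LINT t|unit_interval. G (v t) * u t\<bar> = c * \<bar>LINT t|unit_interval. G (v t) * (u t / c)\<bar>"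
    using c by (simp add: abs_mult del: times_divide_eq_right)
  also have "\<dots> \<le> c * (C * (energy v + energy (\<lambda>t. u t / c)))" using c by (intro mult_left_mono pairing_bound v uc) auto
  also have "\<dots> \<le> c * (C * (energy v + q))" using c D_le_C by (intro mult_left_mono add_left_mono) auto
  finally show ?thesis by (simp add: mult.commute)
qed

lemma pairing_add:
  assumes "finite_energy v" "u \<in> H" "w \<in> H"
  shows "(LINT t|unit_interval. G (v t) * (u t + w t)) = (LINT t|unit_interval. G (v t) * u t) + (LINT t|unit_interval. G (v t) * w t)"
  using G_integrable[OF assms(1) heart_imp_finite_energy[OF assms(2)]] G_integrable[OF assms(1) heart_imp_finite_energy[OF assms(3)]]
  by (simp add: distrib_left)

lemma pairing_mult: "(LINT t|unit_interval. G (v t) * (a * u t)) = a * (LINT t|unit_interval. G (v t) * u t)"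
  by (simp add: mult.left_commute)

lemma scaled_energy: 
  assumes u: "u \<in> H" and "\<rho> (\<lambda>t. u t / c) \<le> 1" shows "energy (\<lambda>t. u t / c) \<le> B + 1"
  using energy_le_if_modular_le[of "\<lambda>t. u t / c"] heart_cmult[OF u, of "1/c"] assms by simp

lemma pairing_dual: assumes v: "finite_energy v" shows "(\<lambda>u. LINT t|unit_interval. G (v t) * u t) \<in> heart_dual \<phi>"
  by (rule heart_dualI[where A="C * (energy v + (B + 1))"])
    (use v in \<open>auto intro!: pairing_add pairing_mult pairing_scaled_bound scaled_energy\<close>)

text \<open>
  Take the least dyadic scale \<open>s = 2\<^sup>i\<close> at which \<open>w / s\<close> has energy at most 1. One step earlier the energy exceeds 1 but is at most \<open>C\<close>,
  so \<open>v = 2 w / s\<close> defines a functional of bounded size with \<open>\<integral> G(v) w \<ge> (s / 2) \<integral> \<Phi> \<bar>v\<bar> \<ge> s / 2\<close>.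
\<close>

lemma hump:
  assumes w: "w \<in> H" and big: "energy w > C ^ M" 
  obtains v s where "finite_energy v" "energy v \<le> C" "s \<ge> 2 ^ M" "energy (\<lambda>t. w t / s) \<le> 1" "s / 2 \<le> (LINT t|unit_interval. G (v t) * w t)"
proof -
  have fw: "finite_energy (\<lambda>t. w t / 2 ^ i)" and hw: "(\<lambda>t. w t / 2 ^ i) \<in> H" for i
    using heart_cmult[OF w, of "1 / 2 ^ i"] by (auto intro: heart_imp_finite_energy)
  define Q where "Q i \<longleftrightarrow> energy (\<lambda>t. w t / 2 ^ i) \<le> 1" for i :: nat
  have "\<exists>i. Q i"
  proof -
    obtain i :: nat where i: "C * energy w < 2 ^ i" using real_arch_pow[of 2] by auto
    have "energy (\<lambda>t. (1 / 2 ^ i) * w t) \<le> C * (1 / 2 ^ i) powr p * energy w" by (intro energy_scale heart_imp_finite_energy w) auto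
    also have "\<dots> \<le> C * (1 / 2 ^ i) powr 1 * energy w"
      using p D_le_C energy_nonneg[of w] by (intro mult_right_mono mult_left_mono powr_mono') auto
    also have "\<dots> \<le> 1" using i by (simp add: divide_simps)
    finally show ?thesis by (auto simp: Q_def)
  qed
  define i where "i = (LEAST i. Q i)"
  have i: "Q i" unfolding i_def using \<open>\<exists>i. Q i\<close> by (rule LeastI_ex)
  have "energy w = energy (\<lambda>t. 2 ^ i * (w t / 2 ^ i))" by simp
  also have "\<dots> \<le> C ^ i * energy (\<lambda>t. w t / 2 ^ i)" by (rule energy_power[OF fw])
  also have "\<dots> \<le> C ^ i * 1" using i D_le_C by (intro mult_left_mono) (auto simp: Q_def)
  finally have "C ^ M < C ^ i" using big by simp
  then have Mi: "M < i" using D_le_C(4) power_increasing[of i M C] by (metis linorder_not_le)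
  then obtain j where j: "i = Suc j" by (cases i) auto
  have "\<not> Q j" unfolding i_def using j not_less_Least[of j Q] by (simp add: i_def)
  then have Pv: "energy (\<lambda>t. w t / 2 ^ j) > 1" by (simp add: Q_def)
  define v where "v t = w t / 2 ^ j" for t
  have fv: "finite_energy v" unfolding v_def by (rule fw)
  have "energy v = energy (\<lambda>t. 2 ^ 1 * (w t / 2 ^ i))" unfolding v_def j by simp
  also have "\<dots> \<le> C ^ 1 * energy (\<lambda>t. w t / 2 ^ i)" by (rule energy_power[OF fw])
  also have "\<dots> \<le> C * 1" using i D_le_C by (simp add: Q_def)
  finally have PvC: "energy v \<le> C" by simp
  have "energy v \<le> (LINT t|unit_interval. G (v t) * v t)" unfolding energy_def
  proof (intro integral_mono finite_energyD(2) fv G_integrable)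
    show "\<Phi> \<bar>v t\<bar> \<le> G (v t) * v t" for t
      using Phi_le[of "\<bar>v t\<bar>"] by (auto simp: G_def sgn_if mult.commute)
  qed
  moreover have "v = (\<lambda>t. w t / 2 ^ j)" by (rule ext) (simp add: v_def)
  then have "energy v > 1" using Pv by simp
  ultimately have "1 \<le> (LINT t|unit_interval. G (v t) * v t)" by linarith
  moreover have "(LINT t|unit_interval. G (v t) * w t) = 2 ^ j * (LINT t|unit_interval. G (v t) * v t)"
    unfolding pairing_mult[symmetric] by (simp add: v_def)
  ultimately have "2 ^ j \<le> (LINT t|unit_interval. G (v t) * w t)" by simp
  then have "2 ^ i / 2 \<le> (LINT t|unit_interval. G (v t) * w t)" by (simp add: j)
  moreover have "(2::real) ^ M \<le> 2 ^ i" using Mi by (intro power_increasing) auto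
  ultimately show ?thesis using that[OF fv PvC, of "2 ^ i"] i by (simp add: Q_def)
qed

text \<open>
  Gliding hump: from a sequence of unbounded energy choose terms \<open>f (n k)\<close> of rapidly growing scale \<open>s k\<close> with functionals \<open>G (v k)\<close>
  that detect them, each earlier functional being at most 1 on later terms. The sum of these
  functionals with weights \<open>e\<^sup>k\<close> is continuous, but at least 1 on every \<open>f (n k)\<close>: the \<open>k\<close>-th summand beats the earlier
  ones since \<open>e\<^sup>k s k\<close> is large, and the later ones since \<open>e\<close> is small.
\<close>

lemma weakly_null_bounded:
  assumes f: "\<And>n. f n \<in> H" and wn: "weakly_null \<phi> f" shows "\<exists>K. \<forall>n. energy (f n) \<le> K"
proof (rule ccontr)
  assume unb: "\<not> ?thesis"
  have later: "\<exists>n\<ge>N. energy (f n) > K" for N K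
  proof -
    obtain n where n: "energy (f n) > max K (\<Sum>i<N. energy (f i))" using unb by (meson not_le)
    have "n \<ge> N"
    proof (rule ccontr)
      assume "\<not> n \<ge> N"
      then have "energy (f n) \<le> (\<Sum>i<N. energy (f i))" by (intro member_le_sum) (auto simp: energy_nonneg)
      with n show False by simp
    qed
    with n show ?thesis by auto
  qed
  \<comment> \<open>Bound of the detecting functionals at scale 1; \<open>e\<close> is chosen such that \<open>A (e + e\<^sup>2 + ...) = 1/4\<close>.\<close>
  define A where "A = C * (C + 1)"
  have A: "A \<ge> 1" using D_le_C(4) mult_mono[of 1 C 1 "C + 1"] by (simp add: A_def)
  define e where "e = 1 / (4 * A + 1)"
  have e: "0 < e" "e < 1" "e \<le> 1 / 5" using A by (auto simp: e_def field_simps)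
  have eA: "e / (1 - e) * A = 1 / 4" using A by (simp add: e_def field_simps)
  let ?L = "\<lambda>v u. LINT t|unit_interval. G (v t) * u t"
  define good where "good k n v s N \<longleftrightarrow> finite_energy v \<and> energy v \<le> C \<and> s \<ge> 12 / e ^ k \<and> energy (\<lambda>t. f n t / s) \<le> 1 \<and>
      s / 2 \<le> ?L v (f n) \<and> (\<forall>m\<ge>N. \<bar>?L v (f m)\<bar> \<le> 1)" for k :: nat and n v s and N :: nat
  have ex: "\<exists>n v s N. good k n v s N \<and> n0 \<le> n \<and> n0 \<le> N" for k n0
  proof -
    obtain M :: nat where M: "12 / e ^ k < 2 ^ M" using real_arch_pow[of 2] by auto
    obtain n where n: "n \<ge> n0" "energy (f n) > C ^ M" using later by blast
    obtain v s where v: "finite_energy v" "energy v \<le> C" "s \<ge> 2 ^ M" "energy (\<lambda>t. f n t / s) \<le> 1" "s / 2 \<le> ?L v (f n)"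
      using hump[OF f n(2)] by blast
    have "(\<lambda>m. ?L v (f m)) \<longlonglongrightarrow> 0" by (rule bspec[OF wn[unfolded weakly_null_def] pairing_dual[OF v(1)]])
    from LIMSEQ_D[OF this zero_less_one] obtain N where N: "\<And>m. m \<ge> N \<Longrightarrow> \<bar>?L v (f m)\<bar> < 1" by auto
    have "good k n v s (max N n0)" unfolding good_def using v M N by (auto intro: less_imp_le)
    with n(1) show ?thesis by (intro exI[of _ n] exI[of _ v] exI[of _ s] exI[of _ "max N n0"]) auto
  qed
  define Q where "Q k x \<longleftrightarrow> (case x of (n, v, s, N) \<Rightarrow> good k n v s N)" for k and x :: "nat \<times> (real \<Rightarrow> real) \<times> real \<times> nat"
  define R where "R x y \<longleftrightarrow> (case x of (n, v, s, N) \<Rightarrow> case y of (n', v', s', N') \<Rightarrow> max (Suc n) N \<le> n' \<and> N \<le> N')"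
    for x y :: "nat \<times> (real \<Rightarrow> real) \<times> real \<times> nat"
  have "\<exists>x. \<forall>k. Q k (x k) \<and> R (x k) (x (Suc k))"
  proof (rule dependent_nat_choice)
    show "\<exists>x. Q 0 x" using ex[of 0 0] by (auto simp: Q_def)
    fix x k assume "Q k x"
    obtain n v s N where x: "x = (n, v, s, N)" by (cases x) auto
    obtain n' v' s' N' where "good (Suc k) n' v' s' N'" "max (Suc n) N \<le> n'" "max (Suc n) N \<le> N'"
      using ex[of "Suc k" "max (Suc n) N"] by blast
    then show "\<exists>y. Q (Suc k) y \<and> R x y" by (intro exI[of _ "(n', v', s', N')"]) (auto simp: Q_def R_def x)
  qed
  then obtain x where x: "\<And>k. Q k (x k)" "\<And>k. R (x k) (x (Suc k))" by blast
  define n v s N where "n k = fst (x k)" and "v k = fst (snd (x k))" and "s k = fst (snd (snd (x k)))" and "N k = snd (snd (snd (x k)))" for k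
  have xk: "x k = (n k, v k, s k, N k)" for k by (simp add: n_def v_def s_def N_def)
  have good: "good k (n k) (v k) (s k) (N k)" for k using x(1)[of k] by (simp add: Q_def xk)
  have step: "Suc (n k) \<le> n (Suc k)" "N k \<le> n (Suc k)" "N k \<le> N (Suc k)" for k
    using x(2)[of k] by (auto simp: R_def xk)
  have n_mono: "strict_mono n" unfolding strict_mono_Suc_iff using step(1) by (simp add: Suc_le_eq)
  have N_mono: "N j \<le> N k" if "j \<le> k" for j k by (rule lift_Suc_mono_le[of N]) (use step(3) that in auto)
  have N_n: "N j \<le> n k" if "j < k" for j k
  proof -
    obtain i where i: "k = Suc i" "j \<le> i" using \<open>j < k\<close> by (cases k) auto
    then show ?thesis using N_mono[of j i] step(2)[of i] by simp
  qed
  have v: "finite_energy (v k)" "energy (v k) \<le> C" for k using good[of k] by (auto simp: good_def)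
  have s: "s k \<ge> 12 / e ^ k" "s k > 0" for k
  proof -
    show 1: "s k \<ge> 12 / e ^ k" using good[of k] by (simp add: good_def)
    have "12 / e ^ k > 0" using e by simp
    with 1 show "s k > 0" by linarith
  qed
  define \<Lambda> where "\<Lambda> u = (\<Sum>k. e ^ k * ?L (v k) u)" for u
  have geo: "summable (\<lambda>k. e ^ k * b)" "(\<Sum>k. e ^ k * b) = b / (1 - e)" for b
    using e geometric_sums[of e] by (auto simp: sums_iff suminf_mult2[symmetric] intro: summable_mult2)
  have term_bound: "\<bar>e ^ k * ?L (v k) u\<bar> \<le> e ^ k * (C * (C + q) * c)" if "u \<in> H" "c > 0" "energy (\<lambda>t. u t / c) \<le> q" for k u c q
  proof -
    have "\<bar>?L (v k) u\<bar> \<le> C * (energy (v k) + q) * c" by (rule pairing_scaled_bound[OF v(1) that])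
    also have "\<dots> \<le> C * (C + q) * c" using v(2) D_le_C that by (intro mult_right_mono mult_left_mono add_right_mono) auto
    finally show ?thesis using e by (simp add: abs_mult mult_left_mono)
  qed
  have summ: "summable (\<lambda>k. e ^ k * ?L (v k) u)" if u: "u \<in> H" for u
    by (rule summable_comparison_test'[OF geo(1)[of "C * (C + energy (\<lambda>t. u t / 1)) * 1"]])
      (use term_bound[OF u, of 1] in simp)
  have \<Lambda>: "\<Lambda> \<in> heart_dual \<phi>"
  proof (rule heart_dualI[where A="C * (C + (B + 1)) / (1 - e)"])
    fix u w assume u: "u \<in> H" and w: "w \<in> H"
    show "\<Lambda> (\<lambda>t. u t + w t) = \<Lambda> u + \<Lambda> w"
      unfolding \<Lambda>_def suminf_add[OF summ[OF u] summ[OF w]] pairing_add[OF v(1) u w] by (simp add: distrib_left)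
  next
    fix u a assume u: "u \<in> H"
    show "\<Lambda> (\<lambda>t. a * u t) = a * \<Lambda> u"
      unfolding \<Lambda>_def suminf_mult[OF summ[OF u], symmetric] pairing_mult by (simp add: mult.left_commute)
  next
    fix u and c :: real assume u: "u \<in> H" and c: "c > 0" and le: "\<rho> (\<lambda>t. u t / c) \<le> 1"
    let ?b = "C * (C + (B + 1)) * c"
    have tb: "\<bar>e ^ k * ?L (v k) u\<bar> \<le> e ^ k * ?b" for k by (rule term_bound[OF u c scaled_energy[OF u le]])
    have abss: "summable (\<lambda>k. \<bar>e ^ k * ?L (v k) u\<bar>)"
      by (rule summable_comparison_test'[OF geo(1)[of ?b]]) (use tb in simp)
    have "\<bar>\<Lambda> u\<bar> \<le> (\<Sum>k. \<bar>e ^ k * ?L (v k) u\<bar>)" unfolding \<Lambda>_def by (rule summable_rabs[OF abss])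
    also have "\<dots> \<le> (\<Sum>k. e ^ k * ?b)" by (rule suminf_le[OF tb abss geo(1)])
    finally show "\<bar>\<Lambda> u\<bar> \<le> C * (C + (B + 1)) / (1 - e) * c" unfolding geo(2) by simp
  qed
  have big: "1 \<le> \<Lambda> (f (n k))" for k
  proof -
    let ?a = "\<lambda>j. e ^ j * ?L (v j) (f (n k))"
    have g: "energy (\<lambda>t. f (n k) t / s k) \<le> 1" "s k / 2 \<le> ?L (v k) (f (n k))" using good[of k] by (auto simp: good_def)
    have tail_b: "\<bar>?a (j + Suc k)\<bar> \<le> e ^ j * (e ^ Suc k * (A * s k))" for j
    proof -
      have "e ^ (j + Suc k) * (C * (C + 1) * s k) = e ^ j * (e ^ Suc k * (A * s k))"
        by (simp only: A_def power_add mult.assoc)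
      with term_bound[OF f s(2) g(1), of "j + Suc k"] show ?thesis by (simp only:)
    qed
    have tabs: "summable (\<lambda>j. \<bar>?a (j + Suc k)\<bar>)"
      by (rule summable_comparison_test'[OF geo(1)[of "e ^ Suc k * (A * s k)"]]) (use tail_b in simp)
    have "\<bar>\<Sum>j. ?a (j + Suc k)\<bar> \<le> (\<Sum>j. \<bar>?a (j + Suc k)\<bar>)" by (rule summable_rabs[OF tabs])
    also have "\<dots> \<le> (\<Sum>j. e ^ j * (e ^ Suc k * (A * s k)))" by (rule suminf_le[OF tail_b tabs geo(1)])
    also have "\<dots> = (e / (1 - e) * A) * (e ^ k * s k)" unfolding geo(2) by simp
    also have "\<dots> = e ^ k * s k / 4" unfolding eA by simp
    finally have tail: "\<bar>\<Sum>j. ?a (j + Suc k)\<bar> \<le> e ^ k * s k / 4" .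
    have "\<bar>\<Sum>j<k. ?a j\<bar> \<le> (\<Sum>j<k. \<bar>?a j\<bar>)" by (rule sum_abs)
    also have "\<dots> \<le> (\<Sum>j<k. e ^ j * 1)"
    proof (intro sum_mono)
      fix j assume "j \<in> {..<k}"
      then have "\<bar>?L (v j) (f (n k))\<bar> \<le> 1" using good[of j] N_n[of j k] by (simp add: good_def)
      then show "\<bar>?a j\<bar> \<le> e ^ j * 1" unfolding abs_mult using e by (intro mult_mono) auto
    qed
    also have "\<dots> \<le> (\<Sum>j. e ^ j * 1)" using e by (intro sum_le_suminf geo(1)) auto
    also have "\<dots> = 1 / (1 - e)" by (rule geo(2))
    also have "\<dots> \<le> 2" using e by (simp add: divide_simps)
    finally have head: "\<bar>\<Sum>j<k. ?a j\<bar> \<le> 2" .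
    have "\<Lambda> (f (n k)) = (\<Sum>j. ?a (j + Suc k)) + (\<Sum>j<Suc k. ?a j)"
      unfolding \<Lambda>_def by (rule suminf_split_initial_segment[OF summ[OF f]])
    then have eq: "\<Lambda> (f (n k)) = (\<Sum>j. ?a (j + Suc k)) + (\<Sum>j<k. ?a j) + ?a k" by simp
    have mid: "e ^ k * s k / 2 \<le> ?a k" using mult_left_mono[OF g(2), of "e ^ k"] e by simp
    have "12 \<le> e ^ k * s k" using s(1)[of k] e by (simp add: divide_simps mult.commute)
    with tail head mid show ?thesis unfolding eq by linarith
  qed
  have "(\<lambda>n. \<Lambda> (f n)) \<longlonglongrightarrow> 0" using wn \<Lambda> unfolding weakly_null_def by blast
  from LIMSEQ_D[OF this zero_less_one] obtain n0 where n0: "\<And>m. m \<ge> n0 \<Longrightarrow> \<bar>\<Lambda> (f m)\<bar> < 1" by auto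
  have "n n0 \<ge> n0" using seq_suble[OF n_mono] .
  from n0[OF this] big[of n0] show False by simp
qed

lemma weakly_null_convergent_subsequence:
  assumes f: "\<And>n. f n \<in> H" and wn: "weakly_null \<phi> f"
  obtains r where "strict_mono (r::nat\<Rightarrow>nat)" "order_converges \<phi> (cesaro (f \<circ> r)) (\<lambda>t. 0)"
proof -
  obtain K where K: "\<And>n. energy (f n) \<le> K" using weakly_null_bounded[OF f wn] by blast
  have weak: "(\<lambda>n. LINT t|unit_interval. G (v t) * (f n t - 0)) \<longlonglongrightarrow> 0" if "finite_energy v" for v
    using bspec[OF wn[unfolded weakly_null_def] pairing_dual[OF that]] by simp
  show ?thesis
    by (rule convergent_subsequence[of f "\<lambda>t. 0" K]) (use f K weak finite_energy_imp_heart[OF finite_energy_0] that in auto)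
qed

lemma sufficiency: "oBSP \<phi> \<and> w_oBSP \<phi> \<and> BSP \<phi>"
proof (intro conjI)
  show "oBSP \<phi>" unfolding oBSP_def
    by (intro allI impI, elim conjE, erule_tac bounded_convergent_subsequence[rotated]) blast+
  show "BSP \<phi>" unfolding BSP_def
    by (intro allI impI, elim conjE, erule_tac bounded_convergent_subsequence[rotated]) blast+
  show "w_oBSP \<phi>" unfolding w_oBSP_def
    by (intro allI impI, elim conjE, erule_tac weakly_null_convergent_subsequence[rotated]) (use finite_energy_imp_heart[OF finite_energy_0] in blast)+
qed

end

section \<open>The equivalence\<close>

theorem theorem3p6:
  fixes \<phi> \<psi> :: "real \<Rightarrow> real"
  assumes "orlicz_function \<phi>"
    and "\<And>s. s \<ge> 0 \<Longrightarrow> ereal (\<psi> s) = orlicz_conjugate \<phi> s"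
    and "orlicz_function \<psi>"
  shows "(oBSP \<phi> \<longleftrightarrow> w_oBSP \<phi>) \<and> (w_oBSP \<phi> \<longleftrightarrow> BSP \<phi>) \<and> (BSP \<phi> \<longleftrightarrow> delta2 \<phi> \<and> delta2 \<psi>)"
proof -
  interpret orlicz_pair \<phi> \<psi> using assms by unfold_locales
  have conjugate_growth: "delta2 \<psi> \<longleftrightarrow> nabla2 \<phi>"
    using nabla2_if_delta2_conjugate delta2_conjugate_if_nabla2 by blast
  have "oBSP \<phi> \<and> w_oBSP \<phi> \<and> BSP \<phi>" if growth: "delta2 \<phi>" "nabla2 \<phi>"
  proof -
    obtain g L E B where "gauge g L E" "B \<ge> 0"
      "\<And>x. 0 \<le> x \<Longrightarrow> \<phi> x \<le> B + x * g x" "\<And>x. 0 \<le> x \<Longrightarrow> x * g x \<le> B + \<phi> x"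
      using gauge_exists[OF growth] by blast
    then interpret orlicz_gauge \<phi> g L E B
      by (intro orlicz_gauge.intro orlicz_axioms orlicz_gauge_axioms.intro)
    show ?thesis by (rule sufficiency)
  qed
  then show ?thesis using necessity conjugate_growth by blast
qed

end
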